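(* Let $p,q\geqslant 0$ be integers with $q\neq p+1$, let $\lambda,\mu\in\mathbb{R}$ and $\delta=\mu-\lambda$. If $\delta$ is not critical, then there exists a unique projectively equivariant quantization over $\mathbb{R}^{p|q}$ from $\mathcal{S}_{\delta}$ to $\mathcal{D}_{\lambda,\mu}$.
   Context: All Lie superalgebras are over $\mathbb{R}$. The parity of a homogeneous object $a$ is $\tilde a$; for an index $i\in\{1,\ldots,p+q\}$, $\tilde i=0$ if $i\leqslant p$ and $\tilde i=1$ otherwise. The coordinates of $\mathbb{R}^{p|q}$ are $y^1,\ldots,y^{p+q}$, where $y^1=x^1,\ldots,y^p=x^p$ are even and $y^{p+1}=\theta^1,\ldots,y^{p+q}=\theta^q$ are odd (anticommuting), so $\tilde{y^i}=\tilde i$. $\mathcal{F}=C^\infty(\mathbb{R}^{p|q})=C^\infty(\mathbb{R}^p)\otimes\Lambda(\theta^1,\ldots,\theta^q)$, and $\mathrm{Vect}(\mathbb{R}^{p|q})$ is the Lie superalgebra of vector fields $X=\sum_i X^i\partial_{y^i}$, $X^i\in\mathcal{F}$. Formulas with signs are written for homogeneous elements and extended linearly. Let $e_1,\ldots,e_{p+q}$ be the standard basis of the superspace $\mathbb{R}^{p|q}$ (parity of $e_i$ is $\tilde i$), and let $\mathrm{str}(A)=\sum_i(-1)^{\tilde i}A^i_i$ for $A\in\mathfrak{gl}(p|q)$. Densities. For $X=\sum_i X^i\partial_{y^i}$ put $\mathrm{div}(X)=\sum_i(-1)^{\tilde{y^i}\widetilde{X^i}}\partial_{y^i}X^i$.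 $\mathcal{F}_\lambda$ is the space $\mathcal{F}$ with the action $L^\lambda_Xf=X(f)+\lambda\,\mathrm{div}(X)f$ of $\mathrm{Vect}(\mathbb{R}^{p|q})$. Symbols. $S^k$ is the degree $k$ part of the (super)symmetric algebra of $\mathbb{R}^{p|q}$, with product $\vee$ satisfying $v\vee w=(-1)^{\tilde v\tilde w}w\vee v$. $\mathfrak{gl}(p|q)$ acts on $S^k$ by $\rho(A)(v_1\vee\cdots\vee v_k)=\sum_j(-1)^{\tilde A(\tilde v_1+\cdots+\tilde v_{j-1})}v_1\vee\cdots\vee Av_j\vee\cdots\vee v_k$. $B^\delta$ is the space of dimension $1|0$ spanned by $u$ with $\rho(A)u=-\delta\,\mathrm{str}(A)u$, and $S^k_\delta=B^\delta\otimes S^k$ with the tensor product representation $\rho$. $\mathcal{S}^k_\delta=\mathcal{F}\otimes S^k_\delta$ with the action $$L_X(f\otimes v)=X(f)\otimes v+(-1)^{\widetilde X\tilde f}\sum_{i,j}fJ_i^j\otimes\rho(e^i_j)v,\qquad J_i^j=(-1)^{\tilde{y^i}\widetilde X+1}\partial_{y^i}X^j,$$ where $e^i_j(e_k)=\delta^i_ke_j$; and $\mathcal{S}_\delta=\bigoplus_{k\geqslant 0}\mathcal{S}^k_\delta$. The generator $u$ is omitted from the notation. Differential operators. $\mathcal{D}_{\lambda,\mu}$ is the space of linear differential operators $\mathcal{F}_\lambda\to\mathcal{F}_\mu$ with action $\mathcal{L}_XD=L^\mu_X\circ D-(-1)^{\widetilde X\widetilde D}D\circ L^\lambda_X$; $\mathcal{D}^k_{\lambda,\mu}$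 is the subspace of operators of order at most $k$. Every $D\in\mathcal{D}^k_{\lambda,\mu}$ is uniquely $D=\sum_{|\alpha|\leqslant k}f_\alpha\,\partial_{y^1}^{\alpha_1}\cdots\partial_{y^{p+q}}^{\alpha_{p+q}}$ with $f_\alpha\in\mathcal{F}$ and $\alpha_{p+1},\ldots,\alpha_{p+q}\in\{0,1\}$. The principal symbol is $\sigma_k\colon\mathcal{D}^k_{\lambda,\mu}\to\mathcal{S}^k_\delta$, $D\mapsto\sum_{|\alpha|=k}f_\alpha\otimes e_1^{\alpha_1}\vee\cdots\vee e_{p+q}^{\alpha_{p+q}}$, with $\delta=\mu-\lambda$. A quantization is a linear bijection $Q\colon\mathcal{S}_\delta\to\mathcal{D}_{\lambda,\mu}$ such that $Q(T)\in\mathcal{D}^k_{\lambda,\mu}$ and $\sigma_k(Q(T))=T$ for all $T\in\mathcal{S}^k_\delta$ and all $k\in\mathbb{N}$. Projective superalgebra. $\mathfrak{pgl}(p+1|q)=\mathfrak{gl}(p+1|q)/\mathbb{R}\,\mathrm{Id}$ is identified with $\mathfrak{g}_{-1}\oplus\mathfrak{g}_0\oplus\mathfrak{g}_1$, $\mathfrak{g}_{-1}=\mathbb{R}^{p|q}$ (columns), $\mathfrak{g}_0=\mathfrak{gl}(p|q)$, $\mathfrak{g}_1=(\mathbb{R}^{p|q})^*$ (rows), through $\left[\begin{pmatrix}a&\xi\\ h&A\end{pmatrix}\right]\mapsto(h,A-a\,\mathrm{Id},\xi)$. It is realized in $\mathrm{Vect}(\mathbb{R}^{p|q})$ by the linear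 map $h\mapsto X^h$ with $X^v=-\sum_iv^i\partial_{y^i}$ for $v\in\mathfrak{g}_{-1}$, $X^A=-\sum_{i,j}(-1)^{\tilde j(\tilde i+\tilde j)}A^i_jy^j\partial_{y^i}$ for $A\in\mathfrak{g}_0$, and $X^\xi=\sum_j\xi_jy^j(-1)^{\tilde j}\mathcal{E}$ for $\xi\in\mathfrak{g}_1$, where $\mathcal{E}=\sum_iy^i\partial_{y^i}$. A quantization $Q\colon\mathcal{S}_\delta\to\mathcal{D}_{\lambda,\mu}$ is projectively equivariant if $\mathcal{L}_{X^h}\circ Q=Q\circ L_{X^h}$ for every $h\in\mathfrak{pgl}(p+1|q)$. Critical values ($q\neq p+1$). Set $\alpha(k,\delta)=\frac{p-q}{2}\delta^2-\frac{2k+p-q}{2}\delta+\frac{k(k+(p-q))}{p-q+1}$. The value $\delta$ is critical if there exist $k,l\in\mathbb{N}$ with $l<k$ and $\alpha(k,\delta)=\alpha(l,\delta)$. *)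

theory Defs
  imports "HOL-Analysis.Analysis" "HOL-Library.Function_Algebras" "HOL-Library.Multiset"
begin

text \<open>All spaces below (superfunctions, vector fields, symbols, operators) are spaces of functions
  with pointwise linear structure.\<close>

instantiation "fun" :: (type, real_vector) real_vector
begin

definition scaleR_fun :: "real \<Rightarrow> ('a \<Rightarrow> 'b) \<Rightarrow> 'a \<Rightarrow> 'b" where
  "scaleR_fun c f = (\<lambda>x. c *\<^sub>R f x)"

instance
  by standard (auto simp: scaleR_fun_def fun_eq_iff scaleR_add_right scaleR_add_left)

end

text \<open>A superfunction \<open>f = \<Sum>I. f\<^sub>I \<theta>\<^sup>I\<close> is the family of its coefficients. The set \<open>I\<close> consists of
  indices of odd coordinates and \<open>\<theta>\<^sup>I\<close> is the product of the odd coordinates with index in \<open>I\<close>, taken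
  in increasing order of the index. A point of \<open>\<real>\<^sup>p\<close> is a sequence of which only the entries with
  index \<open>1, \<dots>, p\<close> matter.\<close>

type_synonym point = "nat \<Rightarrow> real"
type_synonym sfun = "nat set \<Rightarrow> point \<Rightarrow> real"

type_synonym vfield = "nat \<Rightarrow> sfun"                  \<comment> \<open>the components \<open>X\<^sup>i\<close>\<close>
type_synonym oper = "sfun \<Rightarrow> sfun"
type_synonym vec = "nat \<Rightarrow> real"
type_synonym matr = "nat \<Rightarrow> nat \<Rightarrow> real"             \<comment> \<open>\<open>A i j\<close> is the entry in row \<open>i\<close>, column \<open>j\<close>\<close>

text \<open>A multi-index \<open>\<alpha>\<close> is the multiset in which \<open>i\<close> occurs \<open>\<alpha>\<^sub>i\<close> times. An element of the
  supersymmetric algebra is given by its coordinates in the basis of the monomials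
  \<open>e\<^sup>\<alpha> = e\<^sub>1\<^sup>\<alpha>\<^sup>1 \<or> e\<^sub>2\<^sup>\<alpha>\<^sup>2 \<or> \<dots>\<close>, and a symbol \<open>\<Sum>\<alpha>. f\<^sub>\<alpha> \<otimes> e\<^sup>\<alpha>\<close> by its coefficients \<open>f\<^sub>\<alpha>\<close>.\<close>

type_synonym sym = "nat multiset \<Rightarrow> real"
type_synonym symbol = "nat multiset \<Rightarrow> sfun"

definition partial :: "nat \<Rightarrow> (point \<Rightarrow> real) \<Rightarrow> point \<Rightarrow> real" where
  "partial i g = (\<lambda>x. deriv (\<lambda>t. g (x(i := t))) (x i))"

text \<open>The sign in \<open>\<theta>\<^sup>I \<theta>\<^sup>J = (-1)\<^bsup>inversions I J\<^esup> \<theta>\<^sup>I\<^sup>\<union>\<^sup>J\<close> for disjoint \<open>I\<close>, \<open>J\<close>.\<close>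

definition inversions :: "nat set \<Rightarrow> nat set \<Rightarrow> nat" where
  "inversions I J = card {(i, j). i \<in> I \<and> j \<in> J \<and> j < i}"

definition sfun_mult :: "sfun \<Rightarrow> sfun \<Rightarrow> sfun" (infixl "\<star>" 70) where
  "f \<star> g = (\<lambda>K x. \<Sum>I\<in>Pow K. (-1) ^ inversions I (K - I) * f I x * g (K - I) x)"

text \<open>Parities are natural numbers that matter modulo 2. Formulas with signs, given for homogeneous
  arguments, are extended linearly by summing over the homogeneous components (\<open>fpart\<close>, \<open>vpart\<close>,
  \<open>mpart\<close>, \<open>opart\<close>) of parity \<open>0\<close> and \<open>1\<close>.\<close>

definition fpart :: "nat \<Rightarrow> sfun \<Rightarrow> sfun" where
  "fpart a f = (\<lambda>I. if even (card I + a) then f I else 0)"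

definition opart :: "nat \<Rightarrow> oper \<Rightarrow> oper" where
  "opart a D = (\<lambda>f. \<Sum>b<2. fpart (a + b) (D (fpart b f)))"

text \<open>The matrix \<open>e\<^sup>i\<^sub>j\<close>, which sends \<open>e\<^sub>i\<close> to \<open>e\<^sub>j\<close> and the other basis vectors to \<open>0\<close>.\<close>

definition unit_matr :: "nat \<Rightarrow> nat \<Rightarrow> matr" where
  "unit_matr i j = (\<lambda>k l. if k = j \<and> l = i then 1 else 0)"

definition unit_vec :: "nat \<Rightarrow> vec" where
  "unit_vec i = (\<lambda>k. if k = i then 1 else 0)"

locale superspace =
  fixes p q :: nat
begin

definition par :: "nat \<Rightarrow> nat" where
  "par i = (if i \<le> p then 0 else 1)"

definition smooth :: "(point \<Rightarrow> real) \<Rightarrow> bool" where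
  "smooth g \<longleftrightarrow>
     (\<forall>x y. (\<forall>i\<in>{1..p}. x i = y i) \<longrightarrow> g x = g y) \<and>
     (\<forall>is. set is \<subseteq> {1..p} \<longrightarrow>
        continuous_on UNIV (foldr partial is g) \<and>
        (\<forall>i\<in>{1..p}. \<forall>x. (\<lambda>t. foldr partial is g (x(i := t))) differentiable (at (x i))))"

definition sfuns :: "sfun set" where
  "sfuns = {f. (\<forall>I. smooth (f I)) \<and> (\<forall>I. \<not> I \<subseteq> {p+1..p+q} \<longrightarrow> f I = 0)}"

definition coord :: "nat \<Rightarrow> sfun" where
  "coord i = (if i \<le> p then (\<lambda>I x. if I = {} then x i else 0) else (\<lambda>I x. if I = {i} then 1 else 0))"

text \<open>For odd \<open>y\<^sup>i\<close> this is the left derivative.\<close>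

definition pderiv :: "nat \<Rightarrow> sfun \<Rightarrow> sfun" where
  "pderiv i f = (if i \<le> p then (\<lambda>I. partial i (f I))
     else (\<lambda>I. if i \<in> I then 0 else (-1) ^ card {j\<in>I. j < i} *\<^sub>R f (insert i I)))"

definition vpart :: "nat \<Rightarrow> vfield \<Rightarrow> vfield" where
  "vpart a X = (\<lambda>i. fpart (a + par i) (X i))"

definition vf_apply :: "vfield \<Rightarrow> oper" where
  "vf_apply X f = (\<Sum>i\<in>{1..p+q}. X i \<star> pderiv i f)"

definition dvg :: "vfield \<Rightarrow> sfun" where
  "dvg X = (\<Sum>i\<in>{1..p+q}. \<Sum>a<2. (-1) ^ (par i * a) *\<^sub>R pderiv i (fpart a (X i)))"

definition lie_density :: "real \<Rightarrow> vfield \<Rightarrow> oper" where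
  "lie_density lam X f = vf_apply X f + lam *\<^sub>R (dvg X \<star> f)"

definition mpart :: "nat \<Rightarrow> matr \<Rightarrow> matr" where
  "mpart a A = (\<lambda>i j. if even (par i + par j + a) then A i j else 0)"

definition matr_apply :: "matr \<Rightarrow> vec \<Rightarrow> vec" where
  "matr_apply A v = (\<lambda>i. \<Sum>j\<in>{1..p+q}. A i j * v j)"

definition str :: "matr \<Rightarrow> real" where
  "str A = (\<Sum>i\<in>{1..p+q}. (-1) ^ par i * A i i)"

definition midx :: "nat multiset set" where
  "midx = {\<alpha>. set_mset \<alpha> \<subseteq> {1..p+q} \<and> (\<forall>i. p < i \<longrightarrow> count \<alpha> i \<le> 1)}"

text \<open>The number of transpositions of two odd vectors needed to reorder \<open>e\<^sup>\<alpha> \<or> e\<^sup>\<beta>\<close> into \<open>e\<^sup>\<alpha>\<^sup>+\<^sup>\<beta>\<close>, when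
  \<open>\<alpha> + \<beta>\<close> is a multi-index; otherwise the product vanishes.\<close>

definition sym_inversions :: "nat multiset \<Rightarrow> nat multiset \<Rightarrow> nat" where
  "sym_inversions \<alpha> \<beta> = card {(i, j). i \<in># \<alpha> \<and> j \<in># \<beta> \<and> p < j \<and> j < i}"

definition vee :: "sym \<Rightarrow> sym \<Rightarrow> sym" where
  "vee s t = (\<lambda>\<gamma>. if \<gamma> \<in> midx
     then \<Sum>\<alpha> | \<alpha> \<subseteq># \<gamma>. (-1) ^ sym_inversions \<alpha> (\<gamma> - \<alpha>) * s \<alpha> * t (\<gamma> - \<alpha>) else 0)"

definition sym_one :: sym where
  "sym_one = (\<lambda>\<alpha>. if \<alpha> = {#} then 1 else 0)"

definition sym_vec :: "vec \<Rightarrow> sym" where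
  "sym_vec v = (\<lambda>\<alpha>. \<Sum>i\<in>{1..p+q}. if \<alpha> = {#i#} then v i else 0)"

definition vees :: "vec list \<Rightarrow> sym" where
  "vees vs = foldr (\<lambda>v s. vee (sym_vec v) s) vs sym_one"

text \<open>\<open>rho A \<alpha>\<close> is \<open>\<rho>(A) e\<^sup>\<alpha>\<close> in the supersymmetric algebra, where \<open>e\<^sup>\<alpha> = v\<^sub>1 \<or> \<dots> \<or> v\<^sub>k\<close> with basis
  vectors \<open>v\<^sub>m\<close> (listed from \<open>0\<close> in the code); \<open>rho_dens d A \<alpha>\<close> is \<open>\<rho>(A) (u \<otimes> e\<^sup>\<alpha>)\<close>, where \<open>u\<close> is the
  even generator of \<open>B\<^sup>d\<close>, which is left implicit.\<close>

definition rho :: "matr \<Rightarrow> nat multiset \<Rightarrow> sym" where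
  "rho A \<alpha> = (let w = sorted_list_of_multiset \<alpha>; vs = map unit_vec w in
     \<Sum>a<2. \<Sum>m<length w. (-1) ^ (a * (\<Sum>n<m. par (w ! n))) *\<^sub>R
       vees (vs[m := matr_apply (mpart a A) (vs ! m)]))"

definition rho_dens :: "real \<Rightarrow> matr \<Rightarrow> nat multiset \<Rightarrow> sym" where
  "rho_dens d A \<alpha> = (\<lambda>\<beta>. - d * str A * (if \<beta> = \<alpha> then 1 else 0)) + rho A \<alpha>"

definition symbols :: "symbol set" where
  "symbols = {T. (\<forall>\<alpha>. T \<alpha> \<in> sfuns) \<and> (\<forall>\<alpha>. \<alpha> \<notin> midx \<longrightarrow> T \<alpha> = 0) \<and> finite {\<alpha>. T \<alpha> \<noteq> 0}}"

definition symbols_deg :: "nat \<Rightarrow> symbol set" where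
  "symbols_deg k = {T \<in> symbols. \<forall>\<alpha>. T \<alpha> \<noteq> 0 \<longrightarrow> size \<alpha> = k}"

text \<open>\<open>jac a X i j\<close> is \<open>J\<^sub>i\<^sup>j\<close> for a vector field \<open>X\<close> that is homogeneous of parity \<open>a\<close>.\<close>

definition jac :: "nat \<Rightarrow> vfield \<Rightarrow> nat \<Rightarrow> nat \<Rightarrow> sfun" where
  "jac a X i j = (-1) ^ (par i * a + 1) *\<^sub>R pderiv i (X j)"

definition lie_symbol :: "real \<Rightarrow> vfield \<Rightarrow> symbol \<Rightarrow> symbol" where
  "lie_symbol d X T = (\<lambda>\<beta>. vf_apply X (T \<beta>) +
     (\<Sum>\<alpha> | T \<alpha> \<noteq> 0. \<Sum>a<2. \<Sum>b<2. (-1) ^ (a * b) *\<^sub>R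
        (\<Sum>i\<in>{1..p+q}. \<Sum>j\<in>{1..p+q}.
           rho_dens d (unit_matr i j) \<alpha> \<beta> *\<^sub>R (fpart b (T \<alpha>) \<star> jac a (vpart a X) i j))))"

text \<open>Operators are maps on superfunctions, normalised to be \<open>0\<close> outside \<open>sfuns\<close>, so that equality of
  operators is equality on \<open>sfuns\<close>. A differential operator is given by its coefficients \<open>f\<^sub>\<alpha>\<close>.\<close>

definition pderivs :: "nat multiset \<Rightarrow> oper" where
  "pderivs \<alpha> = foldr pderiv (sorted_list_of_multiset \<alpha>)"

definition diff_op :: "symbol \<Rightarrow> oper" where
  "diff_op c = (\<lambda>f. if f \<in> sfuns then (\<Sum>\<alpha> | c \<alpha> \<noteq> 0. c \<alpha> \<star> pderivs \<alpha> f) else 0)"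

definition coeffs_upto :: "nat \<Rightarrow> symbol set" where
  "coeffs_upto k = {c \<in> symbols. \<forall>\<alpha>. c \<alpha> \<noteq> 0 \<longrightarrow> size \<alpha> \<le> k}"

definition diff_ops_upto :: "nat \<Rightarrow> oper set" where
  "diff_ops_upto k = diff_op ` coeffs_upto k"

definition diff_ops :: "oper set" where
  "diff_ops = (\<Union>k. diff_ops_upto k)"

definition principal_symbol :: "nat \<Rightarrow> oper \<Rightarrow> symbol" where
  "principal_symbol k D =
     (\<lambda>\<alpha>. if size \<alpha> = k then (THE c. c \<in> coeffs_upto k \<and> diff_op c = D) \<alpha> else 0)"

definition lie_op :: "real \<Rightarrow> real \<Rightarrow> vfield \<Rightarrow> oper \<Rightarrow> oper" where
  "lie_op lam mu X D = (\<lambda>f. if f \<in> sfuns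
     then \<Sum>a<2. \<Sum>b<2. lie_density mu (vpart a X) (opart b D f) -
            (-1) ^ (a * b) *\<^sub>R opart b D (lie_density lam (vpart a X) f)
     else 0)"

definition quantization :: "(symbol \<Rightarrow> oper) \<Rightarrow> bool" where
  "quantization Q \<longleftrightarrow>
     (\<forall>T\<in>symbols. \<forall>U\<in>symbols. Q (T + U) = Q T + Q U) \<and>
     (\<forall>c. \<forall>T\<in>symbols. Q (c *\<^sub>R T) = c *\<^sub>R Q T) \<and>
     bij_betw Q symbols diff_ops \<and>
     (\<forall>k. \<forall>T\<in>symbols_deg k. Q T \<in> diff_ops_upto k \<and> principal_symbol k (Q T) = T)"

definition vf_minus1 :: "vec \<Rightarrow> vfield" where
  "vf_minus1 v = (\<lambda>i. (- v i) *\<^sub>R (\<lambda>I x. if I = {} then 1 else 0))"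

definition vf_zero :: "matr \<Rightarrow> vfield" where
  "vf_zero A = (\<lambda>i. - (\<Sum>j\<in>{1..p+q}. ((-1) ^ (par j * (par i + par j)) * A i j) *\<^sub>R coord j))"

definition vf_plus1 :: "vec \<Rightarrow> vfield" where
  "vf_plus1 \<xi> = (\<lambda>i. \<Sum>j\<in>{1..p+q}. (\<xi> j * (-1) ^ par j) *\<^sub>R (coord j \<star> coord i))"

text \<open>A matrix \<open>M\<close> in \<open>gl(p+1|q)\<close> has rows and columns \<open>0, \<dots>, p+q\<close>, index \<open>0\<close> being the additional
  even one, and entries outside this range are ignored. Its class modulo \<open>Id\<close> is identified with
  \<open>(h, A - a Id, \<xi>)\<close>.\<close>

definition vf_pgl :: "matr \<Rightarrow> vfield" where
  "vf_pgl M = vf_minus1 (\<lambda>i. M i 0)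
     + vf_zero (\<lambda>i j. M i j - (if i = j then M 0 0 else 0))
     + vf_plus1 (\<lambda>j. M 0 j)"

definition projectively_equivariant :: "real \<Rightarrow> real \<Rightarrow> (symbol \<Rightarrow> oper) \<Rightarrow> bool" where
  "projectively_equivariant lam mu Q \<longleftrightarrow>
     (\<forall>M. \<forall>T\<in>symbols. lie_op lam mu (vf_pgl M) (Q T) = Q (lie_symbol (mu - lam) (vf_pgl M) T))"

definition crit_poly :: "nat \<Rightarrow> real \<Rightarrow> real" where
  "crit_poly k d = (let n = real p - real q; k = real k in
     n / 2 * d\<^sup>2 - (2 * k + n) / 2 * d + k * (k + n) / (n + 1))"

definition critical :: "real \<Rightarrow> bool" where
  "critical d \<longleftrightarrow> (\<exists>k l. l < k \<and> crit_poly k d = crit_poly l d)"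

end

end

theory Submission
  imports Defs
begin

text \<open>The coordinates \<open>y\<^sup>i\<close>, the derivatives \<open>\<partial>\<^sub>i\<close>, the multiplications by \<open>e\<^sub>i\<close> and the dual
  contractions act on symbols as two supercommuting pairs of canonically conjugate operators.
  Identifying a differential operator with its coefficients, both actions of the projective
  superalgebra become expressions in these operators: they agree on the affine part, while on the
  quadratic field number \<open>j\<close> they differ by a combination of \<open>c\<^sub>j\<close> and \<open>K c\<^sub>j\<close>, where \<open>c\<^sub>j\<close> is the
  contraction and \<open>K\<close> multiplies by the degree. For existence, the divergence \<open>D = \<Sum>i. \<partial>\<^sub>i c\<^sub>i\<close> is
  affinely invariant and its commutators with the quadratic fields are again of this form, so a
  combination of the powers of \<open>D\<close> with suitable coefficients intertwines; noncriticality says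
  that no denominator vanishes. For uniqueness, composing one quantization with the inverse of
  another leaves equivariant maps from symbols of degree \<open>k\<close> to symbols of degree \<open>l\<close>. The Casimir
  element acts on symbols of degree \<open>k\<close> as a scalar, and for noncritical \<open>\<delta>\<close> the scalars differ,
  so that these maps vanish for \<open>k \<noteq> l\<close>.\<close>

subsection \<open>The Weyl superalgebra of symbols\<close>

text \<open>Put n = p - q, w = \<delta> and W = w (n + 1). Everything rests on one condition, W
  \<noteq> k + l + n for k \<noteq> l. It expresses noncriticality because the critical polynomials
  at k and l differ by (k - l) ((k + l + n) / (n + 1) - w). It enters twice. Commuting
  \<open>D\<close> past a quadratic field yields a first-order recursion for the coefficients of the
  powers of \<open>D\<close>; on degree k the denominator of coefficient l + 1 is l + 1 times W - k
  - (k - l - 1) - n. For uniqueness, the two halves of the Casimir combine to a polynomial in E - K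
  plus 2 K (K + n - W), where E is the Euler operator of the coordinates. Up to a multiple of the
  identity, E - K is the sum of the actions of the fields y^j \<partial>_j, so it commutes with
  every equivariant map, and only the eigenvalues of K matter. The recurring obstacle is the signs,
  which the definitions introduce by summing over homogeneous components. The involutions
  \<open>tau\<close> and \<open>hat\<close> absorb these sums, so that sign rules become operator
  identities valid for inhomogeneous symbols and operators.\<close>

locale super_weyl =
  fixes S :: "'v::real_vector set" and I :: "nat set" and par :: "nat \<Rightarrow> nat"
    and m d e c :: "nat \<Rightarrow> 'v \<Rightarrow> 'v"
  assumes subspace_S: "subspace S" and finite_I: "finite I"
    and m_in: "\<And>i T. i \<in> I \<Longrightarrow> T \<in> S \<Longrightarrow> m i T \<in> S"
    and d_in: "\<And>i T. i \<in> I \<Longrightarrow> T \<in> S \<Longrightarrow> d i T \<in> S"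
    and e_in: "\<And>i T. i \<in> I \<Longrightarrow> T \<in> S \<Longrightarrow> e i T \<in> S"
    and c_in: "\<And>i T. i \<in> I \<Longrightarrow> T \<in> S \<Longrightarrow> c i T \<in> S"
    and m_add: "\<And>i T U. i \<in> I \<Longrightarrow> T \<in> S \<Longrightarrow> U \<in> S \<Longrightarrow> m i (T + U) = m i T + m i U"
    and d_add: "\<And>i T U. i \<in> I \<Longrightarrow> T \<in> S \<Longrightarrow> U \<in> S \<Longrightarrow> d i (T + U) = d i T + d i U"
    and e_add: "\<And>i T U. i \<in> I \<Longrightarrow> T \<in> S \<Longrightarrow> U \<in> S \<Longrightarrow> e i (T + U) = e i T + e i U"
    and c_add: "\<And>i T U. i \<in> I \<Longrightarrow> T \<in> S \<Longrightarrow> U \<in> S \<Longrightarrow> c i (T + U) = c i T + c i U"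
    and m_scale: "\<And>i r T. i \<in> I \<Longrightarrow> T \<in> S \<Longrightarrow> m i (r *\<^sub>R T) = r *\<^sub>R m i T"
    and d_scale: "\<And>i r T. i \<in> I \<Longrightarrow> T \<in> S \<Longrightarrow> d i (r *\<^sub>R T) = r *\<^sub>R d i T"
    and e_scale: "\<And>i r T. i \<in> I \<Longrightarrow> T \<in> S \<Longrightarrow> e i (r *\<^sub>R T) = r *\<^sub>R e i T"
    and c_scale: "\<And>i r T. i \<in> I \<Longrightarrow> T \<in> S \<Longrightarrow> c i (r *\<^sub>R T) = r *\<^sub>R c i T"
    and m_m: "\<And>i j T. i \<in> I \<Longrightarrow> j \<in> I \<Longrightarrow> T \<in> S \<Longrightarrow> m i (m j T) = (-1) ^ (par i * par j) *\<^sub>R m j (m i T)"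
    and d_d: "\<And>i j T. i \<in> I \<Longrightarrow> j \<in> I \<Longrightarrow> T \<in> S \<Longrightarrow> d i (d j T) = (-1) ^ (par i * par j) *\<^sub>R d j (d i T)"
    and e_e: "\<And>i j T. i \<in> I \<Longrightarrow> j \<in> I \<Longrightarrow> T \<in> S \<Longrightarrow> e i (e j T) = (-1) ^ (par i * par j) *\<^sub>R e j (e i T)"
    and c_c: "\<And>i j T. i \<in> I \<Longrightarrow> j \<in> I \<Longrightarrow> T \<in> S \<Longrightarrow> c i (c j T) = (-1) ^ (par i * par j) *\<^sub>R c j (c i T)"
    and m_e: "\<And>i j T. i \<in> I \<Longrightarrow> j \<in> I \<Longrightarrow> T \<in> S \<Longrightarrow> m i (e j T) = (-1) ^ (par i * par j) *\<^sub>R e j (m i T)"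
    and m_c: "\<And>i j T. i \<in> I \<Longrightarrow> j \<in> I \<Longrightarrow> T \<in> S \<Longrightarrow> m i (c j T) = (-1) ^ (par i * par j) *\<^sub>R c j (m i T)"
    and d_e: "\<And>i j T. i \<in> I \<Longrightarrow> j \<in> I \<Longrightarrow> T \<in> S \<Longrightarrow> d i (e j T) = (-1) ^ (par i * par j) *\<^sub>R e j (d i T)"
    and d_c: "\<And>i j T. i \<in> I \<Longrightarrow> j \<in> I \<Longrightarrow> T \<in> S \<Longrightarrow> d i (c j T) = (-1) ^ (par i * par j) *\<^sub>R c j (d i T)"
    and d_m: "\<And>i j T. i \<in> I \<Longrightarrow> j \<in> I \<Longrightarrow> T \<in> S \<Longrightarrow>
      d i (m j T) = (-1) ^ (par i * par j) *\<^sub>R m j (d i T) + (if i = j then T else 0)"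
    and c_e: "\<And>i j T. i \<in> I \<Longrightarrow> j \<in> I \<Longrightarrow> T \<in> S \<Longrightarrow>
      c i (e j T) = (-1) ^ (par i * par j) *\<^sub>R e j (c i T) + (if i = j then T else 0)"
begin

definition ss :: "nat \<Rightarrow> nat \<Rightarrow> real" where "ss i j = (-1) ^ (par i * par j)"

lemma ss_sym: "ss i j = ss j i"
  by (simp add: ss_def mult.commute)

lemma ss_sq [simp]: "ss i j * ss i j = 1"
  by (simp add: ss_def flip: power_add)

abbreviation eps :: "nat \<Rightarrow> real" where "eps i \<equiv> ss i i"

definition sdim :: real where "sdim = (\<Sum>i\<in>I. eps i)"

definition linS :: "('v \<Rightarrow> 'v) \<Rightarrow> bool" where
  "linS F \<longleftrightarrow> (\<forall>T\<in>S. F T \<in> S) \<and> (\<forall>T\<in>S. \<forall>U\<in>S. F (T + U) = F T + F U) \<and>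
     (\<forall>r. \<forall>T\<in>S. F (r *\<^sub>R T) = r *\<^sub>R F T)"

lemma S_add [simp, intro]: "T \<in> S \<Longrightarrow> U \<in> S \<Longrightarrow> T + U \<in> S"
  by (rule subspace_add[OF subspace_S])
lemma S_diff [simp, intro]: "T \<in> S \<Longrightarrow> U \<in> S \<Longrightarrow> T - U \<in> S"
  by (rule subspace_diff[OF subspace_S])
lemma S_scale [simp, intro]: "T \<in> S \<Longrightarrow> r *\<^sub>R T \<in> S"
  by (rule subspace_scale[OF subspace_S])
lemma S_0 [simp, intro]: "0 \<in> S"
  by (rule subspace_0[OF subspace_S])
lemma S_neg [simp, intro]: "T \<in> S \<Longrightarrow> - T \<in> S"
  by (rule subspace_neg[OF subspace_S])
lemma S_sum [simp, intro]: "(\<And>i. i \<in> A \<Longrightarrow> f i \<in> S) \<Longrightarrow> sum f A \<in> S"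
  by (rule subspace_sum[OF subspace_S])

lemma linS_in: "linS F \<Longrightarrow> T \<in> S \<Longrightarrow> F T \<in> S"
  and linS_add: "linS F \<Longrightarrow> T \<in> S \<Longrightarrow> U \<in> S \<Longrightarrow> F (T + U) = F T + F U"
  and linS_scale: "linS F \<Longrightarrow> T \<in> S \<Longrightarrow> F (r *\<^sub>R T) = r *\<^sub>R F T"
  by (auto simp: linS_def)

lemma linS_0: "linS F \<Longrightarrow> F 0 = 0"
  using linS_scale[of F 0 0] by simp

lemma linS_neg: "linS F \<Longrightarrow> T \<in> S \<Longrightarrow> F (- T) = - F T"
  using linS_scale[of F T "-1"] by simp

lemma linS_diff: "linS F \<Longrightarrow> T \<in> S \<Longrightarrow> U \<in> S \<Longrightarrow> F (T - U) = F T - F U"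
  using linS_add[of F T "- U"] by (simp add: linS_neg)

lemma linS_sum:
  assumes "linS F" "\<And>i. i \<in> A \<Longrightarrow> f i \<in> S"
  shows "F (sum f A) = (\<Sum>i\<in>A. F (f i))"
  using assms(2) by (induction A rule: infinite_finite_induct) (auto simp: linS_0 linS_add assms(1))

lemmas linS_rules = linS_add linS_scale linS_0 linS_neg linS_diff linS_sum

lemma linS_m [simp]: "i \<in> I \<Longrightarrow> linS (m i)"
  and linS_d [simp]: "i \<in> I \<Longrightarrow> linS (d i)"
  and linS_e [simp]: "i \<in> I \<Longrightarrow> linS (e i)"
  and linS_c [simp]: "i \<in> I \<Longrightarrow> linS (c i)"
  by (auto simp: linS_def m_in m_add m_scale d_in d_add d_scale e_in e_add e_scale c_in c_add c_scale)

declare m_in [simp] d_in [simp] e_in [simp] c_in [simp]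

section \<open>Even quadratic elements and their commutators with the generators\<close>

definition E :: "'v \<Rightarrow> 'v" where "E T = (\<Sum>i\<in>I. m i (d i T))"
definition K :: "'v \<Rightarrow> 'v" where "K T = (\<Sum>i\<in>I. e i (c i T))"
definition Y :: "'v \<Rightarrow> 'v" where "Y T = (\<Sum>i\<in>I. m i (e i T))"
definition D :: "'v \<Rightarrow> 'v" where "D T = (\<Sum>i\<in>I. d i (c i T))"

lemma linS_comp_sum:
  assumes "\<And>i. i \<in> I \<Longrightarrow> linS (F i)" "\<And>i. i \<in> I \<Longrightarrow> linS (G i)"
  shows "linS (\<lambda>T. \<Sum>i\<in>I. F i (G i T))"
  using assms unfolding linS_def
  by (auto simp: sum.distrib scaleR_sum_right intro!: S_sum)

lemma linS_E [simp]: "linS E" and linS_K [simp]: "linS K" and linS_Y [simp]: "linS Y" and linS_D [simp]: "linS D"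
  unfolding E_def[abs_def] K_def[abs_def] Y_def[abs_def] D_def[abs_def]
  by (rule linS_comp_sum; simp)+

lemma E_in [simp]: "T \<in> S \<Longrightarrow> E T \<in> S" and K_in [simp]: "T \<in> S \<Longrightarrow> K T \<in> S"
  and Y_in [simp]: "T \<in> S \<Longrightarrow> Y T \<in> S" and D_in [simp]: "T \<in> S \<Longrightarrow> D T \<in> S"
  by (simp_all add: linS_in)

lemma sum_delta_S: "j \<in> I \<Longrightarrow> (\<Sum>i\<in>I. if i = j then f i else 0) = (f j :: 'v)"
  using finite_I by simp

text \<open>One computation serves all sixteen commutators of \<open>D\<close>, \<open>E\<close>,
  \<open>K\<close>, \<open>Y\<close> with the generators. Moving H past F_i G_i costs
  \<open>ss i j\<close> twice, which cancels, so only the terms at i = j survive; \<open>r1\<close>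
  and \<open>r2\<close> are the contractions of H with F_j and with G_j.\<close>

lemma quad_comm:
  fixes r1 r2 :: real
  assumes "j \<in> I" "T \<in> S" and lin: "\<And>i. i \<in> I \<Longrightarrow> linS (F i)"
    "\<And>i. i \<in> I \<Longrightarrow> linS (G i)" "linS H"
    and FH: "\<And>i T. i \<in> I \<Longrightarrow> T \<in> S \<Longrightarrow> F i (H T) = ss i j *\<^sub>R H (F i T) + (if i = j then r1 *\<^sub>R T else 0)"
    and GH: "\<And>i T. i \<in> I \<Longrightarrow> T \<in> S \<Longrightarrow> G i (H T) = ss i j *\<^sub>R H (G i T) + (if i = j then r2 *\<^sub>R T else 0)"
  shows "(\<Sum>i\<in>I. F i (G i (H T))) = H (\<Sum>i\<in>I. F i (G i T)) + r2 *\<^sub>R F j T + (r1 * eps j) *\<^sub>R G j T"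
proof -
  have "F i (G i (H T)) = H (F i (G i T)) + ((if i = j then r2 *\<^sub>R F i T else 0) + (if i = j then (r1 * eps j) *\<^sub>R G i T else 0))" if "i \<in> I" for i
  proof -
    have "F i (G i (H T)) = ss i j *\<^sub>R F i (H (G i T)) + (if i = j then r2 *\<^sub>R F i T else 0)"
      using that assms(1,2) lin by (simp add: GH linS_add linS_scale linS_in linS_0)
    also have "F i (H (G i T)) = ss i j *\<^sub>R H (F i (G i T)) + (if i = j then r1 *\<^sub>R G i T else 0)"
      using that assms(1,2) lin by (simp add: FH linS_in)
    finally show ?thesis by (simp add: scaleR_add_right mult.commute)
  qed
  then show ?thesis
    using assms(1,2) lin by (simp add: sum.distrib linS_sum linS_in sum_delta_S)
qed

lemma flip_delta:
  fixes F G :: "'v \<Rightarrow> 'v"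
  assumes "G (F T) = ss i j *\<^sub>R F (G T) + (if i = j then T else 0)"
  shows "F (G T) = ss i j *\<^sub>R G (F T) + (if i = j then (- eps j) *\<^sub>R T else 0)"
  using assms by (simp add: scaleR_add_right)

lemmas swap [folded ss_def] = m_m d_d e_e c_c m_e m_c d_e d_c d_m c_e

lemma flip:
  fixes F G :: "'v \<Rightarrow> 'v"
  assumes "G (F T) = ss i j *\<^sub>R F (G T)"
  shows "F (G T) = ss j i *\<^sub>R G (F T)"
  using assms by (simp add: ss_sym)

lemma swap':
  assumes "i \<in> I" "j \<in> I" "T \<in> S"
  shows "e i (m j T) = ss i j *\<^sub>R m j (e i T)" "c i (m j T) = ss i j *\<^sub>R m j (c i T)"
    "e i (d j T) = ss i j *\<^sub>R d j (e i T)" "c i (d j T) = ss i j *\<^sub>R d j (c i T)"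
    "m i (d j T) = ss i j *\<^sub>R d j (m i T) + (if i = j then (- eps j) *\<^sub>R T else 0)"
    "e i (c j T) = ss i j *\<^sub>R c j (e i T) + (if i = j then (- eps j) *\<^sub>R T else 0)"
  using assms flip[of "m j" "e i" T, OF swap(5)] flip[of "m j" "c i" T, OF swap(6)]
    flip[of "d j" "e i" T, OF swap(7)] flip[of "d j" "c i" T, OF swap(8)]
    flip_delta[of "d j" "m i" T, OF swap(9)] flip_delta[of "c j" "e i" T, OF swap(10)]
  by (auto simp: ss_sym[of j i])

lemma D_m: assumes "j \<in> I" "T \<in> S" shows "D (m j T) = m j (D T) + eps j *\<^sub>R c j T"
  unfolding D_def
  by (rule trans[OF quad_comm[where F = d and G = c and H = "m j" and ?r1.0 = "1" and ?r2.0 = "0"]])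
    (use assms in \<open>simp_all only: linS_m linS_d linS_e linS_c swap(9)[of _ j] swap'(2)[of _ j] scaleR_one scaleR_zero_left if_cancel add_0_right add_0_left mult_zero_left mult_1_left ss_sq mult_minus_left scaleR_minus_left add_uminus_conv_diff cong: if_cong\<close>)

lemma D_e: assumes "j \<in> I" "T \<in> S" shows "D (e j T) = e j (D T) + d j T"
  unfolding D_def
  by (rule trans[OF quad_comm[where F = d and G = c and H = "e j" and ?r1.0 = "0" and ?r2.0 = "1"]])
    (use assms in \<open>simp_all only: linS_m linS_d linS_e linS_c swap(7)[of _ j] swap(10)[of _ j] scaleR_one scaleR_zero_left if_cancel add_0_right add_0_left mult_zero_left mult_1_left ss_sq mult_minus_left scaleR_minus_left add_uminus_conv_diff cong: if_cong\<close>)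

lemma D_d: assumes "j \<in> I" "T \<in> S" shows "D (d j T) = d j (D T)"
  unfolding D_def
  by (rule trans[OF quad_comm[where F = d and G = c and H = "d j" and ?r1.0 = "0" and ?r2.0 = "0"]])
    (use assms in \<open>simp_all only: linS_m linS_d linS_e linS_c swap(2)[of _ j] swap'(4)[of _ j] scaleR_one scaleR_zero_left if_cancel add_0_right add_0_left mult_zero_left mult_1_left ss_sq mult_minus_left scaleR_minus_left add_uminus_conv_diff cong: if_cong\<close>)

lemma D_c: assumes "j \<in> I" "T \<in> S" shows "D (c j T) = c j (D T)"
  unfolding D_def
  by (rule trans[OF quad_comm[where F = d and G = c and H = "c j" and ?r1.0 = "0" and ?r2.0 = "0"]])
    (use assms in \<open>simp_all only: linS_m linS_d linS_e linS_c swap(4)[of _ j] swap(8)[of _ j] scaleR_one scaleR_zero_left if_cancel add_0_right add_0_left mult_zero_left mult_1_left ss_sq mult_minus_left scaleR_minus_left add_uminus_conv_diff cong: if_cong\<close>)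

lemma E_m: assumes "j \<in> I" "T \<in> S" shows "E (m j T) = m j (E T) + m j T"
  unfolding E_def
  by (rule trans[OF quad_comm[where F = m and G = d and H = "m j" and ?r1.0 = "0" and ?r2.0 = "1"]])
    (use assms in \<open>simp_all only: linS_m linS_d linS_e linS_c swap(1)[of _ j] swap(9)[of _ j] scaleR_one scaleR_zero_left if_cancel add_0_right add_0_left mult_zero_left mult_1_left ss_sq mult_minus_left scaleR_minus_left add_uminus_conv_diff cong: if_cong\<close>)

lemma E_d: assumes "j \<in> I" "T \<in> S" shows "E (d j T) = d j (E T) - d j T"
  unfolding E_def
  by (rule trans[OF quad_comm[where F = m and G = d and H = "d j" and ?r1.0 = "- eps j" and ?r2.0 = "0"]])
    (use assms in \<open>(simp_all only: linS_m linS_d linS_e linS_c swap(2)[of _ j] swap'(5)[of _ j] scaleR_one scaleR_zero_left if_cancel add_0_right add_0_left mult_zero_left mult_1_left ss_sq mult_minus_left scaleR_minus_left add_uminus_conv_diff cong: if_cong), simp\<close>)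

lemma E_e: assumes "j \<in> I" "T \<in> S" shows "E (e j T) = e j (E T)"
  unfolding E_def
  by (rule trans[OF quad_comm[where F = m and G = d and H = "e j" and ?r1.0 = "0" and ?r2.0 = "0"]])
    (use assms in \<open>simp_all only: linS_m linS_d linS_e linS_c swap(5)[of _ j] swap(7)[of _ j] scaleR_one scaleR_zero_left if_cancel add_0_right add_0_left mult_zero_left mult_1_left ss_sq mult_minus_left scaleR_minus_left add_uminus_conv_diff cong: if_cong\<close>)

lemma E_c: assumes "j \<in> I" "T \<in> S" shows "E (c j T) = c j (E T)"
  unfolding E_def
  by (rule trans[OF quad_comm[where F = m and G = d and H = "c j" and ?r1.0 = "0" and ?r2.0 = "0"]])
    (use assms in \<open>simp_all only: linS_m linS_d linS_e linS_c swap(6)[of _ j] swap(8)[of _ j] scaleR_one scaleR_zero_left if_cancel add_0_right add_0_left mult_zero_left mult_1_left ss_sq mult_minus_left scaleR_minus_left add_uminus_conv_diff cong: if_cong\<close>)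

lemma K_e: assumes "j \<in> I" "T \<in> S" shows "K (e j T) = e j (K T) + e j T"
  unfolding K_def
  by (rule trans[OF quad_comm[where F = e and G = c and H = "e j" and ?r1.0 = "0" and ?r2.0 = "1"]])
    (use assms in \<open>simp_all only: linS_m linS_d linS_e linS_c swap(3)[of _ j] swap(10)[of _ j] scaleR_one scaleR_zero_left if_cancel add_0_right add_0_left mult_zero_left mult_1_left ss_sq mult_minus_left scaleR_minus_left add_uminus_conv_diff cong: if_cong\<close>)

lemma K_c: assumes "j \<in> I" "T \<in> S" shows "K (c j T) = c j (K T) - c j T"
  unfolding K_def
  by (rule trans[OF quad_comm[where F = e and G = c and H = "c j" and ?r1.0 = "- eps j" and ?r2.0 = "0"]])
    (use assms in \<open>(simp_all only: linS_m linS_d linS_e linS_c swap(4)[of _ j] swap'(6)[of _ j] scaleR_one scaleR_zero_left if_cancel add_0_right add_0_left mult_zero_left mult_1_left ss_sq mult_minus_left scaleR_minus_left add_uminus_conv_diff cong: if_cong), simp\<close>)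

lemma K_m: assumes "j \<in> I" "T \<in> S" shows "K (m j T) = m j (K T)"
  unfolding K_def
  by (rule trans[OF quad_comm[where F = e and G = c and H = "m j" and ?r1.0 = "0" and ?r2.0 = "0"]])
    (use assms in \<open>simp_all only: linS_m linS_d linS_e linS_c swap'(1)[of _ j] swap'(2)[of _ j] scaleR_one scaleR_zero_left if_cancel add_0_right add_0_left mult_zero_left mult_1_left ss_sq mult_minus_left scaleR_minus_left add_uminus_conv_diff cong: if_cong\<close>)

lemma K_d: assumes "j \<in> I" "T \<in> S" shows "K (d j T) = d j (K T)"
  unfolding K_def
  by (rule trans[OF quad_comm[where F = e and G = c and H = "d j" and ?r1.0 = "0" and ?r2.0 = "0"]])
    (use assms in \<open>simp_all only: linS_m linS_d linS_e linS_c swap'(3)[of _ j] swap'(4)[of _ j] scaleR_one scaleR_zero_left if_cancel add_0_right add_0_left mult_zero_left mult_1_left ss_sq mult_minus_left scaleR_minus_left add_uminus_conv_diff cong: if_cong\<close>)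

lemma Y_m: assumes "j \<in> I" "T \<in> S" shows "Y (m j T) = m j (Y T)"
  unfolding Y_def
  by (rule trans[OF quad_comm[where F = m and G = e and H = "m j" and ?r1.0 = "0" and ?r2.0 = "0"]])
    (use assms in \<open>simp_all only: linS_m linS_d linS_e linS_c swap(1)[of _ j] swap'(1)[of _ j] scaleR_one scaleR_zero_left if_cancel add_0_right add_0_left mult_zero_left mult_1_left ss_sq mult_minus_left scaleR_minus_left add_uminus_conv_diff cong: if_cong\<close>)

lemma Y_e: assumes "j \<in> I" "T \<in> S" shows "Y (e j T) = e j (Y T)"
  unfolding Y_def
  by (rule trans[OF quad_comm[where F = m and G = e and H = "e j" and ?r1.0 = "0" and ?r2.0 = "0"]])
    (use assms in \<open>simp_all only: linS_m linS_d linS_e linS_c swap(3)[of _ j] swap(5)[of _ j] scaleR_one scaleR_zero_left if_cancel add_0_right add_0_left mult_zero_left mult_1_left ss_sq mult_minus_left scaleR_minus_left add_uminus_conv_diff cong: if_cong\<close>)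

lemma Y_d: assumes "j \<in> I" "T \<in> S" shows "Y (d j T) = d j (Y T) - e j T"
  unfolding Y_def
  by (rule trans[OF quad_comm[where F = m and G = e and H = "d j" and ?r1.0 = "- eps j" and ?r2.0 = "0"]])
    (use assms in \<open>(simp_all only: linS_m linS_d linS_e linS_c swap'(3)[of _ j] swap'(5)[of _ j] scaleR_one scaleR_zero_left if_cancel add_0_right add_0_left mult_zero_left mult_1_left ss_sq mult_minus_left scaleR_minus_left add_uminus_conv_diff cong: if_cong), simp\<close>)

lemma Y_c: assumes "j \<in> I" "T \<in> S" shows "Y (c j T) = c j (Y T) - eps j *\<^sub>R m j T"
  unfolding Y_def
  by (rule trans[OF quad_comm[where F = m and G = e and H = "c j" and ?r1.0 = "0" and ?r2.0 = "- eps j"]])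
    (use assms in \<open>simp_all only: linS_m linS_d linS_e linS_c swap(6)[of _ j] swap'(6)[of _ j] scaleR_one scaleR_zero_left if_cancel add_0_right add_0_left mult_zero_left mult_1_left ss_sq mult_minus_left scaleR_minus_left add_uminus_conv_diff cong: if_cong\<close>)

lemmas even_swap = D_m D_e D_d D_c E_m E_d E_e E_c K_e K_c K_m K_d Y_m Y_e Y_d Y_c

lemma D_sum: "D T = (\<Sum>i\<in>I. eps i *\<^sub>R c i (d i T))" if "T \<in> S"
  unfolding D_def using that by (intro sum.cong) (simp_all add: swap'(4))

text \<open>The bracket of the lowering operator \<open>D\<close> with the raising operator
  \<open>Y\<close> is E + K + sdim, as in an sl(2) triple. The superdimension is the sum of the
  signs left over when both factors of \<open>D\<close> contract with the same term of
  \<open>Y\<close>.\<close>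

lemma D_Y: assumes "T \<in> S" shows "D (Y T) = Y (D T) + sdim *\<^sub>R T + E T + K T"
proof -
  have "D (m i (e i T)) = m i (e i (D T)) + m i (d i T) + e i (c i T) + eps i *\<^sub>R T" if "i \<in> I" for i
    using that assms by (simp add: even_swap linS_rules swap(10) scaleR_add_right)
  then show ?thesis
    using assms by (simp add: Y_def linS_sum sum.distrib E_def K_def sdim_def scaleR_sum_left)
qed

lemma D_E: assumes "T \<in> S" shows "D (E T) = E (D T) + D T"
proof -
  have "D (m i (d i T)) = m i (d i (D T)) + eps i *\<^sub>R c i (d i T)" if "i \<in> I" for i
    using that assms by (simp add: even_swap linS_rules)
  then show ?thesis
    using assms by (subst D_sum, simp, simp add: E_def linS_sum sum.distrib)
qed

lemma D_K: assumes "T \<in> S" shows "D (K T) = K (D T) + D T"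
proof -
  have "D (e i (c i T)) = e i (c i (D T)) + d i (c i T)" if "i \<in> I" for i
    using that assms by (simp add: even_swap linS_rules)
  then show ?thesis
    using assms by (simp add: K_def linS_sum sum.distrib) (simp add: D_def)
qed

lemma E_K: assumes "T \<in> S" shows "E (K T) = K (E T)"
  using assms by (simp add: K_def linS_sum even_swap)

lemma K_Y: assumes "T \<in> S" shows "K (Y T) = Y (K T) + Y T"
  using assms by (simp add: Y_def linS_sum even_swap linS_rules sum.distrib)

text \<open>With w = \<delta> and r = \<open>lam\<close> these formulas will turn out to be Lie
  derivatives: \<open>L\<close> along the quadratic field number j on symbols, \<open>G\<close>
  along y^j \<partial>_l both on symbols and on coefficients of operators, and \<open>L'\<close>
  along the quadratic field on coefficients of operators. The factor \<open>sdim + 1\<close> comes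
  from the divergence of that field, which is (sdim + 1) y^j.\<close>

definition L :: "real \<Rightarrow> nat \<Rightarrow> 'v \<Rightarrow> 'v" where
  "L w j T = m j (E T) - m j (K T) - eps j *\<^sub>R Y (c j T) + (w * (sdim + 1)) *\<^sub>R m j T"

definition G :: "real \<Rightarrow> nat \<Rightarrow> nat \<Rightarrow> 'v \<Rightarrow> 'v" where
  "G w j l T = m j (d l T) - (eps j * ss j l) *\<^sub>R e l (c j T) + (if j = l then (w * eps j) *\<^sub>R T else 0)"

definition L' :: "real \<Rightarrow> real \<Rightarrow> nat \<Rightarrow> 'v \<Rightarrow> 'v" where
  "L' w r j T = L w j T - eps j *\<^sub>R (K (c j T) + (r * (sdim + 1)) *\<^sub>R c j T)"

lemma L_in [simp]: "j \<in> I \<Longrightarrow> T \<in> S \<Longrightarrow> L w j T \<in> S"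
  by (simp add: L_def)

lemma linS_L: "j \<in> I \<Longrightarrow> linS (L w j)"
  unfolding linS_def L_def by (auto simp: linS_rules algebra_simps)

lemma G_in [simp]: "j \<in> I \<Longrightarrow> l \<in> I \<Longrightarrow> T \<in> S \<Longrightarrow> G w j l T \<in> S"
  by (simp add: G_def)

lemma linS_G: "j \<in> I \<Longrightarrow> l \<in> I \<Longrightarrow> linS (G w j l)"
  unfolding linS_def G_def by (auto simp: linS_rules algebra_simps)

lemma linS_L': "j \<in> I \<Longrightarrow> linS (L' w r j)"
  unfolding linS_def L'_def by (auto simp: linS_rules linS_rules[OF linS_L] algebra_simps)

lemma D_G:
  assumes "j \<in> I" "l \<in> I" "T \<in> S"
  shows "D (G w j l T) = G w j l (D T)"
  using assms by (auto simp: G_def even_swap linS_rules swap'(4) algebra_simps)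

text \<open>The defect is a combination of c_j and c_j K, the same shape as the difference of
  \<open>L'\<close> and \<open>L\<close>. This is what allows a series in \<open>D\<close> to
  compensate that difference.\<close>

lemma D_L:
  assumes "j \<in> I" "T \<in> S"
  shows "D (L w j T) = L w j (D T) + (eps j * (w * (sdim + 1) - sdim + 1)) *\<^sub>R c j T - (2 * eps j) *\<^sub>R c j (K T)"
  using assms by (simp add: L_def even_swap linS_rules D_Y D_E D_K algebra_simps) (simp flip: scaleR_add_left)

lemma K_G:
  assumes "j \<in> I" "l \<in> I" "T \<in> S"
  shows "K (G w j l T) = G w j l (K T)"
  using assms by (auto simp: G_def even_swap linS_rules algebra_simps)

lemma K_L:
  assumes "j \<in> I" "T \<in> S"
  shows "K (L w j T) = L w j (K T)"
  using assms by (simp add: L_def even_swap linS_rules K_Y E_K algebra_simps)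

section \<open>Powers of the divergence and the intertwining series\<close>

lemma D_pow_in [simp]: "T \<in> S \<Longrightarrow> (D ^^ l) T \<in> S"
  by (induction l) simp_all

lemma linS_D_pow: "linS (D ^^ l)"
  by (induction l) (auto simp: linS_def linS_rules[OF linS_D])

lemma K_D_pow:
  assumes "T \<in> S" "K T = k *\<^sub>R T"
  shows "K ((D ^^ l) T) = (k - real l) *\<^sub>R (D ^^ l) T"
proof (induction l)
  case (Suc l)
  have "K (D ((D ^^ l) T)) = D (K ((D ^^ l) T)) - D ((D ^^ l) T)"
    using assms by (simp add: D_K)
  then show ?case using Suc assms by (simp add: linS_rules algebra_simps)
qed (use assms in simp)

lemma D_pow_d: "j \<in> I \<Longrightarrow> T \<in> S \<Longrightarrow> (D ^^ l) (d j T) = d j ((D ^^ l) T)"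
  and D_pow_G: "j \<in> I \<Longrightarrow> i \<in> I \<Longrightarrow> T \<in> S \<Longrightarrow> (D ^^ l) (G w j i T) = G w j i ((D ^^ l) T)"
  by (induction l) (simp_all add: D_d D_G)

text \<open>Summing \<open>D_L\<close> over the l factors, where factor number i = 0, ..., l - 1
  sees the degree k - i, gives an arithmetic series; hence the factor l and the shift l - 1. At l =
  0 the truncated exponent l - 1 is harmless because of the factor l.\<close>

lemma D_pow_L:
  assumes "j \<in> I" "T \<in> S" "K T = k *\<^sub>R T"
  shows "(D ^^ l) (L w j T) = L w j ((D ^^ l) T) +
    (eps j * real l * (w * (sdim + 1) - sdim + 1 - 2 * k + real l - 1)) *\<^sub>R c j ((D ^^ (l - 1)) T)"
proof (induction l)
  case (Suc l)
  let ?a = "w * (sdim + 1) - sdim + 1" and ?U = "(D ^^ l) T"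
  have U: "?U \<in> S" using assms by simp
  have 1: "D (L w j ?U) = L w j (D ?U) + (eps j * (?a - 2 * (k - real l))) *\<^sub>R c j ?U"
    using assms D_L[OF assms(1) U] K_D_pow[OF assms(2,3)]
    by (simp add: linS_rules) (simp add: algebra_simps)
  have 2: "real l *\<^sub>R D (c j ((D ^^ (l - 1)) T)) = real l *\<^sub>R c j ?U"
    using assms by (cases l) (simp_all add: D_c)
  have "(D ^^ Suc l) (L w j T) = D (L w j ?U) + (eps j * (?a - 2 * k + real l - 1)) *\<^sub>R (real l *\<^sub>R D (c j ((D ^^ (l - 1)) T)))"
    using assms Suc by (simp add: linS_rules mult_ac)
  also have "\<dots> = L w j (D ?U) + (eps j * real (Suc l) * (?a - 2 * k + real (Suc l) - 1)) *\<^sub>R c j ?U"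
    unfolding 1 2 scaleR_scaleR add.assoc by (simp flip: scaleR_add_left) (simp add: algebra_simps)
  finally show ?case by simp
qed simp

text \<open>The recursion is forced by equivariance under the quadratic fields: the contraction term
  that commuting \<open>D\<close> ^ (l + 1) past \<open>L\<close> produces must cancel the one by
  which \<open>L'\<close> differs from \<open>L\<close> on \<open>D\<close> ^ l. The initial value 1
  preserves the principal symbol.\<close>

fun coef :: "real \<Rightarrow> real \<Rightarrow> nat \<Rightarrow> nat \<Rightarrow> real" where
  "coef w r k 0 = 1"
| "coef w r k (Suc l) = - coef w r k l * (real k - real l - 1 + r * (sdim + 1)) /
     (real (Suc l) * (w * (sdim + 1) - sdim + 1 - 2 * real k + real l))"

definition A :: "real \<Rightarrow> real \<Rightarrow> nat \<Rightarrow> 'v \<Rightarrow> 'v" where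
  "A w r k T = (\<Sum>l\<le>k. coef w r k l *\<^sub>R (D ^^ l) T)"

lemma linS_A: "linS (A w r k)"
  unfolding linS_def A_def
  by (auto simp: linS_rules[OF linS_D_pow] scaleR_add_right sum.distrib scaleR_sum_right mult.commute)

lemma A_d: "j \<in> I \<Longrightarrow> T \<in> S \<Longrightarrow> A w r k (d j T) = d j (A w r k T)"
  by (simp add: A_def D_pow_d linS_rules)

lemma A_G: "j \<in> I \<Longrightarrow> i \<in> I \<Longrightarrow> T \<in> S \<Longrightarrow> A w' r k (G w j i T) = G w j i (A w' r k T)"
  by (simp add: A_def D_pow_G linS_rules[OF linS_G])

text \<open>Both sides equal the sum of the \<open>L w j\<close> (\<open>D\<close> ^ l T), up to
  multiples of c_j (\<open>D\<close> ^ l T): \<open>f\<close> collects those from \<open>L'\<close>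
  (with the opposite sign), \<open>g\<close> those from \<open>D_pow_L\<close>, and the recursion
  says that - f l = g (l + 1). The ends fit because g 0 = 0 and because \<open>D\<close> ^ k T has
  degree 0, where \<open>vac\<close> gives f k = 0.\<close>

lemma A_L:
  assumes "j \<in> I" "T \<in> S" and k: "K T = real k *\<^sub>R T"
    and vac: "\<And>U. U \<in> S \<Longrightarrow> K U = 0 \<Longrightarrow> c j U = 0"
    and noncrit: "\<And>l. l < k \<Longrightarrow> w * (sdim + 1) \<noteq> real k + real l + sdim"
  shows "A w r k (L w j T) = L' w r j (A w r k T)"
proof -
  let ?a = "w * (sdim + 1) - sdim + 1" and ?C = "coef w r k"
  define f where "f l = (?C l * eps j * (real k - real l - 1 + r * (sdim + 1))) *\<^sub>R c j ((D ^^ l) T)" for l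
  define g where "g l = (?C l * (eps j * real l * (?a - 2 * real k + real l - 1))) *\<^sub>R c j ((D ^^ (l - 1)) T)" for l
  have fg: "- f l = g (Suc l)" if "l < k" for l
  proof -
    \<comment> \<open>A zero here would mean w (sdim + 1) = k + (k - l - 1) + sdim, so
      noncriticality is applied to the pair k and k - l - 1.\<close>
    have "?a - 2 * real k + real l \<noteq> 0"
      using noncrit[of "k - l - 1"] that by (auto simp: of_nat_diff algebra_simps)
    then have C: "?C (Suc l) * (real (Suc l) * (?a - 2 * real k + real l)) = - (?C l * (real k - real l - 1 + r * (sdim + 1)))"
      by simp
    have X: "?a - 2 * real k + real (Suc l) - 1 = ?a - 2 * real k + real l" by simp
    have "?C (Suc l) * (eps j * real (Suc l) * (?a - 2 * real k + real (Suc l) - 1)) =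
        - (?C l * eps j * (real k - real l - 1 + r * (sdim + 1)))"
      using arg_cong[OF C, of "(*) (eps j)"] unfolding X by (simp del: coef.simps add: mult_ac)
    then show ?thesis unfolding f_def g_def by (simp del: coef.simps)
  qed
  have "c j ((D ^^ k) T) = 0"
    using vac K_D_pow[OF assms(2) k, of k] assms(2) by simp
  then have fk: "f k = 0" by (simp add: f_def)
  have "L' w r j ((D ^^ l) T) = L w j ((D ^^ l) T) -
      (eps j * (real k - real l - 1 + r * (sdim + 1))) *\<^sub>R c j ((D ^^ l) T)" for l
    unfolding L'_def using assms(1,2) by (simp add: K_c K_D_pow[OF assms(2) k] linS_rules) (simp add: algebra_simps)
  then have "L' w r j (A w r k T) = (\<Sum>l\<le>k. ?C l *\<^sub>R L w j ((D ^^ l) T)) + (\<Sum>l\<le>k. - f l)"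
    using assms(1,2)
    by (simp add: A_def linS_rules[OF linS_L'] f_def scaleR_diff_right sum_subtractf sum_negf mult_ac)
  moreover have "A w r k (L w j T) = (\<Sum>l\<le>k. ?C l *\<^sub>R L w j ((D ^^ l) T)) + (\<Sum>l\<le>k. g l)"
    using assms(1,2) by (simp add: A_def D_pow_L[OF assms(1-3)] g_def scaleR_add_right sum.distrib)
  moreover have "(\<Sum>l\<le>k. g l) = (\<Sum>l\<le>k. - f l)"
    by (subst sum.atMost_shift) (simp add: fk fg lessThan_Suc_atMost[symmetric] g_def)
  ultimately show ?thesis by simp
qed

text \<open>The Casimir of gl(p|q) at weight 0. Terms purely in coordinates give \<open>E\<close>,
  terms purely in the symbol variables give \<open>K\<close>, and each of the two kinds of mixed
  terms sums to Y D.\<close>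

lemma casimir_gl:
  assumes "T \<in> S"
  shows "(\<Sum>j\<in>I. \<Sum>l\<in>I. eps l *\<^sub>R G 0 j l (G 0 l j T)) =
    E (E T) + K (K T) + (sdim - 1) *\<^sub>R (E T + K T) - Y (D T) - Y (D T)"
proof -
  have mm: "eps l *\<^sub>R m j (d l (m l (d j T))) = m j (m l (d l (d j T))) + eps l *\<^sub>R m j (d j T)"
    if "j \<in> I" "l \<in> I" for j l
    using that assms by (simp add: swap(9) linS_rules scaleR_add_right)
  have mm': "(\<Sum>j\<in>I. \<Sum>l\<in>I. eps l *\<^sub>R m j (d l (m l (d j T)))) = E (E T) - E T + sdim *\<^sub>R E T"
  proof -
    have "(\<Sum>j\<in>I. \<Sum>l\<in>I. eps l *\<^sub>R m j (d l (m l (d j T)))) = (\<Sum>j\<in>I. m j (E (d j T)) + sdim *\<^sub>R m j (d j T))"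
      using assms by (intro sum.cong) (simp_all add: mm sum.distrib E_def linS_sum sdim_def scaleR_sum_left)
    also have "\<dots> = (\<Sum>j\<in>I. m j (d j (E T))) - E T + sdim *\<^sub>R E T"
      using assms by (simp add: even_swap linS_rules sum.distrib sum_subtractf scaleR_sum_right) (simp add: E_def scaleR_sum_right)
    finally show ?thesis by (simp add: E_def)
  qed
  have ee: "eps j *\<^sub>R e l (c j (e j (c l T))) = e l (e j (c j (c l T))) + eps j *\<^sub>R e l (c l T)"
    if "j \<in> I" "l \<in> I" for j l
    using that assms by (simp add: swap(10) linS_rules scaleR_add_right)
  have ee': "(\<Sum>l\<in>I. \<Sum>j\<in>I. eps j *\<^sub>R e l (c j (e j (c l T)))) = K (K T) - K T + sdim *\<^sub>R K T"
  proof -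
    have "(\<Sum>l\<in>I. \<Sum>j\<in>I. eps j *\<^sub>R e l (c j (e j (c l T)))) = (\<Sum>l\<in>I. e l (K (c l T)) + sdim *\<^sub>R e l (c l T))"
      using assms by (intro sum.cong) (simp_all add: ee sum.distrib K_def linS_sum sdim_def scaleR_sum_left)
    also have "\<dots> = (\<Sum>l\<in>I. e l (c l (K T))) - K T + sdim *\<^sub>R K T"
      using assms by (simp add: even_swap linS_rules sum.distrib sum_subtractf scaleR_sum_right) (simp add: K_def scaleR_sum_right)
    finally show ?thesis by (simp add: K_def)
  qed
  have me: "ss j l *\<^sub>R m j (d l (e j (c l T))) = m j (e j (d l (c l T)))"
    if "j \<in> I" "l \<in> I" for j l
    using that assms by (simp add: swap(7) linS_rules ss_sym[of l j])
  have me': "(\<Sum>j\<in>I. \<Sum>l\<in>I. ss j l *\<^sub>R m j (d l (e j (c l T)))) = Y (D T)"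
    using assms by (simp add: me Y_def D_def linS_sum)
  have em: "(eps l * eps j * ss j l) *\<^sub>R e l (c j (m l (d j T))) = m l (e l (d j (c j T)))"
    if "j \<in> I" "l \<in> I" for j l
    using that assms by (simp add: swap'(1,2,4) linS_rules) (simp add: mult_ac)
  have em': "(\<Sum>j\<in>I. \<Sum>l\<in>I. (eps l * eps j * ss j l) *\<^sub>R e l (c j (m l (d j T)))) = Y (D T)"
    unfolding Y_def D_def using assms by (subst sum.swap) (simp add: em linS_sum)
  have "eps l *\<^sub>R G 0 j l (G 0 l j T) = eps l *\<^sub>R m j (d l (m l (d j T))) - ss j l *\<^sub>R m j (d l (e j (c l T)))
     - (eps l * eps j * ss j l) *\<^sub>R e l (c j (m l (d j T))) + eps j *\<^sub>R e l (c j (e j (c l T)))"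
    if "j \<in> I" "l \<in> I" for j l
    using that assms by (simp add: G_def linS_rules scaleR_diff_right ss_sym[of l j] mult_ac)
  then have "(\<Sum>j\<in>I. \<Sum>l\<in>I. eps l *\<^sub>R G 0 j l (G 0 l j T)) =
      (\<Sum>j\<in>I. \<Sum>l\<in>I. eps l *\<^sub>R m j (d l (m l (d j T)))) - (\<Sum>j\<in>I. \<Sum>l\<in>I. ss j l *\<^sub>R m j (d l (e j (c l T))))
      - (\<Sum>j\<in>I. \<Sum>l\<in>I. (eps l * eps j * ss j l) *\<^sub>R e l (c j (m l (d j T))))
      + (\<Sum>j\<in>I. \<Sum>l\<in>I. eps j *\<^sub>R e l (c j (e j (c l T))))"
    by (simp add: sum.distrib sum_subtractf)
  also have "(\<Sum>j\<in>I. \<Sum>l\<in>I. eps j *\<^sub>R e l (c j (e j (c l T)))) = K (K T) - K T + sdim *\<^sub>R K T"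
    by (subst sum.swap) (rule ee')
  finally show ?thesis unfolding mm' me' em' by (simp add: algebra_simps)
qed

text \<open>A Schur argument with the Casimir that never isolates its eigenvalue. Both halves, the
  sum of the L_j d_j and the gl(p|q) part, involve the term Y D, with which P has no known relation.
  Applying P to each half determines the same defect \<open>B\<close> in two ways; comparing them
  cancels the Euler terms and leaves 2 (k - l) (k + l + sdim - w (sdim + 1)) P T = 0.\<close>

lemma equivariant_eq_0:
  assumes P: "linS P"
    and Pd: "\<And>j T. j \<in> I \<Longrightarrow> T \<in> S \<Longrightarrow> P (d j T) = d j (P T)"
    and PG: "\<And>j l T. j \<in> I \<Longrightarrow> l \<in> I \<Longrightarrow> T \<in> S \<Longrightarrow> P (G w j l T) = G w j l (P T)"
    and PL: "\<And>j T. j \<in> I \<Longrightarrow> T \<in> S \<Longrightarrow> P (L w j T) = L w j (P T)"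
    and k: "\<And>T. T \<in> S \<Longrightarrow> P (K T) = k *\<^sub>R P T"
    and l: "\<And>T. T \<in> S \<Longrightarrow> K (P T) = l *\<^sub>R P T"
    and "k \<noteq> l" and noncrit: "w * (sdim + 1) \<noteq> k + l + sdim" and T: "T \<in> S"
  shows "P T = 0"
proof -
  note Pr = linS_rules[OF P] linS_in[OF P]
  define r where "r = k - l"
  have G0: "G 0 i j T = G w i j T - (if i = j then (w * eps i) *\<^sub>R T else 0)" for i j T
    by (simp add: G_def)
  have PG0: "P (G 0 i j T) = G 0 i j (P T)" if "i \<in> I" "j \<in> I" "T \<in> S" for i j T
    using that by (simp add: G0 Pr PG)
  have EK: "E T - K T = (\<Sum>j\<in>I. G 0 j j T)" for T
    by (simp add: G_def E_def K_def sum_subtractf)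
  have PEK: "P (E T - K T) = E (P T) - K (P T)" if "T \<in> S" for T
    unfolding EK using that by (simp add: Pr PG0)
  \<comment> \<open>P commutes with E - K, the sum of the diagonal linear fields at weight 0, while
    K changes from k to l across P. So P must shift E by k - l.\<close>
  have PE: "P (E T) = E (P T) + r *\<^sub>R P T" if "T \<in> S" for T
    using that PEK[of T] k[of T] l[of T] by (simp add: Pr r_def algebra_simps)
  have LN: "(\<Sum>j\<in>I. L w j (d j T)) = E (E T) - E T - E (K T) - Y (D T) + (w * (sdim + 1)) *\<^sub>R E T"
    if "T \<in> S" for T
  proof -
    have "L w j (d j T) = m j (d j (E T - T - K T + (w * (sdim + 1)) *\<^sub>R T)) - Y (eps j *\<^sub>R c j (d j T))" if "j \<in> I" for j
      using that \<open>T \<in> S\<close> by (simp add: L_def even_swap linS_rules algebra_simps)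
    then have "(\<Sum>j\<in>I. L w j (d j T)) = E (E T - T - K T + (w * (sdim + 1)) *\<^sub>R T) - Y (D T)"
      using that by (simp add: sum_subtractf D_sum linS_sum) (simp add: E_def)
    then show ?thesis using that by (simp add: linS_rules)
  qed
  have PN: "P (\<Sum>j\<in>I. L w j (d j T)) = (\<Sum>j\<in>I. L w j (d j (P T)))"
    using T by (simp add: Pr PL Pd)
  have PC: "P (\<Sum>j\<in>I. \<Sum>l\<in>I. eps l *\<^sub>R G 0 j l (G 0 l j T)) = (\<Sum>j\<in>I. \<Sum>l\<in>I. eps l *\<^sub>R G 0 j l (G 0 l j (P T)))"
    using T by (simp add: Pr PG0)
  define U where "U = P T"
  have U: "U \<in> S" using T by (simp add: U_def Pr)
  have kr: "k = l + r" by (simp add: r_def)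
  let ?W = "w * (sdim + 1)"
  have PEE: "P (E (E T)) = E (E U) + r *\<^sub>R E U + r *\<^sub>R E U + (r * r) *\<^sub>R U"
    using T U by (simp add: PE U_def Pr linS_rules scaleR_add_right)
  have PEKT: "P (E (K T)) = k *\<^sub>R (E U + r *\<^sub>R U)"
    using T U by (simp add: PE k U_def Pr linS_rules algebra_simps)
  have PKK: "P (K (K T)) = (k * k) *\<^sub>R U"
    using T by (simp add: k U_def)
  have KU: "K U = l *\<^sub>R U" using T by (simp add: l U_def)
  have KKU: "K (K U) = (l * l) *\<^sub>R U" using U by (simp add: KU linS_rules)
  have EKU: "E (K U) = l *\<^sub>R E U" using U by (simp add: KU linS_rules)
  \<comment> \<open>The unknown failure of P to commute with Y D. The identities \<open>N\<close>
    and \<open>C\<close> below evaluate B and B + B respectively.\<close>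
  define B where "B = P (Y (D T)) - Y (D U)"
  have "P (E (E T) - E T - E (K T) - Y (D T) + ?W *\<^sub>R E T) = E (E U) - E U - E (K U) - Y (D U) + ?W *\<^sub>R E U"
    using PN unfolding LN[OF T] LN[OF U, unfolded U_def] U_def .
  then have 1: "(E (E U) + r *\<^sub>R E U + r *\<^sub>R E U + (r * r) *\<^sub>R U) - (E U + r *\<^sub>R U) - k *\<^sub>R (E U + r *\<^sub>R U)
      - P (Y (D T)) + ?W *\<^sub>R (E U + r *\<^sub>R U) - (E (E U) - E U - l *\<^sub>R E U - Y (D U) + ?W *\<^sub>R E U) = 0" (is "?X1 = 0")
    using T U by (simp add: Pr PEE PEKT PE EKU flip: U_def)
  have "B - (r *\<^sub>R E U + (r * (r - 1 - k + ?W)) *\<^sub>R U) = - ?X1"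
    unfolding B_def kr by (simp add: algebra_simps)
  then have N: "B = r *\<^sub>R E U + (r * (r - 1 - k + ?W)) *\<^sub>R U"
    unfolding 1 by simp
  have "P (E (E T) + K (K T) + (sdim - 1) *\<^sub>R (E T + K T) - Y (D T) - Y (D T)) =
      E (E U) + K (K U) + (sdim - 1) *\<^sub>R (E U + K U) - Y (D U) - Y (D U)"
    using PC unfolding casimir_gl[OF T] casimir_gl[OF U, unfolded U_def] U_def .
  then have 2: "E (E U) + r *\<^sub>R E U + r *\<^sub>R E U + (r * r) *\<^sub>R U + (k * k) *\<^sub>R U + (sdim - 1) *\<^sub>R (E U + r *\<^sub>R U + k *\<^sub>R U)
      - P (Y (D T)) - P (Y (D T)) - (E (E U) + (l * l) *\<^sub>R U + (sdim - 1) *\<^sub>R (E U + l *\<^sub>R U) - Y (D U) - Y (D U)) = 0" (is "?X2 = 0")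
    using T U by (simp add: Pr PEE PKK PE k KU linS_rules flip: U_def)
  have "B + B - (r *\<^sub>R E U + r *\<^sub>R E U + ((r * r) *\<^sub>R U + (k * k) *\<^sub>R U - (l * l) *\<^sub>R U + ((sdim - 1) * r) *\<^sub>R U + ((sdim - 1) * r) *\<^sub>R U)) = - ?X2"
    unfolding B_def kr by (simp add: algebra_simps)
  then have C: "B + B = r *\<^sub>R E U + r *\<^sub>R E U + ((r * r) *\<^sub>R U + (k * k) *\<^sub>R U - (l * l) *\<^sub>R U + ((sdim - 1) * r) *\<^sub>R U + ((sdim - 1) * r) *\<^sub>R U)"
    unfolding 2 by simp
  have "(r * (r - 1 - k + ?W)) *\<^sub>R U + (r * (r - 1 - k + ?W)) *\<^sub>R U = (r * r) *\<^sub>R U + (k * k) *\<^sub>R U - (l * l) *\<^sub>R U + ((sdim - 1) * r) *\<^sub>R U + ((sdim - 1) * r) *\<^sub>R U"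
    using C unfolding N by (simp add: add_ac)
  then have "0 = (r * r) *\<^sub>R U + (k * k) *\<^sub>R U - (l * l) *\<^sub>R U + ((sdim - 1) * r) *\<^sub>R U + ((sdim - 1) * r) *\<^sub>R U - (r * (r - 1 - k + ?W)) *\<^sub>R U - (r * (r - 1 - k + ?W)) *\<^sub>R U"
    by (metis add_diff_cancel_right' diff_self)
  also have "\<dots> = (r * r + k * k - l * l + (sdim - 1) * r + (sdim - 1) * r - r * (r - 1 - k + ?W) - r * (r - 1 - k + ?W)) *\<^sub>R U"
    by (simp only: scaleR_left_distrib scaleR_left_diff_distrib)
  also have "\<dots> = (2 * r * (k + l + sdim - w * (sdim + 1))) *\<^sub>R U"
    by (simp add: r_def algebra_simps)
  finally show ?thesis using \<open>k \<noteq> l\<close> noncrit by (simp add: r_def U_def)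
qed
end

subsection \<open>Partial derivatives of smooth functions\<close>

text \<open>Continuity in \<open>smooth\<close> refers to the product topology on sequences; this
  restricts it to a coordinate plane, where second derivatives can be compared.\<close>

lemma continuous_on_fun_upd2: "continuous_on UNIV (\<lambda>u :: real \<times> real. x(i := fst u, j := snd u))" for x :: "nat \<Rightarrow> real"
proof (rule continuous_on_coordinatewise_then_product)
  fix k
  have "(\<lambda>u :: real \<times> real. (x(i := fst u, j := snd u)) k) = (if k = j then snd else if k = i then fst else (\<lambda>u. x k))"
    by auto
  moreover have "continuous_on UNIV (if k = j then snd else if k = i then fst else (\<lambda>u :: real \<times> real. x k))"
    using continuous_on_fst[OF continuous_on_id] continuous_on_snd[OF continuous_on_id] by (metis continuous_on_const)
  ultimately show "continuous_on UNIV (\<lambda>u :: real \<times> real. (x(i := fst u, j := snd u)) k)" by (simp only:)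
qed

context superspace
begin

lemma partial_DERIV:
  assumes "(\<lambda>t. g (x(i := t))) differentiable (at (x i))"
  shows "DERIV (\<lambda>t. g (x(i := t))) (x i) :> partial i g x"
  using assms unfolding partial_def
  by (metis DERIV_deriv_iff_real_differentiable)

lemma smooth_differentiable:
  assumes "smooth g" "i \<in> {1..p}"
  shows "(\<lambda>t. g (x(i := t))) differentiable (at (x i))"
  using assms unfolding smooth_def by (metis empty_iff empty_set empty_subsetI foldr_Nil id_apply)

lemma smooth_DERIV:
  assumes "smooth g" "i \<in> {1..p}"
  shows "DERIV (\<lambda>t. g (x(i := t))) s :> partial i g (x(i := s))"
  using partial_DERIV[OF smooth_differentiable[OF assms, of "x(i := s)"]]
  by (simp only: fun_upd_upd fun_upd_same)

lemma smooth_continuous: "smooth g \<Longrightarrow> continuous_on UNIV g"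
  unfolding smooth_def by (metis empty_iff empty_set empty_subsetI foldr_Nil id_apply)

lemma smooth_cong_point: "smooth g \<Longrightarrow> (\<And>i. i \<in> {1..p} \<Longrightarrow> x i = y i) \<Longrightarrow> g x = g y"
  unfolding smooth_def by blast

lemma smooth_partial:
  assumes "smooth g" "i \<in> {1..p}"
  shows "smooth (partial i g)"
  unfolding smooth_def
proof (intro conjI allI impI)
  fix x y :: point
  assume *: "\<forall>i\<in>{1..p}. x i = y i"
  have "g (x(i := t)) = g (y(i := t))" for t
    by (rule smooth_cong_point[OF assms(1)]) (use * in auto)
  then show "partial i g x = partial i g y"
    using * assms(2) by (simp add: partial_def)
next
  fix js assume "set js \<subseteq> {1..p}"
  then have js: "set (js @ [i]) \<subseteq> {1..p}" using assms(2) by simp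
  have eq: "foldr partial (js @ [i]) g = foldr partial js (partial i g)" by simp
  have *: "continuous_on UNIV (foldr partial (js @ [i]) g) \<and>
     (\<forall>k\<in>{1..p}. \<forall>x. (\<lambda>t. foldr partial (js @ [i]) g (x(k := t))) differentiable (at (x k)))"
    using assms(1) js unfolding smooth_def by blast
  show "continuous_on UNIV (foldr partial js (partial i g))"
    and "\<forall>k\<in>{1..p}. \<forall>x. (\<lambda>t. foldr partial js (partial i g) (x(k := t))) differentiable (at (x k))"
    using * unfolding eq by blast+
qed

text \<open>Smoothness concerns all iterated partial derivatives at once, so it is proved
  coinductively: any class of continuous, partially differentiable functions that is closed under
  \<open>partial\<close> consists of smooth functions.\<close>

lemma smooth_coinduct:
  assumes "g \<in> A"
    and "\<And>g x y. g \<in> A \<Longrightarrow> (\<And>i. i \<in> {1..p} \<Longrightarrow> x i = y i) \<Longrightarrow> g x = g y"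
    and "\<And>g. g \<in> A \<Longrightarrow> continuous_on UNIV g"
    and "\<And>g i x. g \<in> A \<Longrightarrow> i \<in> {1..p} \<Longrightarrow> (\<lambda>t. g (x(i := t))) differentiable (at (x i))"
    and "\<And>g i. g \<in> A \<Longrightarrow> i \<in> {1..p} \<Longrightarrow> partial i g \<in> A"
  shows "smooth g"
proof -
  have "foldr partial js g \<in> A" if "set js \<subseteq> {1..p}" for js
    using that by (induction js) (use assms in auto)
  then show ?thesis unfolding smooth_def using assms(1-4) by blast
qed

lemma partial_add:
  assumes "smooth g" "smooth h" "i \<in> {1..p}"
  shows "partial i (g + h) = partial i g + partial i h"
proof
  fix x
  have "DERIV (\<lambda>t. (g + h) (x(i := t))) (x i) :> partial i g x + partial i h x"
    using DERIV_add[OF smooth_DERIV[OF assms(1,3), of x "x i"] smooth_DERIV[OF assms(2,3), of x "x i"]] by simp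
  then show "partial i (g + h) x = (partial i g + partial i h) x"
    unfolding partial_def[of i "g + h"] by (simp add: DERIV_imp_deriv)
qed

lemma partial_scale:
  assumes "smooth g" "i \<in> {1..p}"
  shows "partial i (r *\<^sub>R g) = r *\<^sub>R partial i g"
proof
  fix x
  have "DERIV (\<lambda>t. (r *\<^sub>R g) (x(i := t))) (x i) :> r * partial i g x"
    using DERIV_cmult[OF smooth_DERIV[OF assms, of x "x i"], of r] by (simp add: scaleR_fun_def)
  then show "partial i (r *\<^sub>R g) x = (r *\<^sub>R partial i g) x"
    unfolding partial_def[of i "r *\<^sub>R g"] by (simp add: DERIV_imp_deriv scaleR_fun_def)
qed

lemma partial_sum_mult:
  assumes "finite B" "\<And>k. k \<in> B \<Longrightarrow> smooth (g k)" "\<And>k. k \<in> B \<Longrightarrow> smooth (h k)" "i \<in> {1..p}"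
  shows "partial i (\<lambda>x. \<Sum>k\<in>B. r k * g k x * h k x) =
     (\<lambda>x. \<Sum>k\<in>B. r k * (partial i (g k) x * h k x + g k x * partial i (h k) x))"
proof
  fix x
  have "DERIV (\<lambda>t. \<Sum>k\<in>B. r k * (g k (x(i := t)) * h k (x(i := t)))) (x i) :>
      (\<Sum>k\<in>B. r k * (partial i (g k) x * h k x + partial i (h k) x * g k x))"
    using DERIV_mult[OF smooth_DERIV[OF assms(2,4), of _ x "x i"] smooth_DERIV[OF assms(3,4), of _ x "x i"]]
    by (intro DERIV_sum DERIV_cmult) simp
  then show "partial i (\<lambda>x. \<Sum>k\<in>B. r k * g k x * h k x) x =
     (\<Sum>k\<in>B. r k * (partial i (g k) x * h k x + g k x * partial i (h k) x))"
    unfolding partial_def[of i "\<lambda>x. \<Sum>k\<in>B. r k * g k x * h k x"] by (simp add: DERIV_imp_deriv mult_ac)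
qed

lemma smooth_const [simp]: "smooth (\<lambda>x. r)"
  by (rule smooth_coinduct[of _ "range (\<lambda>r x. r)"]) (auto simp: partial_def fun_eq_iff)

lemma partial_const [simp]: "partial i (\<lambda>x. r) = 0"
  by (simp add: partial_def fun_eq_iff)

lemma smooth_0 [simp]: "smooth 0"
  using smooth_const[of 0] by (simp add: zero_fun_def)

lemma partial_0 [simp]: "partial i 0 = 0"
  using partial_const[of i 0] by (simp add: zero_fun_def)

lemma smooth_add:
  assumes "smooth g" "smooth h"
  shows "smooth (g + h)"
proof (rule smooth_coinduct[of _ "{g + h | g h. smooth g \<and> smooth h}"])
  show "g + h \<in> {g + h | g h. smooth g \<and> smooth h}" using assms by blast
next
  fix f i assume "f \<in> {g + h | g h. smooth g \<and> smooth h}" "i \<in> {1..p}"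
  then show "partial i f \<in> {g + h | g h. smooth g \<and> smooth h}"
    using partial_add smooth_partial by blast
next
  fix f and x y :: point assume "f \<in> {g + h | g h. smooth g \<and> smooth h}" and *: "\<And>i. i \<in> {1..p} \<Longrightarrow> x i = y i"
  then obtain g h where "f = g + h" "smooth g" "smooth h" by blast
  then show "f x = f y" using smooth_cong_point[of g x y] smooth_cong_point[of h x y] * by simp
next
  fix f i and x :: point assume "f \<in> {g + h | g h. smooth g \<and> smooth h}" "i \<in> {1..p}"
  then obtain g h where "f = g + h" "smooth g" "smooth h" "i \<in> {1..p}" by blast
  then show "(\<lambda>t. f (x(i := t))) differentiable (at (x i))"
    using differentiable_add[OF smooth_differentiable[of g i x] smooth_differentiable[of h i x]] by (simp del: fun_upd_apply)
next
  fix f assume "f \<in> {g + h | g h. smooth g \<and> smooth h}"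
  then obtain g h where "f = g + h" "smooth g" "smooth h" by blast
  then show "continuous_on UNIV f"
    using continuous_on_add[OF smooth_continuous smooth_continuous, of g h] by (simp add: plus_fun_def)
qed

lemma smooth_scale:
  assumes "smooth g"
  shows "smooth (r *\<^sub>R g)"
proof (rule smooth_coinduct[of _ "{r *\<^sub>R g | g. smooth g}"])
  fix f i assume "f \<in> {r *\<^sub>R g | g. smooth g}" "i \<in> {1..p}"
  then show "partial i f \<in> {r *\<^sub>R g | g. smooth g}"
    using partial_scale smooth_partial by blast
next
  fix f and x y :: point assume "f \<in> {r *\<^sub>R g | g. smooth g}" and *: "\<And>i. i \<in> {1..p} \<Longrightarrow> x i = y i"
  then obtain g where "f = r *\<^sub>R g" "smooth g" by blast
  then show "f x = f y" using smooth_cong_point[of g x y] * by (simp add: scaleR_fun_def)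
next
  fix f i and x :: point assume "f \<in> {r *\<^sub>R g | g. smooth g}" "i \<in> {1..p}"
  then obtain g where "smooth g" "f = r *\<^sub>R g" "i \<in> {1..p}" by blast
  then show "(\<lambda>t. f (x(i := t))) differentiable (at (x i))"
    using differentiable_mult[OF differentiable_const smooth_differentiable[of g i x]] by (simp add: scaleR_fun_def del: fun_upd_apply)
next
  fix f assume "f \<in> {r *\<^sub>R g | g. smooth g}"
  then obtain g where "f = r *\<^sub>R g" "smooth g" by blast
  then show "continuous_on UNIV f"
    using continuous_on_mult[OF continuous_on_const smooth_continuous, of g r] by (simp add: scaleR_fun_def)
qed (use assms in blast)

lemma partial_point_coord: "partial j (\<lambda>x. x i) = (\<lambda>x. if i = j then 1 else 0)"
  by (auto simp: partial_def fun_eq_iff)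

lemma smooth_point_coord:
  assumes "i \<in> {1..p}"
  shows "smooth (\<lambda>x. x i)"
proof (rule smooth_coinduct[of _ "insert (\<lambda>x. x i) (range (\<lambda>r x. r))"])
  fix f :: "point \<Rightarrow> real" and j assume "f \<in> insert (\<lambda>x. x i) (range (\<lambda>r x. r))" "j \<in> {1..p}"
  then show "partial j f \<in> insert (\<lambda>x. x i) (range (\<lambda>r x. r))"
    by (auto simp: partial_point_coord zero_fun_def)
next
  fix f :: "point \<Rightarrow> real" and x :: point and j assume "f \<in> insert (\<lambda>x. x i) (range (\<lambda>r x. r))" "j \<in> {1..p}"
  then show "(\<lambda>t. f (x(j := t))) differentiable (at (x j))"
    by (cases "i = j") auto
qed (use assms in \<open>auto simp: fun_upd_def intro: continuous_on_product_coordinates\<close>)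

text \<open>Differentiating x_i g in direction i throws off the bare factor g. The class used for
  coinduction therefore carries a free smooth summand h.\<close>

lemma smooth_coord_mult:
  assumes "smooth g" "i \<in> {1..p}"
  shows "smooth (\<lambda>x. x i * g x)"
proof (rule smooth_coinduct[of _ "{(\<lambda>x. x i * g x) + h | g h. smooth g \<and> smooth h}"])
  show "(\<lambda>x. x i * g x) \<in> {(\<lambda>x. x i * g x) + h | g h. smooth g \<and> smooth h}"
    using assms by (force intro: exI[of _ g] exI[of _ 0])
next
  fix f j assume "f \<in> {(\<lambda>x. x i * g x) + h | g h. smooth g \<and> smooth h}" and j: "j \<in> {1..p}"
  then obtain g h where f: "f = (\<lambda>x. x i * g x) + h" and g: "smooth g" and h: "smooth h" by blast
  let ?h = "(if i = j then g else 0) + partial j h"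
  have "partial j f x = x i * partial j g x + ?h x" for x
  proof -
    have "DERIV (\<lambda>t. f (x(j := t))) (x j) :> (if i = j then 1 else 0) * g x + partial j g x * x i + partial j h x"
      unfolding f plus_fun_def
      using DERIV_mult[OF smooth_DERIV[OF smooth_point_coord[OF assms(2)] j, of x "x j"] smooth_DERIV[OF g j, of x "x j"]]
        smooth_DERIV[OF h j, of x "x j"]
      by (intro DERIV_add) (auto simp: partial_point_coord)
    then show ?thesis unfolding partial_def[of j f] by (auto simp: DERIV_imp_deriv)
  qed
  then have "partial j f = (\<lambda>x. x i * partial j g x) + ?h" by auto
  moreover have "smooth ?h" using g h j by (auto intro!: smooth_add smooth_partial)
  ultimately show "partial j f \<in> {(\<lambda>x. x i * g x) + h | g h. smooth g \<and> smooth h}"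
    using smooth_partial[OF g j] by blast
next
  fix f and x y :: point assume "f \<in> {(\<lambda>x. x i * g x) + h | g h. smooth g \<and> smooth h}" and *: "\<And>i. i \<in> {1..p} \<Longrightarrow> x i = y i"
  then obtain g h where "f = (\<lambda>x. x i * g x) + h" "smooth g" "smooth h" by blast
  then show "f x = f y" using smooth_cong_point[of g x y] smooth_cong_point[of h x y] * assms(2) by simp
next
  fix f j and x :: point assume "f \<in> {(\<lambda>x. x i * g x) + h | g h. smooth g \<and> smooth h}" "j \<in> {1..p}"
  then obtain g h where "f = (\<lambda>x. x i * g x) + h" "smooth g" "smooth h" "j \<in> {1..p}" by blast
  then show "(\<lambda>t. f (x(j := t))) differentiable (at (x j))"
    using differentiable_add[OF differentiable_mult[OF smooth_differentiable[OF smooth_point_coord[OF assms(2)], of j x]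
      smooth_differentiable[of g j x]] smooth_differentiable[of h j x]]
    by (simp del: fun_upd_apply)
next
  fix f assume "f \<in> {(\<lambda>x. x i * g x) + h | g h. smooth g \<and> smooth h}"
  then obtain g h where "f = (\<lambda>x. x i * g x) + h" "smooth g" "smooth h" by blast
  then show "continuous_on UNIV f"
    using continuous_on_add[OF continuous_on_mult[OF continuous_on_product_coordinates smooth_continuous, of g i] smooth_continuous, of h]
    by (simp add: plus_fun_def)
qed

text \<open>The mean value theorem, applied first in direction i and then in direction j. The second
  difference on the left is symmetric in the two directions, which is what makes it useful.\<close>

lemma mixed_difference:
  assumes "smooth g" "i \<in> {1..p}" "j \<in> {1..p}" "i \<noteq> j" "0 < r"
  shows "\<exists>s t. a < s \<and> s < a + r \<and> b < t \<and> t < b + r \<and>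
    g (x(i := a + r, j := b + r)) - g (x(i := a + r, j := b)) - g (x(i := a, j := b + r)) + g (x(i := a, j := b)) =
    r * r * partial j (partial i g) (x(i := s, j := t))"
proof -
  define \<phi> where "\<phi> s = g (x(i := s, j := b + r)) - g (x(i := s, j := b))" for s
  have sw: "x(i := s, j := t) = x(j := t, i := s)" for s t using assms(4) by (simp add: fun_upd_twist)
  have d: "DERIV \<phi> s :> partial i g (x(i := s, j := b + r)) - partial i g (x(i := s, j := b))" for s
    unfolding \<phi>_def sw by (intro DERIV_diff smooth_DERIV assms)
  obtain s where s: "a < s" "s < a + r"
    "\<phi> (a + r) - \<phi> a = (a + r - a) * (partial i g (x(i := s, j := b + r)) - partial i g (x(i := s, j := b)))"
    using MVT2[of a "a + r" \<phi> "\<lambda>s. partial i g (x(i := s, j := b + r)) - partial i g (x(i := s, j := b))"] d assms(5) by auto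
  obtain t where t: "b < t" "t < b + r"
    "partial i g (x(i := s, j := b + r)) - partial i g (x(i := s, j := b)) = (b + r - b) * partial j (partial i g) (x(i := s, j := t))"
    using MVT2[of b "b + r" "\<lambda>t. partial i g (x(i := s, j := t))" "\<lambda>t. partial j (partial i g) (x(i := s, j := t))"]
      smooth_DERIV[OF smooth_partial[OF assms(1,2)] assms(3)] assms(5) by auto
  show ?thesis using s t by (intro exI[of _ s] exI[of _ t]) (simp add: \<phi>_def)
qed

text \<open>Schwarz's theorem. On squares of side r n shrinking to (a, b), the symmetric second
  difference equals r n ^ 2 times either mixed derivative at suitable points, so the two mixed
  derivatives agree at nearby points and, by continuity, in the limit.\<close>

lemma partial_commute:
  assumes "smooth g" "i \<in> {1..p}" "j \<in> {1..p}"
  shows "partial i (partial j g) = partial j (partial i g)"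
proof (cases "i = j")
  case False
  show ?thesis
  proof
    fix x :: point
    define a b where "a = x i" and "b = x j"
    define r where "r n = inverse (real (Suc n))" for n
    have r: "r n > 0" for n by (simp add: r_def)
    have r0: "r \<longlonglongrightarrow> 0" unfolding r_def by (rule LIMSEQ_inverse_real_of_nat)
    define G where "G u = partial j (partial i g) (x(i := fst u, j := snd u))" for u :: "real \<times> real"
    define H where "H u = partial i (partial j g) (x(i := fst u, j := snd u))" for u :: "real \<times> real"
    define near where "near n u \<longleftrightarrow> a < fst u \<and> fst u < a + r n \<and> b < snd u \<and> snd u < b + r n" for n u
    have sw: "x(i := s, j := t) = x(j := t, i := s)" for s t using False by (simp add: fun_upd_twist)
    have "\<exists>u v. near n u \<and> near n v \<and> G u = H v" for n
    proof -
      obtain s t where st: "a < s" "s < a + r n" "b < t" "t < b + r n"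
        "g (x(i := a + r n, j := b + r n)) - g (x(i := a + r n, j := b)) - g (x(i := a, j := b + r n)) + g (x(i := a, j := b)) =
         r n * r n * partial j (partial i g) (x(i := s, j := t))"
        using mixed_difference[OF assms(1,2,3) False r[of n], of a b x] by blast
      obtain t' s' where st': "b < t'" "t' < b + r n" "a < s'" "s' < a + r n"
        "g (x(j := b + r n, i := a + r n)) - g (x(j := b + r n, i := a)) - g (x(j := b, i := a + r n)) + g (x(j := b, i := a)) =
         r n * r n * partial i (partial j g) (x(j := t', i := s'))"
        using mixed_difference[OF assms(1,3,2) False[symmetric] r[of n], of b a x] by blast
      have "r n * r n * G (s, t) = r n * r n * H (s', t')"
        using st(5) st'(5) unfolding G_def H_def sw fst_conv snd_conv by linarith
      then have "G (s, t) = H (s', t')" using r[of n] by simp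
      moreover have "near n (s, t)" "near n (s', t')" using st(1-4) st'(1-4) by (simp_all add: near_def)
      ultimately show ?thesis by blast
    qed
    then obtain u v where u: "\<And>n. near n (u n)" and v: "\<And>n. near n (v n)" and eq: "\<And>n. G (u n) = H (v n)"
      by metis
    have lim0: "w \<longlonglongrightarrow> l" if "\<And>n. l < w n" "\<And>n. w n < l + r n" for w l
    proof (rule tendsto_sandwich[of "\<lambda>n. l" w _ "\<lambda>n. l + r n"])
      show "(\<lambda>n. l + r n) \<longlonglongrightarrow> l" using tendsto_add[OF tendsto_const r0, of l] by simp
    qed (simp_all add: that less_imp_le)
    have lim: "w \<longlonglongrightarrow> (a, b)" if "\<And>n. near n (w n)" for w
      using tendsto_Pair[OF lim0[of a "\<lambda>n. fst (w n)"] lim0[of b "\<lambda>n. snd (w n)"]] that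
      by (simp add: near_def)
    have cont: "continuous_on UNIV (\<lambda>u :: real \<times> real. f (x(i := fst u, j := snd u)))" if "smooth f" for f
      by (rule continuous_on_compose2[OF smooth_continuous[OF that] continuous_on_fun_upd2]) simp
    have "(\<lambda>n. G (u n)) \<longlonglongrightarrow> G (a, b)" "(\<lambda>n. H (v n)) \<longlonglongrightarrow> H (a, b)"
      unfolding G_def H_def
      by (intro continuous_on_tendsto_compose[OF cont] smooth_partial assms lim u v UNIV_I always_eventually allI)+
    then have "G (a, b) = H (a, b)"
      unfolding eq by (rule LIMSEQ_unique)
    then show "partial i (partial j g) x = partial j (partial i g) x" by (simp add: G_def H_def a_def b_def)
  qed
qed simp

end

subsection \<open>The algebra of superfunctions\<close>

lemma inversions_eq_sum_left:
  assumes "finite I" "finite J"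
  shows "inversions I J = (\<Sum>i\<in>I. card {j\<in>J. j < i})"
proof -
  have "{(i, j). i \<in> I \<and> j \<in> J \<and> j < i} = (SIGMA i:I. {j\<in>J. j < i})" by auto
  then show ?thesis using assms by (simp add: inversions_def card_SigmaI)
qed

lemma inversions_eq_sum_right:
  assumes "finite I" "finite J"
  shows "inversions I J = (\<Sum>j\<in>J. card {i\<in>I. j < i})"
proof -
  have "{(i, j). i \<in> I \<and> j \<in> J \<and> j < i} = prod.swap ` (SIGMA j:J. {i\<in>I. j < i})" by force
  then show ?thesis using assms by (simp add: inversions_def card_SigmaI card_image)
qed

lemma inversions_Un_left:
  assumes "finite I" "finite I'" "finite J" "I \<inter> I' = {}"
  shows "inversions (I \<union> I') J = inversions I J + inversions I' J"
  using assms by (simp add: inversions_eq_sum_left sum.union_disjoint)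

lemma inversions_Un_right:
  assumes "finite I" "finite J" "finite J'" "J \<inter> J' = {}"
  shows "inversions I (J \<union> J') = inversions I J + inversions I J'"
  using assms by (simp add: inversions_eq_sum_right sum.union_disjoint)

lemma inversions_empty [simp]: "inversions {} J = 0" "inversions I {} = 0"
  by (simp_all add: inversions_def)

text \<open>Both bracketings sum over the ordered partitions of K into three blocks. Since
  \<open>inversions\<close> is additive over disjoint unions, either way a partition carries the
  inversions between its three pairs of blocks.\<close>

lemma star_assoc: "(f \<star> g) \<star> h = f \<star> (g \<star> h)"
proof (intro ext)
  fix K x
  show "((f \<star> g) \<star> h) K x = (f \<star> (g \<star> h)) K x"
  proof (cases "finite K")
    case K: True
    let ?s = "\<lambda>I J. (-1 :: real) ^ inversions I J"
    have fin: "finite I" if "I \<subseteq> K" for I using that K finite_subset by blast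
    have "((f \<star> g) \<star> h) K x = (\<Sum>(J, I)\<in>(SIGMA J:Pow K. Pow J).
        ?s J (K - J) * (?s I (J - I) * f I x * g (J - I) x) * h (K - J) x)"
      unfolding sfun_mult_def using K fin
      by (subst sum.Sigma[symmetric]) (auto simp: sum_distrib_left sum_distrib_right)
    also have "\<dots> = (\<Sum>(I, L)\<in>(SIGMA I:Pow K. Pow (K - I)).
        ?s I (K - I) * f I x * (?s L (K - I - L) * g L x * h (K - I - L) x))"
    proof (rule sum.reindex_bij_witness[of _ "\<lambda>(I, L). (I \<union> L, I)" "\<lambda>(J, I). (I, J - I)"])
      fix a assume "a \<in> (SIGMA J:Pow K. Pow J)"
      then obtain J I where a: "a = (J, I)" "I \<subseteq> J" "J \<subseteq> K" by auto
      have f: "finite I" "finite (J - I)" "finite (K - J)" using a K fin by auto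
      have "J = I \<union> (J - I)" "K - I = (J - I) \<union> (K - J)" using a by auto
      then have "inversions J (K - J) = inversions I (K - J) + inversions (J - I) (K - J)"
        "inversions I (K - I) = inversions I (J - I) + inversions I (K - J)"
        using inversions_Un_left[of I "J - I" "K - J"] inversions_Un_right[of I "J - I" "K - J"] f a by auto
      moreover have "K - I - (J - I) = K - J" using a by auto
      ultimately show "(case case a of (J, I) \<Rightarrow> (I, J - I) of (I, L) \<Rightarrow>
          ?s I (K - I) * f I x * (?s L (K - I - L) * g L x * h (K - I - L) x)) =
        (case a of (J, I) \<Rightarrow> ?s J (K - J) * (?s I (J - I) * f I x * g (J - I) x) * h (K - J) x)"
        by (simp add: a power_add mult_ac)
    qed auto
    also have "\<dots> = (f \<star> (g \<star> h)) K x"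
      unfolding sfun_mult_def using K fin
      by (subst sum.Sigma[symmetric]) (auto simp: sum_distrib_left sum_distrib_right)
    finally show ?thesis .
  qed (simp add: sfun_mult_def finite_Pow_iff)
qed

lemma star_add_left: "(f + g) \<star> h = f \<star> h + g \<star> h"
  and star_add_right: "f \<star> (g + h) = f \<star> g + f \<star> h"
  and star_scale_left [simp]: "(r *\<^sub>R f) \<star> g = r *\<^sub>R (f \<star> g)"
  and star_scale_right [simp]: "f \<star> (r *\<^sub>R g) = r *\<^sub>R (f \<star> g)"
  and star_0_left [simp]: "0 \<star> f = 0"
  and star_0_right [simp]: "f \<star> 0 = 0"
  by (simp_all add: fun_eq_iff sfun_mult_def scaleR_fun_def sum.distrib sum_distrib_left algebra_simps)

lemma star_sum_right: "g \<star> (\<Sum>a\<in>A. f a) = (\<Sum>a\<in>A. g \<star> f a)"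
  using sum_comp_morphism[where h = "\<lambda>f. g \<star> f" and g = f and A = A, OF star_0_right star_add_right]
  unfolding comp_def by (rule sym)

lemma star_minus_right [simp]: "f \<star> (- g) = - (f \<star> g)"
  using star_scale_right[of f "-1" g] by simp

definition below :: "nat \<Rightarrow> nat set \<Rightarrow> nat" where "below i I = card {j\<in>I. j < i}"

lemma inversions_insert_left:
  assumes "finite I" "finite J" "i \<notin> I"
  shows "inversions (insert i I) J = inversions I J + below i J"
  using assms by (simp add: inversions_eq_sum_left below_def)

text \<open>The elements of I above i become new inversions and those below i do not; together they
  make up I. The additive form avoids truncated subtraction.\<close>

lemma inversions_insert_right:
  assumes "finite I" "finite J" "i \<notin> J" "i \<notin> I"
  shows "inversions I (insert i J) + below i I = inversions I J + card I"
proof -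
  have "{k\<in>I. i < k} \<union> {k\<in>I. k < i} = I"
    using assms(4) by (force simp: not_less_iff_gr_or_eq)
  then have "card I = card {k\<in>I. i < k} + below i I"
    unfolding below_def using assms(1) card_Un_disjoint[of "{k\<in>I. i < k}" "{k\<in>I. k < i}"] by fastforce
  then show ?thesis using assms by (simp add: inversions_eq_sum_right)
qed

lemma below_Un: "finite I \<Longrightarrow> finite J \<Longrightarrow> I \<inter> J = {} \<Longrightarrow> below i (I \<union> J) = below i I + below i J"
proof -
  assume *: "finite I" "finite J" "I \<inter> J = {}"
  have "{j \<in> I \<union> J. j < i} = {j\<in>I. j < i} \<union> {j\<in>J. j < i}" by auto
  then show ?thesis unfolding below_def using * by (subst card_Un_disjoint[symmetric]) auto
qed

lemma below_insert: "finite I \<Longrightarrow> j \<notin> I \<Longrightarrow> below i (insert j I) = below i I + (if j < i then 1 else 0)"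
  using below_Un[of I "{j}" i] by (auto simp: below_def card_1_singleton_iff)

lemma below_insert_self [simp]: "below i (insert i I) = below i I"
proof -
  have "{j \<in> insert i I. j < i} = {j\<in>I. j < i}" by auto
  then show ?thesis by (simp add: below_def)
qed

lemma below_empty [simp]: "below i {} = 0"
  by (simp add: below_def)

lemma sum_Pow_insert:
  assumes "finite K" "i \<notin> K"
  shows "(\<Sum>I\<in>Pow (insert i K). F I) = (\<Sum>I\<in>Pow K. F I + (F (insert i I) :: real))"
proof -
  have "inj_on (insert i) (Pow K)" using assms by (auto simp: inj_on_def)
  moreover have "Pow K \<inter> insert i ` Pow K = {}" using assms by auto
  ultimately show ?thesis
    using assms by (simp add: Pow_insert sum.union_disjoint sum.reindex sum.distrib)
qed

text \<open>Converts additive identities between inversion counts into sign identities: (-1) ^ b is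
  its own inverse, so b may change sides.\<close>

lemma neg_one_power_eq:
  assumes "a + b = c + d"
  shows "(-1 :: real) ^ a = (-1) ^ b * (-1) ^ (c + d)"
proof -
  have "(-1 :: real) ^ b * (-1) ^ b = 1" by (simp flip: power_mult_distrib)
  then show ?thesis unfolding assms[symmetric] power_add by (simp add: mult.left_commute)
qed

section \<open>The sign involution, coordinates and derivatives of superfunctions\<close>

context superspace
begin

text \<open>The sign created when something with the parity of y^i passes f, written as an
  automorphism of the algebra so that f need not be homogeneous. Index 0 counts as even, so
  \<open>tau 0\<close> is the identity.\<close>

definition tau :: "nat \<Rightarrow> sfun \<Rightarrow> sfun" where
  "tau i f = (\<lambda>I. (-1) ^ (par i * card I) *\<^sub>R f I)"

definition one :: sfun where
  "one = (\<lambda>I x. if I = {} then 1 else 0)"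

lemma sfuns_smooth: "f \<in> sfuns \<Longrightarrow> smooth (f I)"
  by (simp add: sfuns_def)

lemma sfuns_supp: "f \<in> sfuns \<Longrightarrow> \<not> I \<subseteq> {p+1..p+q} \<Longrightarrow> f I = 0"
  by (simp add: sfuns_def)

lemma sfuns_infinite: "f \<in> sfuns \<Longrightarrow> infinite I \<Longrightarrow> f I = 0"
  by (rule sfuns_supp) (auto dest: finite_subset)

lemma pderiv_odd:
  "\<not> i \<le> p \<Longrightarrow> pderiv i f I x = (if i \<in> I then 0 else (-1) ^ below i I * f (insert i I) x)"
  by (simp add: pderiv_def below_def scaleR_fun_def)

lemma pderiv_even: "i \<le> p \<Longrightarrow> pderiv i f I x = partial i (f I) x"
  by (simp add: pderiv_def)

text \<open>Comparison of the coefficients at K. If i is not in K, the factorizations of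
  \<open>insert i K\<close> with i in the left part give the first summand and those with i in the
  right part the second. If i is in K, the left side is 0, and on the right the two summands cancel
  term by term.\<close>

lemma pderiv_star_odd:
  assumes "\<not> i \<le> p"
  shows "pderiv i (f \<star> g) = pderiv i f \<star> g + tau i f \<star> pderiv i g"
proof (intro ext)
  fix K x
  have par: "par i = 1" using assms by (simp add: par_def)
  show "pderiv i (f \<star> g) K x = (pderiv i f \<star> g + tau i f \<star> pderiv i g) K x"
  proof (cases "finite K")
    case K: True
    have fin: "finite I" if "I \<subseteq> K" for I using that K finite_subset by blast
    show ?thesis
    proof (cases "i \<in> K")
      case False
      have 1: "(-1) ^ below i K * ((-1) ^ inversions (insert i I) (insert i K - insert i I)) =
          (-1) ^ inversions I (K - I) * (-1 :: real) ^ below i I" if "I \<subseteq> K" for I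
      proof -
        have "insert i K - insert i I = K - I" "i \<notin> I" using False that by auto
        moreover have "below i K = below i I + below i (K - I)"
          using below_Un[of I "K - I" i] that K fin by (simp add: Un_absorb1)
        ultimately show ?thesis using that fin K
          by (simp add: inversions_insert_left power_add mult_ac)
      qed
      have 2: "(-1) ^ below i K * ((-1) ^ inversions I (insert i K - I)) =
          (-1) ^ inversions I (K - I) * (-1) ^ card I * (-1 :: real) ^ below i (K - I)" if "I \<subseteq> K" for I
      proof -
        have i: "insert i K - I = insert i (K - I)" "i \<notin> I" using False that by auto
        have "inversions I (insert i (K - I)) + below i I = inversions I (K - I) + card I"
          using i K fin[OF that] False by (intro inversions_insert_right) auto
        then have "(-1 :: real) ^ inversions I (insert i (K - I)) = (-1) ^ below i I * (-1) ^ (inversions I (K - I) + card I)"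
          by (rule neg_one_power_eq)
        moreover have "below i K = below i I + below i (K - I)"
          using below_Un[of I "K - I" i] that K fin by (simp add: Un_absorb1)
        ultimately show ?thesis unfolding i(1)
          by (simp add: power_add mult_ac)
      qed
      have "pderiv i (f \<star> g) K x = (\<Sum>I\<in>Pow K.
          ((-1) ^ below i K * (-1) ^ inversions I (insert i K - I)) * f I x * g (insert i K - I) x +
          ((-1) ^ below i K * (-1) ^ inversions (insert i I) (insert i K - insert i I)) * f (insert i I) x * g (insert i K - insert i I) x)"
        using False assms unfolding pderiv_odd[OF assms] sfun_mult_def sum_Pow_insert[OF K False]
        by (simp add: sum_distrib_left algebra_simps)
      also have "\<dots> = (\<Sum>I\<in>Pow K. (-1) ^ inversions I (K - I) * (-1) ^ card I * (-1) ^ below i (K - I) * f I x * g (insert i (K - I)) x +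
          (-1) ^ inversions I (K - I) * (-1) ^ below i I * f (insert i I) x * g (K - I) x)"
      proof (rule sum.cong)
        fix I assume "I \<in> Pow K"
        then have I: "I \<subseteq> K" by simp
        have "insert i K - insert i I = K - I" "insert i K - I = insert i (K - I)" using False I by auto
        then show "((-1) ^ below i K * (-1) ^ inversions I (insert i K - I)) * f I x * g (insert i K - I) x +
          ((-1) ^ below i K * (-1) ^ inversions (insert i I) (insert i K - insert i I)) * f (insert i I) x * g (insert i K - insert i I) x =
          (-1) ^ inversions I (K - I) * (-1) ^ card I * (-1) ^ below i (K - I) * f I x * g (insert i (K - I)) x +
          (-1) ^ inversions I (K - I) * (-1) ^ below i I * f (insert i I) x * g (K - I) x"
          unfolding 1[OF I] 2[OF I] by simp
      qed simp
      also have "\<dots> = (pderiv i f \<star> g + tau i f \<star> pderiv i g) K x"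
        using False unfolding plus_fun_apply sfun_mult_def sum.distrib[symmetric]
        by (intro sum.cong) (auto simp: pderiv_odd[OF assms] tau_def par scaleR_fun_def)
      finally show ?thesis .
    next
      case True
      define K' where "K' = K - {i}"
      have K': "K = insert i K'" "i \<notin> K'" "finite K'" using True K by (auto simp: K'_def)
      have "(pderiv i f \<star> g + tau i f \<star> pderiv i g) K x = (\<Sum>I\<in>Pow K'. 0)"
        unfolding plus_fun_apply sfun_mult_def sum.distrib[symmetric] K'(1) sum_Pow_insert[OF K'(3,2)]
      proof (rule sum.cong)
        fix I assume "I \<in> Pow K'"
        then have I: "I \<subseteq> K'" by simp
        then have d: "insert i K' - insert i I = K' - I" "insert i K' - I = insert i (K' - I)" "i \<notin> I" "finite I" "insert i (K' - I) - {i} = K' - I"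
          using K' finite_subset by auto
        have "inversions I (insert i (K' - I)) + below i I = inversions I (K' - I) + card I"
          using K' d by (intro inversions_insert_right) auto
        then have "(-1 :: real) ^ inversions I (insert i (K' - I)) = (-1) ^ below i I * (-1) ^ (inversions I (K' - I) + card I)"
          by (rule neg_one_power_eq)
        moreover have "inversions (insert i I) (K' - I) = inversions I (K' - I) + below i (K' - I)"
          using K' d by (intro inversions_insert_left) auto
        ultimately show "(-1) ^ inversions I (insert i K' - I) * pderiv i f I x * g (insert i K' - I) x +
            (-1) ^ inversions (insert i I) (insert i K' - insert i I) * pderiv i f (insert i I) x * g (insert i K' - insert i I) x +
            ((-1) ^ inversions I (insert i K' - I) * tau i f I x * pderiv i g (insert i K' - I) x +
             (-1) ^ inversions (insert i I) (insert i K' - insert i I) * tau i f (insert i I) x * pderiv i g (insert i K' - insert i I) x) = 0"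
          unfolding d(1,2) using d(3,4) K'(2)
          by (simp add: pderiv_odd[OF assms] tau_def par scaleR_fun_def power_add mult_ac)
      qed simp
      then show ?thesis using True by (simp add: pderiv_odd[OF assms])
    qed
  qed (simp add: pderiv_odd[OF assms] sfun_mult_def finite_Pow_iff)
qed

lemma pderiv_star:
  assumes "f \<in> sfuns" "g \<in> sfuns" "i \<in> {1..p+q}"
  shows "pderiv i (f \<star> g) = pderiv i f \<star> g + tau i f \<star> pderiv i g"
proof (cases "i \<le> p")
  case True
  then have i: "i \<in> {1..p}" using assms by simp
  show ?thesis
  proof (intro ext)
    fix K x
    show "pderiv i (f \<star> g) K x = (pderiv i f \<star> g + tau i f \<star> pderiv i g) K x"
    proof (cases "finite K")
      case K: True
      then have "partial i ((f \<star> g) K) x =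
        (\<Sum>I\<in>Pow K. (-1) ^ inversions I (K - I) * (partial i (f I) x * g (K - I) x + f I x * partial i (g (K - I)) x))"
        unfolding sfun_mult_def using assms i
        by (subst partial_sum_mult) (auto intro: sfuns_smooth)
      then show ?thesis using True
        by (simp add: pderiv_even tau_def par_def sfun_mult_def algebra_simps sum.distrib)
    qed (use True in \<open>simp add: pderiv_even sfun_mult_def finite_Pow_iff\<close>)
  qed
qed (rule pderiv_star_odd)

lemma sfuns_0 [simp, intro]: "0 \<in> sfuns"
  by (simp add: sfuns_def)

lemma sfuns_add [simp, intro]: "f \<in> sfuns \<Longrightarrow> g \<in> sfuns \<Longrightarrow> f + g \<in> sfuns"
  by (simp add: sfuns_def smooth_add)

lemma sfuns_scale [simp, intro]: "f \<in> sfuns \<Longrightarrow> r *\<^sub>R f \<in> sfuns"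
  by (simp add: sfuns_def scaleR_fun_def[of r f] smooth_scale)

lemma sfuns_sum: "(\<And>a. a \<in> A \<Longrightarrow> f a \<in> sfuns) \<Longrightarrow> sum f A \<in> sfuns"
  by (induction A rule: infinite_finite_induct) simp_all

lemma sfuns_tau [simp, intro]: "f \<in> sfuns \<Longrightarrow> tau i f \<in> sfuns"
  by (simp add: sfuns_def tau_def smooth_scale)

lemma sfuns_fpart [simp, intro]: "f \<in> sfuns \<Longrightarrow> fpart a f \<in> sfuns"
  by (simp add: sfuns_def fpart_def)

lemma sfuns_pderiv [simp, intro]:
  assumes "f \<in> sfuns" "i \<in> {1..p+q}"
  shows "pderiv i f \<in> sfuns"
proof -
  have "smooth (pderiv i f I)" for I
    using assms by (auto simp: pderiv_def sfuns_def intro!: smooth_partial smooth_scale)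
  moreover have "pderiv i f I = 0" if "\<not> I \<subseteq> {p+1..p+q}" for I
    using that sfuns_supp[OF assms(1) that] sfuns_supp[OF assms(1), of "insert i I"] by (auto simp: pderiv_def)
  ultimately show ?thesis by (simp add: sfuns_def)
qed

lemma sfuns_one [simp, intro]: "one \<in> sfuns"
proof -
  have "one I = (\<lambda>x. if I = {} then 1 else 0)" for I by (simp add: one_def)
  then show ?thesis by (auto simp: sfuns_def zero_fun_def)
qed

lemma coord_even_star:
  assumes "i \<le> p" "f \<in> sfuns"
  shows "coord i \<star> f = (\<lambda>K x. x i * f K x)" "f \<star> coord i = (\<lambda>K x. x i * f K x)"
proof -
  have "(coord i \<star> f) K x = x i * f K x" "(f \<star> coord i) K x = x i * f K x" for K x
  proof -
    have "(\<Sum>I\<in>Pow K. (-1) ^ inversions I (K - I) * coord i I x * f (K - I) x) =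
        (\<Sum>I\<in>Pow K. if I = {} then x i * f K x else 0)"
      using assms(1) by (intro sum.cong) (auto simp: coord_def)
    then show "(coord i \<star> f) K x = x i * f K x"
      using sfuns_infinite[OF assms(2), of K] by (cases "finite K") (simp_all add: sfun_mult_def)
    have "(\<Sum>I\<in>Pow K. (-1) ^ inversions I (K - I) * f I x * coord i (K - I) x) =
        (\<Sum>I\<in>Pow K. if I = K then x i * f K x else 0)"
      using assms(1) by (intro sum.cong) (auto simp: coord_def)
    then show "(f \<star> coord i) K x = x i * f K x"
      using sfuns_infinite[OF assms(2), of K] by (cases "finite K") (simp_all add: sfun_mult_def)
  qed
  then show "coord i \<star> f = (\<lambda>K x. x i * f K x)" "f \<star> coord i = (\<lambda>K x. x i * f K x)"
    by (intro ext, blast)+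
qed

lemma coord_odd_star:
  assumes "\<not> i \<le> p" "f \<in> sfuns"
  shows "coord i \<star> f = (\<lambda>K. if i \<in> K then (-1) ^ below i K *\<^sub>R f (K - {i}) else 0)"
    "f \<star> coord i = (\<lambda>K. if i \<in> K then ((-1) ^ below i K * (-1) ^ card (K - {i})) *\<^sub>R f (K - {i}) else 0)"
proof -
  have "(coord i \<star> f) K x = (if i \<in> K then (-1) ^ below i K *\<^sub>R f (K - {i}) else 0) x"
    "(f \<star> coord i) K x = (if i \<in> K then ((-1) ^ below i K * (-1) ^ card (K - {i})) *\<^sub>R f (K - {i}) else 0) x" for K x
  proof -
    have fin: "f (K - {i}) = 0" if "infinite K"
      using sfuns_infinite[OF assms(2)] that by simp
    have inv: "inversions {i} (K - {i}) = below i K" "(-1 :: real) ^ inversions (K - {i}) {i} = (-1) ^ below i K * (-1) ^ card (K - {i})"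
      if "finite K" "i \<in> K"
    proof -
      have b: "below i (K - {i}) = below i K" using below_insert_self[of i "K - {i}"] that by (simp add: insert_absorb)
      show "inversions {i} (K - {i}) = below i K"
        using inversions_insert_left[of "{}" "K - {i}" i] that b by simp
      show "(-1 :: real) ^ inversions (K - {i}) {i} = (-1) ^ below i K * (-1) ^ card (K - {i})"
        using neg_one_power_eq[OF inversions_insert_right[of "K - {i}" "{}" i]] that b by simp
    qed
    have "(\<Sum>I\<in>Pow K. (-1) ^ inversions I (K - I) * coord i I x * f (K - I) x) =
        (\<Sum>I\<in>Pow K. if I = {i} then (-1) ^ inversions {i} (K - {i}) * f (K - {i}) x else 0)"
      using assms(1) by (intro sum.cong) (auto simp: coord_def)
    then show "(coord i \<star> f) K x = (if i \<in> K then (-1) ^ below i K *\<^sub>R f (K - {i}) else 0) x"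
      using fin inv by (cases "finite K") (auto simp: sfun_mult_def scaleR_fun_def)
    have "(\<Sum>I\<in>Pow K. (-1) ^ inversions I (K - I) * f I x * coord i (K - I) x) =
        (\<Sum>I\<in>Pow K. if I = K - {i} then (if i \<in> K then (-1) ^ inversions (K - {i}) {i} * f (K - {i}) x else 0) else 0)"
    proof (rule sum.cong)
      fix I assume "I \<in> Pow K"
      then have "K - I = {i} \<longleftrightarrow> I = K - {i} \<and> i \<in> K" by auto
      moreover have "i \<in> K \<Longrightarrow> K - (K - {i}) = {i}" by auto
      ultimately show "(-1) ^ inversions I (K - I) * f I x * coord i (K - I) x =
        (if I = K - {i} then (if i \<in> K then (-1) ^ inversions (K - {i}) {i} * f (K - {i}) x else 0) else 0)"
        using assms(1) by (auto simp: coord_def)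
    qed simp
    also have "\<dots> = (if finite K \<and> i \<in> K then (-1) ^ inversions (K - {i}) {i} * f (K - {i}) x else 0)"
      by (cases "finite K") auto
    finally show "(f \<star> coord i) K x = (if i \<in> K then ((-1) ^ below i K * (-1) ^ card (K - {i})) *\<^sub>R f (K - {i}) else 0) x"
      using fin inv by (cases "finite K") (auto simp: sfun_mult_def scaleR_fun_def)
  qed
  then show "coord i \<star> f = (\<lambda>K. if i \<in> K then (-1) ^ below i K *\<^sub>R f (K - {i}) else 0)"
    "f \<star> coord i = (\<lambda>K. if i \<in> K then ((-1) ^ below i K * (-1) ^ card (K - {i})) *\<^sub>R f (K - {i}) else 0)"
    by (intro ext, blast)+
qed

lemma one_star:
  assumes "f \<in> sfuns"
  shows "one \<star> f = f" "f \<star> one = f"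
proof -
  have "(one \<star> f) K x = f K x" "(f \<star> one) K x = f K x" for K x
  proof -
    have "(\<Sum>I\<in>Pow K. (-1) ^ inversions I (K - I) * one I x * f (K - I) x) =
        (\<Sum>I\<in>Pow K. if I = {} then f K x else 0)"
      by (intro sum.cong) (auto simp: one_def)
    then show "(one \<star> f) K x = f K x"
      using sfuns_infinite[OF assms(1), of K] by (cases "finite K") (simp_all add: sfun_mult_def)
    have "(\<Sum>I\<in>Pow K. (-1) ^ inversions I (K - I) * f I x * one (K - I) x) =
        (\<Sum>I\<in>Pow K. if I = K then f K x else 0)"
      by (intro sum.cong) (auto simp: one_def)
    then show "(f \<star> one) K x = f K x"
      using sfuns_infinite[OF assms(1), of K] by (cases "finite K") (simp_all add: sfun_mult_def)
  qed
  then show "one \<star> f = f" "f \<star> one = f" by (intro ext, blast)+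
qed

lemma sfuns_coord_star [simp, intro]:
  assumes "f \<in> sfuns" "i \<in> {1..p+q}"
  shows "coord i \<star> f \<in> sfuns"
proof (cases "i \<le> p")
  case True
  then have "smooth (\<lambda>x. x i * f K x)" for K
    using assms by (intro smooth_coord_mult sfuns_smooth) auto
  then show ?thesis
    using sfuns_supp[OF assms(1)] by (simp add: coord_even_star[OF True assms(1)] sfuns_def fun_eq_iff)
next
  case False
  have "f (K - {i}) = 0" if "i \<in> K" "\<not> K \<subseteq> {p+1..p+q}" for K
    by (rule sfuns_supp[OF assms(1)]) (use that False assms(2) in auto)
  then show ?thesis
    using sfuns_smooth[OF assms(1)] by (auto simp: coord_odd_star[OF False assms(1)] sfuns_def intro!: smooth_scale)
qed

lemma sfuns_coord [simp, intro]: "i \<in> {1..p+q} \<Longrightarrow> coord i \<in> sfuns"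
proof -
  assume i: "i \<in> {1..p+q}"
  have "coord i \<star> one = coord i"
  proof (cases "i \<le> p")
    case True
    then show ?thesis unfolding coord_even_star[OF True sfuns_one] by (auto simp: coord_def one_def fun_eq_iff)
  next
    case False
    show ?thesis unfolding coord_odd_star[OF False sfuns_one]
      using False by (auto simp: coord_def one_def scaleR_fun_def fun_eq_iff)
  qed
  then show ?thesis using sfuns_coord_star[OF sfuns_one i] by simp
qed

lemma star_coord:
  assumes "f \<in> sfuns"
  shows "f \<star> coord i = coord i \<star> tau i f"
proof (cases "i \<le> p")
  case True
  then show ?thesis using assms by (simp add: coord_even_star tau_def par_def)
next
  case False
  then show ?thesis
    unfolding coord_odd_star(2)[OF False assms] coord_odd_star(1)[OF False sfuns_tau[OF assms]]
    by (auto simp: tau_def par_def fun_eq_iff scaleR_fun_def)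
qed

lemma tau_add: "tau i (f + g) = tau i f + tau i g"
  by (auto simp: tau_def fun_eq_iff scaleR_fun_def algebra_simps)

lemma tau_scale [simp]: "tau i (r *\<^sub>R f) = r *\<^sub>R tau i f"
  by (auto simp: tau_def fun_eq_iff scaleR_fun_def)

lemma tau_0 [simp]: "tau i 0 = 0"
  using tau_scale[of i 0 0] by simp

lemma tau_commute: "tau i (tau j f) = tau j (tau i f)"
  by (auto simp: tau_def fun_eq_iff scaleR_fun_def)

lemma tau_tau [simp]: "tau i (tau i f) = f"
  by (auto simp: tau_def fun_eq_iff scaleR_fun_def simp flip: power_add mult.assoc)

lemma tau_star: "tau i (f \<star> g) = tau i f \<star> tau i g"
proof (intro ext)
  fix K x
  have "(-1) ^ (par i * card K) * ((-1) ^ inversions I (K - I) * f I x * g (K - I) x) =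
    (-1) ^ inversions I (K - I) * ((-1) ^ (par i * card I) * f I x) * ((-1) ^ (par i * card (K - I)) * g (K - I) x)"
    if "I \<in> Pow K" "finite K" for I
  proof -
    have "card K = card I + card (K - I)"
      using that by (simp add: card_Diff_subset finite_subset card_mono)
    then show ?thesis by (simp add: power_add algebra_simps)
  qed
  then show "tau i (f \<star> g) K x = (tau i f \<star> tau i g) K x"
    by (cases "finite K") (auto simp: tau_def sfun_mult_def scaleR_fun_def sum_distrib_left intro!: sum.cong)
qed

lemma tau_coord: "tau i (coord j) = (-1) ^ (par i * par j) *\<^sub>R coord j"
  by (auto simp: tau_def coord_def fun_eq_iff scaleR_fun_def par_def)

lemma tau_one [simp]: "tau i one = one"
  by (auto simp: tau_def one_def fun_eq_iff scaleR_fun_def)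

lemma tau_pderiv:
  assumes "f \<in> sfuns" "j \<in> {1..p+q}"
  shows "tau i (pderiv j f) = (-1) ^ (par i * par j) *\<^sub>R pderiv j (tau i f)"
proof (intro ext)
  fix I x
  show "tau i (pderiv j f) I x = ((-1) ^ (par i * par j) *\<^sub>R pderiv j (tau i f)) I x"
  proof (cases "j \<le> p")
    case True
    then have "partial j ((-1) ^ (par i * card I) *\<^sub>R f I) = (-1) ^ (par i * card I) *\<^sub>R partial j (f I)"
      using assms by (intro partial_scale sfuns_smooth) auto
    then show ?thesis using True by (simp add: tau_def pderiv_even scaleR_fun_def par_def[of j])
  next
    case False
    have "infinite I \<Longrightarrow> f (insert j I) = 0"
      using sfuns_infinite[OF assms(1)] by simp
    moreover have "(-1 :: real) ^ (par i + par i) = 1" by (simp flip: mult_2)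
    then have "(-1 :: real) ^ par i * ((-1) ^ par i * r) = r" for r
      by (simp flip: power_add mult.assoc)
    ultimately show ?thesis using False
      by (cases "finite I") (auto simp: tau_def pderiv_odd scaleR_fun_def par_def[of j] power_add)
  qed
qed

lemma pderiv_add:
  assumes "f \<in> sfuns" "g \<in> sfuns" "i \<in> {1..p+q}"
  shows "pderiv i (f + g) = pderiv i f + pderiv i g"
  using assms by (auto simp: pderiv_def fun_eq_iff partial_add sfuns_smooth scaleR_fun_def algebra_simps)

lemma pderiv_scale:
  assumes "f \<in> sfuns" "i \<in> {1..p+q}"
  shows "pderiv i (r *\<^sub>R f) = r *\<^sub>R pderiv i f"
proof -
  have 1: "(r *\<^sub>R f) I = r *\<^sub>R f I" for f :: sfun and I by (simp add: scaleR_fun_def)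
  show ?thesis
    by (rule ext) (use assms in \<open>auto simp: pderiv_def 1 partial_scale sfuns_smooth\<close>)
qed

lemma pderiv_0 [simp]: "pderiv i 0 = 0"
  by (auto simp: pderiv_def fun_eq_iff scaleR_fun_def)

lemma pderiv_sum:
  assumes "\<And>a. a \<in> A \<Longrightarrow> f a \<in> sfuns" "i \<in> {1..p+q}"
  shows "pderiv i (\<Sum>a\<in>A. f a) = (\<Sum>a\<in>A. pderiv i (f a))"
  using assms(1)
proof (induction A rule: infinite_finite_induct)
  case (insert a A)
  have "pderiv i (f a + sum f A) = pderiv i (f a) + pderiv i (sum f A)"
    using insert assms(2) by (intro pderiv_add sfuns_sum) auto
  then show ?case using insert by (simp only: sum.insert insert_iff simp_thms)
qed simp_all

lemma pderiv_one [simp]: "pderiv i one = 0"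
proof -
  have "one I = (\<lambda>x. if I = {} then 1 else 0)" for I by (simp add: one_def)
  then have "partial i (one I) = 0" for I by simp
  then show ?thesis by (auto simp: pderiv_def fun_eq_iff scaleR_fun_def one_def)
qed

lemma pderiv_coord: "pderiv i (coord j) = (if i = j then one else 0)"
proof (intro ext)
  fix I x
  have "coord j I = (if I = {} then (\<lambda>x. x j) else 0)" if "j \<le> p" using that by (auto simp: coord_def)
  moreover have "coord j I = (if I = {j} then (\<lambda>x. 1) else 0)" if "\<not> j \<le> p" for I using that by (auto simp: coord_def)
  ultimately show "pderiv i (coord j) I x = (if i = j then one else 0) I x"
    by (cases "i \<le> p"; cases "j \<le> p"; cases "I = {}")
      (auto simp: pderiv_even pderiv_odd partial_point_coord one_def coord_def)
qed

lemma pderiv_commute: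
  assumes "f \<in> sfuns" "i \<in> {1..p+q}" "j \<in> {1..p+q}"
  shows "pderiv i (pderiv j f) = (-1) ^ (par i * par j) *\<^sub>R pderiv j (pderiv i f)"
proof (intro ext)
  fix I x
  consider "i \<le> p" "j \<le> p" | "i \<le> p" "\<not> j \<le> p" | "\<not> i \<le> p" "j \<le> p" | "\<not> i \<le> p" "\<not> j \<le> p" by blast
  then show "pderiv i (pderiv j f) I x = ((-1) ^ (par i * par j) *\<^sub>R pderiv j (pderiv i f)) I x"
  proof cases
    case 1
    then show ?thesis
      using assms partial_commute[OF sfuns_smooth[OF assms(1)], of i j I] by (simp add: pderiv_def par_def scaleR_fun_def)
  next
    case 2
    then show ?thesis
      using assms partial_scale[OF sfuns_smooth[OF assms(1)], of i _ "insert j I"] by (simp add: pderiv_def par_def scaleR_fun_def)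
  next
    case 3
    then show ?thesis
      using assms partial_scale[OF sfuns_smooth[OF assms(1)], of j _ "insert i I"] by (simp add: pderiv_def par_def scaleR_fun_def)
  next
    case 4
    then have p: "par i = 1" "par j = 1" by (simp_all add: par_def)
    show ?thesis
    proof (cases "finite I")
      case True
      then show ?thesis
        using 4 by (auto simp: pderiv_odd p scaleR_fun_def below_insert insert_commute power_add)
    next
      case False
      then show ?thesis
        using 4 sfuns_infinite[OF assms(1)] by (simp add: pderiv_odd p scaleR_fun_def)
    qed
  qed
qed

text \<open>The sign that sorts e_j into the monomial of \<alpha>: e_j passes the factors of smaller
  index, and only when these are odd, in which case j is odd too, does a sign arise.\<close>

definition sg :: "nat \<Rightarrow> nat multiset \<Rightarrow> real" where
  "sg j \<alpha> = (-1) ^ card {i \<in> set_mset \<alpha>. p < i \<and> i < j}"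

text \<open>Multiplication by \<open>e\<^sub>j\<close> and the contraction with the dual vector. The involution \<open>t j\<close> accounts
  for the sign that arises when \<open>e\<^sub>j\<close> passes the coefficient.\<close>

definition emul :: "(nat \<Rightarrow> 'v \<Rightarrow> 'v) \<Rightarrow> nat \<Rightarrow> (nat multiset \<Rightarrow> 'v::real_vector) \<Rightarrow> nat multiset \<Rightarrow> 'v" where
  "emul t j T = (\<lambda>\<beta>. if \<beta> \<in> midx \<and> j \<in># \<beta> then sg j (\<beta> - {#j#}) *\<^sub>R t j (T (\<beta> - {#j#})) else 0)"

definition contr :: "(nat \<Rightarrow> 'v \<Rightarrow> 'v) \<Rightarrow> nat \<Rightarrow> (nat multiset \<Rightarrow> 'v::real_vector) \<Rightarrow> nat multiset \<Rightarrow> 'v" where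
  "contr t j T = (\<lambda>\<beta>. if add_mset j \<beta> \<in> midx
     then (real (Suc (count \<beta> j)) * sg j \<beta>) *\<^sub>R t j (T (add_mset j \<beta>)) else 0)"

text \<open>The factor by which \<open>sg i\<close> changes when j is added to the multi-index; see
  \<open>sg_add\<close>.\<close>

definition kap :: "nat \<Rightarrow> nat \<Rightarrow> real" where
  "kap i j = (if p < j \<and> j < i then -1 else 1)"

lemma kap_sq [simp]: "kap i j * kap i j = 1" "kap i j * (kap i j * r) = r"
  by (auto simp: kap_def)

text \<open>The product is -1 exactly when the smaller of the two indices is odd, and since odd
  indices come last, both are odd then.\<close>

lemma kap_kap: "i \<noteq> j \<Longrightarrow> kap i j * kap j i = (-1) ^ (par i * par j)"
  by (auto simp: kap_def par_def)

lemma sg_sq [simp]: "sg i \<alpha> * sg i \<alpha> = 1" "sg i \<alpha> * (sg i \<alpha> * r) = r"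
  by (simp_all add: sg_def flip: power_add mult.assoc)

lemma midx_add: "add_mset j \<beta> \<in> midx \<longleftrightarrow> \<beta> \<in> midx \<and> j \<in> {1..p+q} \<and> (p < j \<longrightarrow> j \<notin># \<beta>)"
proof -
  have "(\<forall>i. p < i \<longrightarrow> count (add_mset j \<beta>) i \<le> 1) \<longleftrightarrow>
      (\<forall>i. p < i \<longrightarrow> count \<beta> i \<le> 1) \<and> (p < j \<longrightarrow> count \<beta> j = 0)"
  proof (intro iffI conjI allI impI)
    fix i assume *: "\<forall>i. p < i \<longrightarrow> count (add_mset j \<beta>) i \<le> 1"
    show "p < i \<Longrightarrow> count \<beta> i \<le> 1" using *[rule_format, of i] by (cases "i = j") auto
  next
    assume *: "\<forall>i. p < i \<longrightarrow> count (add_mset j \<beta>) i \<le> 1"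
    show "p < j \<Longrightarrow> count \<beta> j = 0" using *[rule_format, of j] by simp
  next
    fix i assume "(\<forall>i. p < i \<longrightarrow> count \<beta> i \<le> 1) \<and> (p < j \<longrightarrow> count \<beta> j = 0)" "p < i"
    then show "count (add_mset j \<beta>) i \<le> 1" by (cases "i = j") auto
  qed
  then show ?thesis by (auto simp: midx_def not_in_iff)
qed

lemma midx_minus: "\<beta> \<in> midx \<Longrightarrow> j \<in># \<beta> \<Longrightarrow> \<beta> - {#j#} \<in> midx"
  by (metis insert_DiffM midx_add)

lemma midx_odd: "\<beta> \<in> midx \<Longrightarrow> j \<in># \<beta> \<Longrightarrow> p < j \<Longrightarrow> j \<notin># \<beta> - {#j#}"
  by (metis insert_DiffM midx_add)

lemma sg_add:
  assumes "add_mset j \<beta> \<in> midx"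
  shows "sg i (add_mset j \<beta>) = kap i j * sg i \<beta>"
proof (cases "p < j \<and> j < i")
  case True
  then have "{k \<in> set_mset (add_mset j \<beta>). p < k \<and> k < i} = insert j {k \<in> set_mset \<beta>. p < k \<and> k < i}"
    "j \<notin> {k \<in> set_mset \<beta>. p < k \<and> k < i}"
    using assms by (auto simp: midx_add)
  then show ?thesis using True by (simp add: sg_def kap_def)
next
  case False
  then have "{k \<in> set_mset (add_mset j \<beta>). p < k \<and> k < i} = {k \<in> set_mset \<beta>. p < k \<and> k < i}" by auto
  then show ?thesis using False by (simp add: sg_def kap_def)
qed

lemma sg_minus:
  assumes "\<beta> \<in> midx" "j \<in># \<beta>"
  shows "sg i \<beta> = kap i j * sg i (\<beta> - {#j#})"
  using sg_add[of j "\<beta> - {#j#}" i] assms by simp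

text \<open>The involution is left abstract so that the relations serve twice: with
  \<open>tau\<close> for symbols, and with the identity for the supersymmetric algebra, whose
  coefficients are real numbers.\<close>

context
  fixes t :: "nat \<Rightarrow> 'v::real_vector \<Rightarrow> 'v"
  assumes t_scale: "\<And>i r v. t i (r *\<^sub>R v) = r *\<^sub>R t i v"
    and t_invol: "\<And>i v. t i (t i v) = v"
    and t_comm: "\<And>i j v. t i (t j v) = t j (t i v)"
begin

lemma t_0: "t i 0 = 0"
  using t_scale[of i 0 0] by simp

lemma emul_emul: "emul t i (emul t j T) = (-1) ^ (par i * par j) *\<^sub>R emul t j (emul t i T)"
proof
  fix \<gamma>
  show "emul t i (emul t j T) \<gamma> = ((-1) ^ (par i * par j) *\<^sub>R emul t j (emul t i T)) \<gamma>"
  proof (cases "i = j")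
    case True
    then show ?thesis
      using midx_odd[of \<gamma> j] by (cases "p < j") (auto simp: emul_def t_0 par_def scaleR_fun_def)
  next
    case False
    show ?thesis
    proof (cases "\<gamma> \<in> midx \<and> i \<in># \<gamma> \<and> j \<in># \<gamma>")
      case True
      then have m: "\<gamma> \<in> midx" "i \<in># \<gamma>" "j \<in># \<gamma>" "i \<in># \<gamma> - {#j#}" "j \<in># \<gamma> - {#i#}"
        using False by (auto simp: in_diff_count)
      have s: "sg i (\<gamma> - {#i#}) * sg j (\<gamma> - {#i#} - {#j#}) =
          (-1) ^ (par i * par j) * (sg j (\<gamma> - {#j#}) * sg i (\<gamma> - {#j#} - {#i#}))"
        using sg_minus[OF midx_minus[OF m(1,2)] m(5), of i] sg_minus[OF midx_minus[OF m(1,3)] m(4), of j]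
        by (simp add: add_mset_commute[of j i "{#}"] mult_ac flip: kap_kap[OF False])
      show ?thesis using m s
        by (simp add: emul_def midx_minus t_scale scaleR_fun_def t_comm[of i j] add_mset_commute[of j i "{#}"])
    next
      case F: False
      then show ?thesis using False
        by (auto simp: emul_def t_0 scaleR_fun_def in_diff_count)
    qed
  qed
qed

lemma contr_contr: "contr t i (contr t j T) = (-1) ^ (par i * par j) *\<^sub>R contr t j (contr t i T)"
proof
  fix \<gamma>
  show "contr t i (contr t j T) \<gamma> = ((-1) ^ (par i * par j) *\<^sub>R contr t j (contr t i T)) \<gamma>"
  proof (cases "i = j")
    case True
    then show ?thesis
      by (cases "p < j") (auto simp: contr_def midx_add t_0 par_def scaleR_fun_def)
  next
    case False
    show ?thesis
    proof (cases "add_mset j (add_mset i \<gamma>) \<in> midx")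
      case True
      then have m: "add_mset i \<gamma> \<in> midx" "add_mset j \<gamma> \<in> midx" "add_mset i (add_mset j \<gamma>) \<in> midx"
        by (auto simp: midx_add)
      show ?thesis using m True False
        by (simp add: contr_def t_scale scaleR_fun_def sg_add t_comm[of i j] add_mset_commute[of i j] mult_ac flip: kap_kap[OF False])
    next
      case F: False
      then have "add_mset i (add_mset j \<gamma>) \<notin> midx" by (simp add: add_mset_commute)
      then show ?thesis using F
        by (simp add: contr_def t_0 scaleR_fun_def)
    qed
  qed
qed

text \<open>For i = j even, the multiplicities of the two orders differ by one; for i = j odd,
  exactly one order contributes. Both products vanish outside \<open>midx\<close>, so T has to
  vanish there as well.\<close>

lemma contr_emul:
  assumes "i \<in> {1..p+q}" and T: "\<And>\<beta>. \<beta> \<notin> midx \<Longrightarrow> T \<beta> = 0"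
  shows "contr t i (emul t j T) = (-1) ^ (par i * par j) *\<^sub>R emul t j (contr t i T) + (if i = j then T else 0)"
proof
  fix \<gamma>
  show "contr t i (emul t j T) \<gamma> = ((-1) ^ (par i * par j) *\<^sub>R emul t j (contr t i T) + (if i = j then T else 0)) \<gamma>"
  proof (cases "\<gamma> \<in> midx")
    case g: True
    show ?thesis
    proof (cases "i = j")
      case True
      have 1: "contr t i (emul t i T) \<gamma> = (if add_mset i \<gamma> \<in> midx then real (Suc (count \<gamma> i)) *\<^sub>R T \<gamma> else 0)"
        by (simp add: contr_def emul_def t_scale t_invol)
      have 2: "emul t i (contr t i T) \<gamma> = (if i \<in># \<gamma> then real (count \<gamma> i) *\<^sub>R T \<gamma> else 0)"
        using g by (auto simp: contr_def emul_def t_scale t_invol)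
      have 3: "count \<gamma> i = 1" if "p < i" "i \<in># \<gamma>"
      proof -
        have "count \<gamma> i \<le> 1" using g that(1) by (simp add: midx_def)
        moreover have "0 < count \<gamma> i" using that(2) by simp
        ultimately show ?thesis by linarith
      qed
      show ?thesis
        using assms(1) g 3 unfolding True[symmetric]
        by (cases "p < i"; cases "i \<in># \<gamma>") (simp_all add: 1 2 scaleR_fun_def par_def midx_add count_eq_zero_iff algebra_simps)
    next
      case False
      show ?thesis
      proof (cases "j \<in># \<gamma> \<and> add_mset i \<gamma> \<in> midx")
        case True
        then have m: "add_mset i (\<gamma> - {#j#}) \<in> midx" "j \<in># \<gamma>"
          using midx_minus[of "add_mset i \<gamma>" j] False by auto
        have s: "sg i \<gamma> * sg j (add_mset i (\<gamma> - {#j#})) = (-1) ^ (par i * par j) * (sg j (\<gamma> - {#j#}) * sg i (\<gamma> - {#j#}))"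
          using sg_minus[OF g m(2), of i] by (simp add: sg_add[OF m(1)] mult_ac flip: kap_kap[OF False])
        show ?thesis using m True False g
          by (simp add: contr_def emul_def t_scale t_comm[of i j] scaleR_fun_def s mult.assoc)
      next
        case F: False
        then show ?thesis using False g
          by (auto simp: contr_def emul_def t_0 scaleR_fun_def midx_add in_diff_count)
      qed
    qed
  next
    case False
    then show ?thesis using T by (auto simp: contr_def emul_def midx_add scaleR_fun_def)
  qed
qed

end

end

lemma sum_fun_apply: "(\<Sum>i\<in>A. f i) x = (\<Sum>i\<in>A. f i x :: 'b::comm_monoid_add)"
  using sum_comp_morphism[where h = "\<lambda>f. f x" and g = f and A = A] by (simp add: comp_def)

context superspace
begin

section \<open>The vector space of symbols\<close>

lemma symbols_in: "T \<in> symbols \<Longrightarrow> T \<alpha> \<in> sfuns"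
  and symbols_midx: "T \<in> symbols \<Longrightarrow> \<alpha> \<notin> midx \<Longrightarrow> T \<alpha> = 0"
  and symbols_finite: "T \<in> symbols \<Longrightarrow> finite {\<alpha>. T \<alpha> \<noteq> 0}"
  by (auto simp: symbols_def)

lemma symbolsI:
  assumes "\<And>\<alpha>. T \<alpha> \<in> sfuns" "\<And>\<alpha>. \<alpha> \<notin> midx \<Longrightarrow> T \<alpha> = 0" "{\<alpha>. T \<alpha> \<noteq> 0} \<subseteq> A" "finite A"
  shows "T \<in> symbols"
  using assms finite_subset by (auto simp: symbols_def)

lemma symbols_map:
  assumes "T \<in> symbols" "F 0 = 0" "\<And>f. f \<in> sfuns \<Longrightarrow> F f \<in> sfuns"
  shows "(\<lambda>\<alpha>. F (T \<alpha>)) \<in> symbols"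
  using assms by (intro symbolsI[of _ "{\<alpha>. T \<alpha> \<noteq> 0}"]) (auto simp: symbols_def)

lemma subspace_symbols: "subspace symbols"
proof (intro subspaceI)
  show "0 \<in> symbols" by (rule symbolsI[of _ "{}"]) auto
next
  fix T U assume *: "T \<in> symbols" "U \<in> symbols"
  show "T + U \<in> symbols"
  proof (rule symbolsI[of _ "{\<alpha>. T \<alpha> \<noteq> 0} \<union> {\<alpha>. U \<alpha> \<noteq> 0}"])
    show "(T + U) \<alpha> \<in> sfuns" for \<alpha> using * by (simp add: symbols_in)
    show "(T + U) \<alpha> = 0" if "\<alpha> \<notin> midx" for \<alpha>
      using symbols_midx[OF *(1) that] symbols_midx[OF *(2) that] by (metis plus_fun_apply add_0_right)
    show "{\<alpha>. (T + U) \<alpha> \<noteq> 0} \<subseteq> {\<alpha>. T \<alpha> \<noteq> 0} \<union> {\<alpha>. U \<alpha> \<noteq> 0}" by auto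
  qed (use * symbols_finite in blast)
next
  fix r T assume *: "T \<in> symbols"
  have "(\<lambda>\<alpha>. r *\<^sub>R T \<alpha>) \<in> symbols"
    by (rule symbols_map[where F = "\<lambda>f. r *\<^sub>R f"]) (rule * scaleR_zero_right sfuns_scale | assumption)+
  then show "r *\<^sub>R T \<in> symbols" by (simp only: scaleR_fun_def[of r T])
qed

subsection \<open>Operators on symbols\<close>

definition mop :: "nat \<Rightarrow> symbol \<Rightarrow> symbol" where "mop i T = (\<lambda>\<alpha>. coord i \<star> T \<alpha>)"
definition dop :: "nat \<Rightarrow> symbol \<Rightarrow> symbol" where "dop i T = (\<lambda>\<alpha>. pderiv i (T \<alpha>))"
definition eop :: "nat \<Rightarrow> symbol \<Rightarrow> symbol" where "eop = emul tau"
definition cop :: "nat \<Rightarrow> symbol \<Rightarrow> symbol" where "cop = contr tau"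

lemma coord_star_coord_star:
  "coord i \<star> (coord j \<star> f) = (-1) ^ (par i * par j) *\<^sub>R (coord j \<star> (coord i \<star> f))" if "i \<in> {1..p+q}"
  using star_coord[OF sfuns_coord[OF that], of j] by (simp add: tau_coord mult.commute flip: star_assoc)

lemma scaleR_fun_apply: "scaleR r f \<alpha> = r *\<^sub>R f \<alpha>"
  by (simp add: scaleR_fun_def)

lemma emul_symbols:
  assumes "i \<in> {1..p+q}" "T \<in> symbols"
  shows "emul tau i T \<in> symbols"
proof (rule symbolsI[of _ "add_mset i ` {\<alpha>. T \<alpha> \<noteq> 0}"])
  show "emul tau i T \<alpha> \<in> sfuns" for \<alpha>
    using symbols_in[OF assms(2), of "\<alpha> - {#i#}"] by (simp add: emul_def)
  show "emul tau i T \<alpha> = 0" if "\<alpha> \<notin> midx" for \<alpha> using that by (simp add: emul_def)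
  show "{\<alpha>. emul tau i T \<alpha> \<noteq> 0} \<subseteq> add_mset i ` {\<alpha>. T \<alpha> \<noteq> 0}"
  proof
    fix \<alpha> assume *: "\<alpha> \<in> {\<alpha>. emul tau i T \<alpha> \<noteq> 0}"
    then have "i \<in># \<alpha>" by (simp add: emul_def split: if_splits)
    moreover from * have "T (\<alpha> - {#i#}) \<noteq> 0"
      by (cases "T (\<alpha> - {#i#}) = 0") (simp_all add: emul_def split: if_splits)
    ultimately show "\<alpha> \<in> add_mset i ` {\<alpha>. T \<alpha> \<noteq> 0}"
      by (intro image_eqI[of _ _ "\<alpha> - {#i#}"]) simp_all
  qed
  show "finite (add_mset i ` {\<alpha>. T \<alpha> \<noteq> 0})" by (rule finite_imageI[OF symbols_finite[OF assms(2)]])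
qed

lemma contr_symbols:
  assumes "i \<in> {1..p+q}" "T \<in> symbols"
  shows "contr tau i T \<in> symbols"
proof (rule symbolsI[of _ "(\<lambda>\<alpha>. \<alpha> - {#i#}) ` {\<alpha>. T \<alpha> \<noteq> 0}"])
  show "contr tau i T \<alpha> \<in> sfuns" for \<alpha>
    using symbols_in[OF assms(2), of "add_mset i \<alpha>"] by (simp add: contr_def)
  show "contr tau i T \<alpha> = 0" if "\<alpha> \<notin> midx" for \<alpha> using that by (simp add: contr_def midx_add)
  show "{\<alpha>. contr tau i T \<alpha> \<noteq> 0} \<subseteq> (\<lambda>\<alpha>. \<alpha> - {#i#}) ` {\<alpha>. T \<alpha> \<noteq> 0}"
  proof
    fix \<alpha> assume *: "\<alpha> \<in> {\<alpha>. contr tau i T \<alpha> \<noteq> 0}"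
    then have "T (add_mset i \<alpha>) \<noteq> 0"
      by (cases "T (add_mset i \<alpha>) = 0") (simp_all add: contr_def split: if_splits)
    then show "\<alpha> \<in> (\<lambda>\<alpha>. \<alpha> - {#i#}) ` {\<alpha>. T \<alpha> \<noteq> 0}"
      by (intro image_eqI[of _ _ "add_mset i \<alpha>"]) simp_all
  qed
  show "finite ((\<lambda>\<alpha>. \<alpha> - {#i#}) ` {\<alpha>. T \<alpha> \<noteq> 0})" by (rule finite_imageI[OF symbols_finite[OF assms(2)]])
qed

lemma symbol_ext: "(\<And>\<alpha>. T \<alpha> = U \<alpha>) \<Longrightarrow> T = (U :: symbol)"
  by (rule ext)

text \<open>Operators on coefficients supercommute with operators on multi-indices precisely because
  \<open>eop\<close> and \<open>cop\<close> apply \<open>tau\<close> to the coefficient. The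
  contraction between \<open>dop\<close> and \<open>mop\<close> is the Leibniz rule, the one between
  \<open>cop\<close> and \<open>eop\<close> is \<open>contr_emul\<close>.\<close>

sublocale SW: super_weyl symbols "{1..p+q}" par mop dop eop cop
proof (unfold_locales, goal_cases)
  case 1 show ?case by (rule subspace_symbols)
next
  case 2 show ?case by simp
next
  case (3 i T) then show ?case
    unfolding mop_def by (intro symbols_map[where F = "\<lambda>f. coord i \<star> f"] star_0_right sfuns_coord_star)
next
  case (4 i T) then show ?case
    unfolding dop_def by (intro symbols_map[where F = "pderiv i"] pderiv_0 sfuns_pderiv)
next
  case (5 i T) then show ?case unfolding eop_def by (rule emul_symbols)
next
  case (6 i T) then show ?case unfolding cop_def by (rule contr_symbols)
next
  case 7 show ?case by (rule symbol_ext) (simp add: mop_def star_add_right)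
next
  case 8 then show ?case by (intro symbol_ext) (simp add: dop_def pderiv_add symbols_in)
next
  case 9 show ?case by (rule symbol_ext) (simp add: eop_def emul_def tau_add scaleR_add_right)
next
  case 10 show ?case by (rule symbol_ext) (simp add: cop_def contr_def tau_add scaleR_add_right)
next
  case 11 show ?case by (rule symbol_ext) (simp add: mop_def scaleR_fun_apply)
next
  case 12 then show ?case by (intro symbol_ext) (simp add: dop_def pderiv_scale symbols_in scaleR_fun_apply)
next
  case 13 show ?case by (rule symbol_ext) (simp add: eop_def emul_def scaleR_fun_apply)
next
  case 14 show ?case by (rule symbol_ext) (simp add: cop_def contr_def scaleR_fun_apply mult_ac)
next
  case (15 i j T)
  then show ?case by (intro symbol_ext) (simp add: mop_def scaleR_fun_apply coord_star_coord_star[of i j])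
next
  case (16 i j T)
  then show ?case using pderiv_commute[OF symbols_in[of T], of i j]
    by (intro symbol_ext) (simp add: dop_def scaleR_fun_apply)
next
  case (17 i j T) show ?case
    unfolding eop_def by (rule emul_emul) (auto simp: tau_commute)
next
  case (18 i j T) show ?case
    unfolding cop_def by (rule contr_contr) (auto simp: tau_commute)
next
  case (19 i j T)
  then show ?case by (intro symbol_ext) (simp add: mop_def eop_def emul_def scaleR_fun_apply tau_star tau_coord mult_ac)
next
  case (20 i j T)
  then show ?case by (intro symbol_ext) (simp add: mop_def cop_def contr_def scaleR_fun_apply tau_star tau_coord mult_ac)
next
  case (21 i j T)
  then show ?case
    by (intro symbol_ext)
      (simp add: dop_def eop_def emul_def scaleR_fun_apply pderiv_scale symbols_in tau_pderiv mult_ac)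
next
  case (22 i j T)
  then show ?case
    by (intro symbol_ext)
      (simp add: dop_def cop_def contr_def scaleR_fun_apply pderiv_scale symbols_in tau_pderiv mult_ac)
next
  case (23 i j T)
  then have "pderiv i (coord j \<star> T \<alpha>) = (-1) ^ (par i * par j) *\<^sub>R (coord j \<star> pderiv i (T \<alpha>)) + (if i = j then T \<alpha> else 0)" for \<alpha>
    by (simp add: pderiv_star symbols_in pderiv_coord tau_coord one_star)
  then show ?case by (intro symbol_ext) (simp add: mop_def dop_def scaleR_fun_apply)
next
  case (24 i j T)
  then show ?case unfolding eop_def cop_def
    by (intro contr_emul tau_scale tau_tau tau_commute symbols_midx)
qed

lemma K_apply:
  assumes "T \<in> symbols"
  shows "SW.K T \<alpha> = real (size \<alpha>) *\<^sub>R T \<alpha>"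
proof (cases "\<alpha> \<in> midx")
  case True
  have *: "eop i (cop i T) \<alpha> = real (count \<alpha> i) *\<^sub>R T \<alpha>" for i
    using True by (auto simp: eop_def cop_def emul_def contr_def count_eq_zero_iff)
  have "(\<Sum>i\<in>{1..p+q}. count \<alpha> i) = size \<alpha>"
    using True unfolding size_multiset_overloaded_eq
    by (intro sum.mono_neutral_right) (auto simp: midx_def count_eq_zero_iff)
  then have "(\<Sum>i\<in>{1..p+q}. real (count \<alpha> i)) = real (size \<alpha>)"
    by (metis of_nat_sum)
  moreover have "SW.K T \<alpha> = (\<Sum>i\<in>{1..p+q}. eop i (cop i T) \<alpha>)"
    unfolding SW.K_def by (rule sum_fun_apply)
  ultimately show ?thesis by (simp add: * flip: scaleR_sum_left)
next
  case False
  show ?thesis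
    unfolding symbols_midx[OF SW.K_in[OF assms] False] symbols_midx[OF assms False] by simp
qed

lemma sdim_eq: "SW.sdim = real p - real q"
proof -
  have "{1..p+q} = {1..p} \<union> {p+1..p+q}" by auto
  then have "SW.sdim = (\<Sum>i\<in>{1..p}. SW.eps i) + (\<Sum>i\<in>{p+1..p+q}. SW.eps i)"
    unfolding SW.sdim_def by (simp add: sum.union_disjoint ivl_disj_int)
  also have "(\<Sum>i\<in>{1..p}. SW.eps i) = real p" by (simp add: SW.ss_def par_def)
  also have "(\<Sum>i\<in>{p+1..p+q}. SW.eps i) = (\<Sum>i\<in>{p+1..p+q}. - 1)" by (intro sum.cong) (auto simp: SW.ss_def par_def)
  finally show ?thesis by simp
qed

end

subsection \<open>The Lie derivative of symbols\<close>

lemma finite_submultisets: "finite {\<alpha>. \<alpha> \<subseteq># \<gamma>}"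
proof (induction \<gamma>)
  case (add x \<gamma>)
  have "{\<alpha>. \<alpha> \<subseteq># add_mset x \<gamma>} \<subseteq> {\<alpha>. \<alpha> \<subseteq># \<gamma>} \<union> add_mset x ` {\<alpha>. \<alpha> \<subseteq># \<gamma>}"
  proof
    fix \<alpha> assume "\<alpha> \<in> {\<alpha>. \<alpha> \<subseteq># add_mset x \<gamma>}"
    then have *: "\<alpha> \<subseteq># add_mset x \<gamma>" by simp
    show "\<alpha> \<in> {\<alpha>. \<alpha> \<subseteq># \<gamma>} \<union> add_mset x ` {\<alpha>. \<alpha> \<subseteq># \<gamma>}"
    proof (cases "x \<in># \<alpha>")
      case True
      then obtain \<alpha>' where "\<alpha> = add_mset x \<alpha>'" by (metis insert_DiffM)
      then show ?thesis using * by simp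
    next
      case False
      have "count \<alpha> a \<le> count \<gamma> a" for a
        using *[unfolded subseteq_mset_def, rule_format, of a] False
        by (cases "a = x") (simp_all add: count_eq_zero_iff[THEN iffD2])
      then show ?thesis by (simp add: subseteq_mset_def)
    qed
  qed
  then show ?case using add by (meson finite_UnI finite_imageI finite_subset)
qed simp

lemma sum_less_2: "(\<Sum>a<(2::nat). f a) = f 0 + (f 1 :: 'b::comm_monoid_add)"
  by (simp add: numeral_2_eq_2)

lemma inversions_commute:
  assumes "finite I" "finite J" "I \<inter> J = {}"
  shows "inversions I J + inversions J I = card I * card J"
proof -
  have "card {j \<in> J. j < i} + card {j \<in> J. i < j} = card J" if "i \<in> I" for i
  proof -
    have "{j \<in> J. j < i} \<union> {j \<in> J. i < j} = J" using that assms(3) by (force simp: not_less_iff_gr_or_eq)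
    then show ?thesis
      using card_Un_disjoint[of "{j \<in> J. j < i}" "{j \<in> J. i < j}"] assms(2) by fastforce
  qed
  then show ?thesis
    using assms by (simp add: inversions_eq_sum_left[OF assms(1,2)] inversions_eq_sum_right[OF assms(2,1)] flip: sum.distrib)
qed

text \<open>Passing to complements in K exchanges the factors at the cost of (-1) ^ (|J| |K - J|),
  and on the support of g the size of J is congruent to c modulo 2.\<close>

lemma star_supercommute:
  assumes g: "\<And>J. odd (card J + c) \<Longrightarrow> g J = 0"
  shows "f \<star> g = g \<star> (\<lambda>I. (-1) ^ (c * card I) *\<^sub>R f I)"
proof (intro ext)
  fix K x
  show "(f \<star> g) K x = (g \<star> (\<lambda>I. (-1) ^ (c * card I) *\<^sub>R f I)) K x"
  proof (cases "finite K")
    case True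
    have "(f \<star> g) K x = (\<Sum>J\<in>Pow K. (-1) ^ inversions (K - J) J * f (K - J) x * g J x)"
      unfolding sfun_mult_def
      by (rule sum.reindex_bij_witness[of _ "\<lambda>J. K - J" "\<lambda>J. K - J"]) (auto simp: double_diff)
    also have "\<dots> = (\<Sum>J\<in>Pow K. (-1) ^ inversions J (K - J) * g J x * ((-1) ^ (c * card (K - J)) * f (K - J) x))"
    proof (rule sum.cong)
      fix J assume "J \<in> Pow K"
      then have fin: "finite J" "finite (K - J)" "J \<inter> (K - J) = {}" using True finite_subset by auto
      show "(-1) ^ inversions (K - J) J * f (K - J) x * g J x =
          (-1) ^ inversions J (K - J) * g J x * ((-1) ^ (c * card (K - J)) * f (K - J) x)"
      proof (cases "even (card J + c)")
        case True
        have "inversions (K - J) J + inversions J (K - J) = card J * card (K - J) + 0"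
          using inversions_commute[OF fin] by simp
        then have "(-1 :: real) ^ inversions (K - J) J = (-1) ^ inversions J (K - J) * (-1) ^ (card J * card (K - J) + 0)"
          by (rule neg_one_power_eq)
        also have "(-1 :: real) ^ (card J * card (K - J) + 0) = (-1) ^ (c * card (K - J))"
          using True by (auto simp: minus_one_power_iff)
        finally show ?thesis by (simp add: mult_ac)
      qed (use g in simp)
    qed simp
    finally show ?thesis by (simp add: sfun_mult_def scaleR_fun_def)
  qed (simp add: sfun_mult_def finite_Pow_iff)
qed

context superspace
begin

section \<open>The representation of gl(p|q) on the supersymmetric algebra\<close>

abbreviation idt :: "nat \<Rightarrow> real \<Rightarrow> real" where "idt \<equiv> (\<lambda>_ v. v)"

lemma vee_unit_vec:
  assumes "j \<in> {1..p+q}"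
  shows "vee (sym_vec (unit_vec j)) s = emul idt j s"
proof
  fix \<gamma>
  have *: "sym_vec (unit_vec j) \<alpha> = (if \<alpha> = {#j#} then 1 else 0)" for \<alpha>
  proof -
    have "sym_vec (unit_vec j) \<alpha> = (\<Sum>i\<in>{1..p+q}. if i = j then (if \<alpha> = {#j#} then 1 else 0) else 0)"
      unfolding sym_vec_def by (intro sum.cong) (auto simp: unit_vec_def)
    then show ?thesis using assms by simp
  qed
  have inv: "(-1) ^ sym_inversions {#j#} \<delta> = sg j \<delta>" for \<delta>
  proof -
    have "{(i, l). i \<in># {#j#} \<and> l \<in># \<delta> \<and> p < l \<and> l < i} = Pair j ` {i \<in> set_mset \<delta>. p < i \<and> i < j}" by auto
    then show ?thesis by (simp add: sym_inversions_def sg_def card_image inj_on_def)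
  qed
  have "(\<Sum>\<alpha> | \<alpha> \<subseteq># \<gamma>. (-1) ^ sym_inversions \<alpha> (\<gamma> - \<alpha>) * sym_vec (unit_vec j) \<alpha> * s (\<gamma> - \<alpha>)) =
      (\<Sum>\<alpha>\<in>{\<alpha>. \<alpha> \<subseteq># \<gamma>}. if \<alpha> = {#j#} then sg j (\<gamma> - {#j#}) * s (\<gamma> - {#j#}) else 0)"
    by (intro sum.cong) (auto simp: * inv)
  also have "\<dots> = (if j \<in># \<gamma> then sg j (\<gamma> - {#j#}) * s (\<gamma> - {#j#}) else 0)"
    using finite_submultisets[of \<gamma>] by simp
  finally show "vee (sym_vec (unit_vec j)) s \<gamma> = emul idt j s \<gamma>"
    by (simp add: vee_def emul_def)
qed

lemma vee_0: "vee (sym_vec 0) s = 0"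
proof -
  have "sym_vec 0 \<alpha> = 0" for \<alpha> by (simp add: sym_vec_def cong: if_cong)
  then show ?thesis by (intro ext) (simp add: vee_def)
qed

lemma vees_Nil [simp]: "vees [] = sym_one"
  and vees_Cons: "vees (v # vs) = vee (sym_vec v) (vees vs)"
  by (simp_all add: vees_def)

definition basis :: "nat multiset \<Rightarrow> sym" where
  "basis \<alpha> = (\<lambda>\<beta>. if \<beta> = \<alpha> then 1 else 0)"

lemma vees_supp: "\<beta> \<notin> midx \<Longrightarrow> vees vs \<beta> = 0"
  by (cases vs) (auto simp: vees_Cons vee_def sym_one_def midx_def)

text \<open>No letter of a sorted word is preceded by a larger one, so every \<open>sg\<close> that
  occurs while the monomial is built up is 1.\<close>

lemma vees_sorted:
  assumes "sorted w" "mset w \<in> midx"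
  shows "vees (map unit_vec w) = basis (mset w)"
  using assms
proof (induction w)
  case Nil
  then show ?case by (simp add: sym_one_def basis_def)
next
  case (Cons j w)
  then have w: "mset w \<in> midx" "j \<in> {1..p+q}" by (auto simp: midx_add)
  have "{i \<in> set w. p < i \<and> i < j} = {}" using Cons.prems by auto
  then have "sg j (mset w) = 1"
    unfolding sg_def set_mset_mset by (simp only: card.empty power_0)
  then have "emul idt j (basis (mset w)) = basis (add_mset j (mset w))"
  proof (intro ext)
    fix x
    have "j \<in># x \<and> x - {#j#} = mset w \<longleftrightarrow> x = add_mset j (mset w)"
      by (metis insert_DiffM add_mset_remove_trivial union_single_eq_member)
    then show "emul idt j (basis (mset w)) x = basis (add_mset j (mset w)) x"
      using Cons.prems \<open>sg j (mset w) = 1\<close>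
      by (cases "x = add_mset j (mset w)") (auto simp: emul_def basis_def)
  qed
  then show ?case using Cons w by (simp add: vees_Cons vee_unit_vec)
qed

lemma emul_idt_linear: "emul idt j (\<Sum>a\<in>A. r a *\<^sub>R f a) = (\<Sum>a\<in>A. r a *\<^sub>R emul idt j (f a))"
proof (rule ext)
  fix x
  show "emul idt j (\<Sum>a\<in>A. r a *\<^sub>R f a) x = (\<Sum>a\<in>A. r a *\<^sub>R emul idt j (f a)) x"
  proof (cases "x \<in> midx \<and> j \<in># x")
    case True
    then show ?thesis by (simp add: emul_def sum_fun_apply scaleR_fun_def sum_distrib_left mult_ac)
  next
    case False
    then have "emul idt j g x = 0" for g by (auto simp: emul_def)
    then show ?thesis by (simp add: sum_fun_apply scaleR_fun_def)
  qed
qed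

lemma emul_scale: "emul idt j (r *\<^sub>R s) = r *\<^sub>R emul idt j s"
  using emul_idt_linear[of j "\<lambda>_. r" "\<lambda>_. s" "{0}"] by simp

lemma matr_apply_unit:
  assumes "w \<in> {1..p+q}"
  shows "matr_apply (mpart a (unit_matr i j)) (unit_vec w) =
    (if even (par i + par j + a) \<and> w = i then unit_vec j else 0)"
proof
  fix k
  have "matr_apply (mpart a (unit_matr i j)) (unit_vec w) k =
      (\<Sum>l\<in>{1..p+q}. if l = w then mpart a (unit_matr i j) k w else 0)"
    unfolding matr_apply_def by (intro sum.cong) (auto simp: unit_vec_def)
  also have "\<dots> = mpart a (unit_matr i j) k w" using assms by simp
  finally show "matr_apply (mpart a (unit_matr i j)) (unit_vec w) k =
      (if even (par i + par j + a) \<and> w = i then unit_vec j else 0) k"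
    by (auto simp: mpart_def unit_matr_def unit_vec_def add_ac)
qed

text \<open>The action of the matrix unit is the superderivation e_j c_i: both agree on vectors and
  satisfy the same Leibniz rule. In the induction, the sign a * par k from the derivation and the
  sign par j * par k from exchanging e_k and e_j combine to par i * par k, as
  \<open>contr_emul\<close> requires.\<close>

lemma derivation_vees:
  assumes "set w \<subseteq> {1..p+q}" "i \<in> {1..p+q}" "j \<in> {1..p+q}" "even (par i + par j + a)"
  shows "(\<Sum>m<length w. (-1) ^ (a * (\<Sum>n<m. par (w ! n))) *\<^sub>R
      vees ((map unit_vec w)[m := (if w ! m = i then unit_vec j else 0)])) =
    emul idt j (contr idt i (vees (map unit_vec w)))"
  using assms(1)
proof (induction w)
  case Nil
  show ?case by (rule ext) (simp add: emul_def contr_def sym_one_def)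
next
  case (Cons k w)
  let ?V = "vees (map unit_vec w)"
  let ?t = "\<lambda>w m. (-1) ^ (a * (\<Sum>n<m. par (w ! n))) *\<^sub>R vees ((map unit_vec w)[m := (if w ! m = i then unit_vec j else 0)])"
  have k: "k \<in> {1..p+q}" using Cons.prems by simp
  have sum: "(\<Sum>n<Suc m. par ((k # w) ! n)) = par k + (\<Sum>n<m. par (w ! n))" for m
    by (subst sum.lessThan_Suc_shift) simp
  have s: "(-1 :: real) ^ (a * par k) * (-1) ^ (par j * par k) = (-1) ^ (par i * par k)"
    using assms(4) by (auto simp: minus_one_power_iff)
  have t0: "?t (k # w) 0 = (if k = i then emul idt j ?V else 0)"
    using assms(3) by (simp add: vees_Cons vee_unit_vec vee_0)
  have tS: "?t (k # w) (Suc m) = (-1) ^ (a * par k) *\<^sub>R ((-1) ^ (a * (\<Sum>n<m. par (w ! n))) *\<^sub>R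
      emul idt k (vees ((map unit_vec w)[m := (if w ! m = i then unit_vec j else 0)])))" for m
    unfolding sum using k by (simp add: vees_Cons vee_unit_vec distrib_left power_add)
  have "(\<Sum>m<length (k # w). ?t (k # w) m) = ?t (k # w) 0 + (\<Sum>m<length w. ?t (k # w) (Suc m))"
    by (simp only: length_Cons sum.lessThan_Suc_shift)
  also have "(\<Sum>m<length w. ?t (k # w) (Suc m)) = (-1) ^ (a * par k) *\<^sub>R emul idt k (\<Sum>m<length w. ?t w m)"
    unfolding tS emul_idt_linear scaleR_sum_right ..
  also have "(\<Sum>m<length w. ?t w m) = emul idt j (contr idt i ?V)"
    using Cons by simp
  also have "emul idt k (emul idt j (contr idt i ?V)) = (-1) ^ (par j * par k) *\<^sub>R emul idt j (emul idt k (contr idt i ?V))"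
    using emul_emul[of idt k j] by (simp add: mult.commute)
  finally have 1: "(\<Sum>m<length (k # w). ?t (k # w) m) = (if k = i then emul idt j ?V else 0) +
      (-1) ^ (par i * par k) *\<^sub>R emul idt j (emul idt k (contr idt i ?V))"
    by (simp only: t0 scaleR_scaleR s emul_scale)
  have "contr idt i (emul idt k ?V) = (-1) ^ (par i * par k) *\<^sub>R emul idt k (contr idt i ?V) + (if i = k then ?V else 0)"
    using vees_supp by (intro contr_emul assms(2)) auto
  then have 2: "emul idt j (contr idt i (vees (map unit_vec (k # w)))) =
      emul idt j ((-1) ^ (par i * par k) *\<^sub>R emul idt k (contr idt i ?V) + (if i = k then ?V else 0))"
    using k by (simp add: vees_Cons vee_unit_vec)
  show ?case unfolding 1 2
    by (rule ext) (auto simp: emul_def scaleR_fun_def algebra_simps)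
qed

lemma rho_unit_matr:
  assumes "\<alpha> \<in> midx" "i \<in> {1..p+q}" "j \<in> {1..p+q}"
  shows "rho (unit_matr i j) \<alpha> = emul idt j (contr idt i (basis \<alpha>))"
proof -
  define w where "w = sorted_list_of_multiset \<alpha>"
  have w: "sorted w" "mset w = \<alpha>" by (simp_all add: w_def)
  then have sw: "set w \<subseteq> {1..p+q}" using assms(1) by (auto simp: midx_def)
  let ?u = "\<lambda>a m. matr_apply (mpart a (unit_matr i j)) (map unit_vec w ! m)"
  let ?f = "\<lambda>a m. (-1) ^ (a * (\<Sum>n<m. par (w ! n))) *\<^sub>R vees ((map unit_vec w)[m := ?u a m])"
  have rho: "rho (unit_matr i j) \<alpha> = (\<Sum>a<2. \<Sum>m<length w. ?f a m)"
    by (simp add: rho_def Let_def w_def)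
  have u: "?u a m = (if even (par i + par j + a) \<and> w ! m = i then unit_vec j else 0)" if "m < length w" for a m
    using that sw nth_mem[OF that] by (simp add: matr_apply_unit subset_eq)
  have zero: "vees (vs[m := 0]) = 0" if "m < length vs" for vs m
    using that
  proof (induction vs arbitrary: m)
    case (Cons v vs)
    have "vee s 0 = 0" for s by (rule ext) (simp add: vee_def)
    with Cons show ?case
      by (cases m) (simp_all only: list_update_code vees_Cons vee_0 length_Cons Suc_less_eq)
  qed simp
  \<comment> \<open>The matrix unit is homogeneous of parity par i + par j. Its component of the
    other parity is 0 and puts a zero factor into each product.\<close>
  have "(\<Sum>m<length w. ?f a m) = (if even (par i + par j + a) then emul idt j (contr idt i (basis \<alpha>)) else 0)" for a
  proof (cases "even (par i + par j + a)")
    case True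
    have "(\<Sum>m<length w. ?f a m) = (\<Sum>m<length w. (-1) ^ (a * (\<Sum>n<m. par (w ! n))) *\<^sub>R
        vees ((map unit_vec w)[m := (if w ! m = i then unit_vec j else 0)]))"
      using True by (intro sum.cong) (simp_all only: u lessThan_iff simp_thms)
    then show ?thesis
      using True derivation_vees[OF sw assms(2,3) True] vees_sorted[OF w(1)] w(2) assms(1) by simp
  next
    case False
    have "(\<Sum>m<length w. ?f a m) = (\<Sum>m<length w. 0)"
      using False by (intro sum.cong) (simp_all add: u zero del: nth_map)
    then show ?thesis using False by simp
  qed
  then have "rho (unit_matr i j) \<alpha> =
      (\<Sum>a<2. if even (par i + par j + a) then emul idt j (contr idt i (basis \<alpha>)) else 0)"
    unfolding rho by (intro sum.cong refl)
  then show ?thesis by (simp add: sum_less_2)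
qed

lemma eop_cop_eq_rho:
  assumes "T \<in> symbols" "i \<in> {1..p+q}" "j \<in> {1..p+q}"
  shows "eop j (cop i T) \<beta> = (\<Sum>\<alpha> | T \<alpha> \<noteq> 0. rho (unit_matr i j) \<alpha> \<beta> *\<^sub>R tau i (tau j (T \<alpha>)))"
proof -
  \<comment> \<open>The only multi-index that the matrix unit can send to \<beta>: one j is traded
    back for i. The coefficient \<open>r\<close> is 0 whenever this exchange is impossible.\<close>
  define \<alpha>0 where "\<alpha>0 = add_mset i (\<beta> - {#j#})"
  define r where "r = (if \<beta> \<in> midx \<and> j \<in># \<beta> \<and> \<alpha>0 \<in> midx
    then sg j (\<beta> - {#j#}) * (real (Suc (count (\<beta> - {#j#}) i)) * sg i (\<beta> - {#j#})) else 0)"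
  have "(\<Sum>\<alpha> | T \<alpha> \<noteq> 0. rho (unit_matr i j) \<alpha> \<beta> *\<^sub>R tau i (tau j (T \<alpha>))) =
      (\<Sum>\<alpha> | T \<alpha> \<noteq> 0. if \<alpha> = \<alpha>0 then r *\<^sub>R tau i (tau j (T \<alpha>0)) else 0)"
  proof (rule sum.cong)
    fix \<alpha> assume "\<alpha> \<in> {\<alpha>. T \<alpha> \<noteq> 0}"
    then have "\<alpha> \<in> midx" using symbols_midx[OF assms(1)] by blast
    then have "rho (unit_matr i j) \<alpha> \<beta> = (if \<alpha> = \<alpha>0 then r else 0)"
      unfolding rho_unit_matr[OF \<open>\<alpha> \<in> midx\<close> assms(2,3)]
      by (auto simp: emul_def contr_def basis_def r_def \<alpha>0_def)
    then show "rho (unit_matr i j) \<alpha> \<beta> *\<^sub>R tau i (tau j (T \<alpha>)) =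
        (if \<alpha> = \<alpha>0 then r *\<^sub>R tau i (tau j (T \<alpha>0)) else 0)" by simp
  qed simp
  also have "\<dots> = (if T \<alpha>0 \<noteq> 0 then r *\<^sub>R tau i (tau j (T \<alpha>0)) else 0)"
    using symbols_finite[OF assms(1)] by simp
  also have "\<dots> = r *\<^sub>R tau i (tau j (T \<alpha>0))" by simp
  also have "\<dots> = eop j (cop i T) \<beta>"
    by (simp add: eop_def cop_def emul_def contr_def r_def \<alpha>0_def tau_commute[of i j])
  finally show ?thesis ..
qed

section \<open>Lie derivatives of symbols along homogeneous vector fields\<close>

definition homogeneous :: "nat \<Rightarrow> vfield \<Rightarrow> bool" where
  "homogeneous a X \<longleftrightarrow> (\<forall>i\<in>{1..p+q}. X i \<in> sfuns \<and> (\<forall>J. odd (card J + a + par i) \<longrightarrow> X i J = 0))"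

lemma homogeneous_fpart:
  assumes "homogeneous a X" "i \<in> {1..p+q}"
  shows "fpart (b + par i) (X i) = (if even (a + b) then X i else 0)"
proof (rule ext)
  fix J
  show "fpart (b + par i) (X i) J = (if even (a + b) then X i else 0) J"
  proof (cases "odd (card J + a + par i)")
    case True
    then have "X i J = 0" using assms by (simp add: homogeneous_def)
    then show ?thesis by (simp add: fpart_def)
  next
    case False
    then have "even (card J + (b + par i)) \<longleftrightarrow> even (a + b)" by auto
    then show ?thesis by (simp add: fpart_def)
  qed
qed

lemma tau_fpart: "(\<Sum>b<2. (-1) ^ (b * (par i + par j)) *\<^sub>R fpart b f) = tau i (tau j f)"
  by (rule ext) (auto simp: sum_less_2 fpart_def tau_def scaleR_fun_def fun_eq_iff minus_one_power_iff)

lemma fpart_tau_power: "(-1) ^ (c * card I) *\<^sub>R fpart b f I = (-1) ^ (c * b) *\<^sub>R fpart b f I"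
  by (auto simp: fpart_def minus_one_power_iff)

lemma pderiv_parity:
  assumes "\<And>J. odd (card J + c) \<Longrightarrow> f J = 0" "f \<in> sfuns" "odd (card J + c + par i)"
  shows "pderiv i f J = 0"
proof (cases "i \<le> p")
  case True
  then show ?thesis using assms(1,3) by (auto simp: pderiv_def par_def)
next
  case False
  have "f (insert i J) = 0" if "i \<notin> J"
  proof (cases "finite J")
    case True
    then show ?thesis using that assms(1)[of "insert i J"] assms(3) False by (simp add: par_def)
  qed (use sfuns_infinite[OF assms(2)] in simp)
  then show ?thesis using False by (simp add: pderiv_def)
qed

text \<open>Moving the Jacobian to the left of a coefficient of parity b costs (a + par i + par j)
  b; with the sign a b of the definition this leaves b (par i + par j). Summed over b this sign is
  \<open>tau i\<close> after \<open>tau j\<close>, exactly what \<open>eop j\<close> after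
  \<open>cop i\<close> applies, so the representation turns into Weyl operators.\<close>

lemma lie_symbol_homogeneous:
  assumes X: "homogeneous a X" "a < 2" and T: "T \<in> symbols"
  shows "lie_symbol d X T \<beta> = vf_apply X (T \<beta>) +
    (\<Sum>i\<in>{1..p+q}. \<Sum>j\<in>{1..p+q}. (-1) ^ (par i * a + 1) *\<^sub>R
      (pderiv i (X j) \<star> (eop j (cop i T) \<beta> - (if i = j then (d * (-1) ^ par i) *\<^sub>R T \<beta> else 0))))"
proof -
  let ?J = "\<lambda>i j. (-1) ^ (par i * a + 1) *\<^sub>R pderiv i (X j)"
  have jac: "jac c (vpart c X) i j = (if c = a then ?J i j else 0)" if "c < 2" "i \<in> {1..p+q}" "j \<in> {1..p+q}" for c i j
    using that X(2) homogeneous_fpart[OF X(1) that(3), of c] unfolding jac_def vpart_def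
    by (cases "c = a") (auto simp: less_2_cases_iff)
  have comm: "(-1) ^ (a * b) *\<^sub>R (fpart b f \<star> ?J i j) = ?J i j \<star> ((-1) ^ (b * (par i + par j)) *\<^sub>R fpart b f)"
    if "i \<in> {1..p+q}" "j \<in> {1..p+q}" for i j b f
  proof -
    have "pderiv i (X j) J = 0" if "odd (card J + (a + par i + par j))" for J
      using X(1) \<open>j \<in> {1..p+q}\<close> that
      by (intro pderiv_parity[of "a + par j"]) (auto simp: homogeneous_def add_ac)
    then have "fpart b f \<star> ?J i j = ?J i j \<star> (\<lambda>I. (-1) ^ ((a + par i + par j) * card I) *\<^sub>R fpart b f I)"
      by (intro star_supercommute) (simp add: scaleR_fun_def fun_eq_iff)
    also have "(\<lambda>I. (-1) ^ ((a + par i + par j) * card I) *\<^sub>R fpart b f I) = (-1) ^ ((a + par i + par j) * b) *\<^sub>R fpart b f"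
      by (rule ext) (simp only: fpart_tau_power scaleR_fun_def[of _ "fpart b f"])
    finally have *: "fpart b f \<star> ?J i j = ?J i j \<star> ((-1) ^ ((a + par i + par j) * b) *\<^sub>R fpart b f)" .
    have "(-1 :: real) ^ (a * b) * (-1) ^ ((a + par i + par j) * b) = (-1) ^ (b * (par i + par j))"
      by (auto simp: minus_one_power_iff)
    then show ?thesis unfolding * by (simp only: star_scale_right scaleR_scaleR)
  qed
  let ?r = "\<lambda>i j \<alpha>. rho_dens d (unit_matr i j) \<alpha> \<beta>"
  have inner: "(\<Sum>c<2. \<Sum>b<2. (-1) ^ (c * b) *\<^sub>R
        (\<Sum>i\<in>{1..p+q}. \<Sum>j\<in>{1..p+q}. ?r i j \<alpha> *\<^sub>R (fpart b f \<star> jac c (vpart c X) i j))) =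
      (\<Sum>i\<in>{1..p+q}. \<Sum>j\<in>{1..p+q}. ?J i j \<star> (?r i j \<alpha> *\<^sub>R tau i (tau j f)))" for \<alpha> f
  proof -
    have "(\<Sum>c<2. \<Sum>b<2. (-1) ^ (c * b) *\<^sub>R
        (\<Sum>i\<in>{1..p+q}. \<Sum>j\<in>{1..p+q}. ?r i j \<alpha> *\<^sub>R (fpart b f \<star> jac c (vpart c X) i j))) =
      (\<Sum>c<2. if c = a then \<Sum>b<2. (-1) ^ (a * b) *\<^sub>R
        (\<Sum>i\<in>{1..p+q}. \<Sum>j\<in>{1..p+q}. ?r i j \<alpha> *\<^sub>R (fpart b f \<star> ?J i j)) else 0)"
    proof (rule sum.cong)
      fix c :: nat assume c: "c \<in> {..<2}"
      have "(\<Sum>i\<in>{1..p+q}. \<Sum>j\<in>{1..p+q}. ?r i j \<alpha> *\<^sub>R (fpart b f \<star> jac c (vpart c X) i j)) =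
        (if c = a then \<Sum>i\<in>{1..p+q}. \<Sum>j\<in>{1..p+q}. ?r i j \<alpha> *\<^sub>R (fpart b f \<star> ?J i j) else 0)" for b
      proof (cases "c = a")
        case True
        show ?thesis unfolding if_P[OF True]
          by (intro sum.cong refl) (use c True in \<open>simp only: jac lessThan_iff if_True simp_thms\<close>)
      next
        case False
        have "(\<Sum>i\<in>{1..p+q}. \<Sum>j\<in>{1..p+q}. ?r i j \<alpha> *\<^sub>R (fpart b f \<star> jac c (vpart c X) i j)) =
            (\<Sum>i\<in>{1..p+q}. \<Sum>j\<in>{1..p+q}. 0)"
          by (intro sum.cong refl) (use c False in \<open>simp only: jac lessThan_iff if_False star_0_right scaleR_zero_right\<close>)
        then show ?thesis using False by simp
      qed
      then show "(\<Sum>b<2. (-1) ^ (c * b) *\<^sub>R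
          (\<Sum>i\<in>{1..p+q}. \<Sum>j\<in>{1..p+q}. ?r i j \<alpha> *\<^sub>R (fpart b f \<star> jac c (vpart c X) i j))) =
        (if c = a then \<Sum>b<2. (-1) ^ (a * b) *\<^sub>R
          (\<Sum>i\<in>{1..p+q}. \<Sum>j\<in>{1..p+q}. ?r i j \<alpha> *\<^sub>R (fpart b f \<star> ?J i j)) else 0)"
        by simp
    qed simp
    also have "\<dots> = (\<Sum>b<2. (-1) ^ (a * b) *\<^sub>R
        (\<Sum>i\<in>{1..p+q}. \<Sum>j\<in>{1..p+q}. ?r i j \<alpha> *\<^sub>R (fpart b f \<star> ?J i j)))"
      using X(2) by simp
    also have "\<dots> = (\<Sum>i\<in>{1..p+q}. \<Sum>j\<in>{1..p+q}. \<Sum>b<2. ?r i j \<alpha> *\<^sub>R ((-1) ^ (a * b) *\<^sub>R (fpart b f \<star> ?J i j)))"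
      unfolding scaleR_sum_right scaleR_left_commute[of "(-1) ^ (a * _)"]
      by (simp only: sum.swap[where A = "{..<2}"])
    also have "\<dots> = (\<Sum>i\<in>{1..p+q}. \<Sum>j\<in>{1..p+q}. ?J i j \<star> (?r i j \<alpha> *\<^sub>R tau i (tau j f)))"
    proof (intro sum.cong refl)
      fix i j assume ij: "i \<in> {1..p+q}" "j \<in> {1..p+q}"
      have "(\<Sum>b<2. ?r i j \<alpha> *\<^sub>R ((-1) ^ (a * b) *\<^sub>R (fpart b f \<star> ?J i j))) =
          ?r i j \<alpha> *\<^sub>R (\<Sum>b<2. ?J i j \<star> ((-1) ^ (b * (par i + par j)) *\<^sub>R fpart b f))"
        by (simp only: comm[OF ij] scaleR_sum_right)
      also have "\<dots> = ?J i j \<star> (?r i j \<alpha> *\<^sub>R tau i (tau j f))"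
        unfolding star_sum_right[symmetric] tau_fpart by (simp only: star_scale_right)
      finally show "(\<Sum>b<2. ?r i j \<alpha> *\<^sub>R ((-1) ^ (a * b) *\<^sub>R (fpart b f \<star> ?J i j))) =
          ?J i j \<star> (?r i j \<alpha> *\<^sub>R tau i (tau j f))" .
    qed
    finally show ?thesis .
  qed
  have rsum: "(\<Sum>\<alpha> | T \<alpha> \<noteq> 0. ?r i j \<alpha> *\<^sub>R tau i (tau j (T \<alpha>))) =
      eop j (cop i T) \<beta> - (if i = j then (d * (-1) ^ par i) *\<^sub>R T \<beta> else 0)"
    if "i \<in> {1..p+q}" "j \<in> {1..p+q}" for i j
  proof -
    have str: "str (unit_matr i j) = (if i = j then (-1) ^ par i else 0)"
    proof -
      have "str (unit_matr i j) = (\<Sum>k\<in>{1..p+q}. if k = i then (if i = j then (-1) ^ par i else 0) else 0)"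
        unfolding str_def by (intro sum.cong) (auto simp: unit_matr_def)
      then show ?thesis using that by simp
    qed
    have "(\<Sum>\<alpha> | T \<alpha> \<noteq> 0. ?r i j \<alpha> *\<^sub>R tau i (tau j (T \<alpha>))) =
        (\<Sum>\<alpha> | T \<alpha> \<noteq> 0. (if \<alpha> = \<beta> then (- d * str (unit_matr i j)) *\<^sub>R tau i (tau j (T \<beta>)) else 0) +
          rho (unit_matr i j) \<alpha> \<beta> *\<^sub>R tau i (tau j (T \<alpha>)))"
      unfolding rho_dens_def by (intro sum.cong) (auto simp: scaleR_left_diff_distrib)
    also have "\<dots> = (- d * str (unit_matr i j)) *\<^sub>R tau i (tau j (T \<beta>)) + eop j (cop i T) \<beta>"
      using symbols_finite[OF T] unfolding sum.distrib eop_cop_eq_rho[OF T that, symmetric] by simp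
    finally show ?thesis unfolding str by (cases "i = j") simp_all
  qed
  have "lie_symbol d X T \<beta> = vf_apply X (T \<beta>) +
      (\<Sum>\<alpha> | T \<alpha> \<noteq> 0. \<Sum>i\<in>{1..p+q}. \<Sum>j\<in>{1..p+q}. ?J i j \<star> (?r i j \<alpha> *\<^sub>R tau i (tau j (T \<alpha>))))"
    unfolding lie_symbol_def inner ..
  also have "(\<Sum>\<alpha> | T \<alpha> \<noteq> 0. \<Sum>i\<in>{1..p+q}. \<Sum>j\<in>{1..p+q}. ?J i j \<star> (?r i j \<alpha> *\<^sub>R tau i (tau j (T \<alpha>)))) =
      (\<Sum>i\<in>{1..p+q}. \<Sum>j\<in>{1..p+q}. \<Sum>\<alpha> | T \<alpha> \<noteq> 0. ?J i j \<star> (?r i j \<alpha> *\<^sub>R tau i (tau j (T \<alpha>))))"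
    by (simp only: sum.swap[where A = "{\<alpha>. T \<alpha> \<noteq> 0}"])
  also have "\<dots> = (\<Sum>i\<in>{1..p+q}. \<Sum>j\<in>{1..p+q}. (-1) ^ (par i * a + 1) *\<^sub>R
      (pderiv i (X j) \<star> (eop j (cop i T) \<beta> - (if i = j then (d * (-1) ^ par i) *\<^sub>R T \<beta> else 0))))"
  proof (intro sum.cong refl)
    fix i j assume ij: "i \<in> {1..p+q}" "j \<in> {1..p+q}"
    have "(\<Sum>\<alpha> | T \<alpha> \<noteq> 0. ?J i j \<star> (?r i j \<alpha> *\<^sub>R tau i (tau j (T \<alpha>)))) =
        ?J i j \<star> (\<Sum>\<alpha> | T \<alpha> \<noteq> 0. ?r i j \<alpha> *\<^sub>R tau i (tau j (T \<alpha>)))"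
      by (rule star_sum_right[symmetric])
    also have "\<dots> = (-1) ^ (par i * a + 1) *\<^sub>R
        (pderiv i (X j) \<star> (eop j (cop i T) \<beta> - (if i = j then (d * (-1) ^ par i) *\<^sub>R T \<beta> else 0)))"
      unfolding rsum[OF ij] by (rule star_scale_left)
    finally show "(\<Sum>\<alpha> | T \<alpha> \<noteq> 0. ?J i j \<star> (?r i j \<alpha> *\<^sub>R tau i (tau j (T \<alpha>)))) = \<dots>" .
  qed
  finally show ?thesis .
qed

subsection \<open>Iterated derivatives\<close>

lemma smooth_mult:
  assumes "smooth g" "smooth h"
  shows "smooth (\<lambda>x. g x * h x)"
proof -
  \<comment> \<open>By the Leibniz rule the finite sums of products of smooth functions are closed
    under differentiation. Lists of pairs represent these sums, so that a derivative is again given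
    by a list.\<close>
  define F where "F L = (\<lambda>x. \<Sum>(g, h)\<leftarrow>L. g x * h x :: real)" for L :: "((point \<Rightarrow> real) \<times> (point \<Rightarrow> real)) list"
  define ok where "ok L \<longleftrightarrow> (\<forall>(g, h)\<in>set L. smooth g \<and> smooth h)" for L :: "((point \<Rightarrow> real) \<times> (point \<Rightarrow> real)) list"
  have F_Nil: "F [] = (\<lambda>x. 0)" and F_Cons: "F ((g, h) # L) = (\<lambda>x. g x * h x + F L x)" for g h L
    by (simp_all add: F_def)
  have ok_Cons: "ok ((g, h) # L) \<longleftrightarrow> smooth g \<and> smooth h \<and> ok L" for g h L
    by (simp add: ok_def)
  have dep: "F L x = F L y" if "ok L" "\<And>i. i \<in> {1..p} \<Longrightarrow> x i = y i" for L x y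
    using that(1)
  proof (induction L)
    case (Cons a L)
    obtain g h where "a = (g, h)" by (cases a)
    then show ?case
      using Cons that(2) smooth_cong_point[of g x y] smooth_cong_point[of h x y] by (simp add: F_Cons ok_Cons)
  qed (simp add: F_Nil)
  have cont: "continuous_on UNIV (F L)" if "ok L" for L
    using that
  proof (induction L)
    case (Cons a L)
    obtain g h where "a = (g, h)" by (cases a)
    then show ?case
      using Cons continuous_on_add[OF continuous_on_mult[OF smooth_continuous[of g] smooth_continuous[of h]], of "F L"]
      by (simp add: F_Cons ok_Cons)
  qed (simp add: F_Nil)
  have deriv: "\<exists>L'. ok L' \<and> (\<forall>x s. DERIV (\<lambda>t. F L (x(i := t))) s :> F L' (x(i := s)))" if "ok L" "i \<in> {1..p}" for L i
    using that(1)
  proof (induction L)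
    case Nil
    show ?case by (intro exI[of _ "[]"]) (simp add: F_Nil ok_def)
  next
    case (Cons a L)
    obtain g h where a: "a = (g, h)" by (cases a)
    then have gh: "smooth g" "smooth h" "ok L" using Cons.prems by (simp_all add: ok_Cons)
    obtain L' where L': "ok L'" "\<And>x s. DERIV (\<lambda>t. F L (x(i := t))) s :> F L' (x(i := s))"
      using Cons.IH[OF gh(3)] by blast
    have "DERIV (\<lambda>t. F (a # L) (x(i := t))) s :> F ((partial i g, h) # (partial i h, g) # L') (x(i := s))" for x s
      unfolding a F_Cons
      using DERIV_add[OF DERIV_mult[OF smooth_DERIV[OF gh(1) that(2)] smooth_DERIV[OF gh(2) that(2)]] L'(2)]
      by (simp only: add.assoc)
    moreover have "ok ((partial i g, h) # (partial i h, g) # L')"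
      using gh L' that(2) smooth_partial by (simp add: ok_Cons)
    ultimately show ?case by blast
  qed
  have "smooth (F [(g, h)])"
  proof (rule smooth_coinduct[of _ "{F L | L. ok L}"])
    show "F [(g, h)] \<in> {F L | L. ok L}" using assms by (auto simp: ok_def)
  next
    fix f and x y :: point assume "f \<in> {F L | L. ok L}" and *: "\<And>i. i \<in> {1..p} \<Longrightarrow> x i = y i"
    then obtain L where "f = F L" "ok L" by blast
    then show "f x = f y" using dep[of L x y] * by simp
  next
    fix f assume "f \<in> {F L | L. ok L}"
    then show "continuous_on UNIV f" using cont by blast
  next
    fix f i and x :: point assume "f \<in> {F L | L. ok L}" "i \<in> {1..p}"
    then obtain L L' where "f = F L" "\<And>x s. DERIV (\<lambda>t. F L (x(i := t))) s :> F L' (x(i := s))"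
      using deriv by blast
    then show "(\<lambda>t. f (x(i := t))) differentiable (at (x i))"
      using real_differentiable_def by blast
  next
    fix f i assume "f \<in> {F L | L. ok L}" "i \<in> {1..p}"
    then obtain L L' where L: "f = F L" "ok L'" "\<And>x s. DERIV (\<lambda>t. F L (x(i := t))) s :> F L' (x(i := s))"
      using deriv by blast
    have "partial i f x = F L' x" for x
      using DERIV_imp_deriv[OF L(3)[of x "x i"]] unfolding L(1) partial_def by (simp only: fun_upd_triv)
    then have "partial i f = F L'" by (rule ext)
    then show "partial i f \<in> {F L | L. ok L}" using L(2) by blast
  qed
  then show ?thesis by (simp add: F_def)
qed

lemma smooth_sum: "(\<And>a. a \<in> A \<Longrightarrow> smooth (f a)) \<Longrightarrow> smooth (\<lambda>x. \<Sum>a\<in>A. f a x)"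
proof (induction A rule: infinite_finite_induct)
  case (insert a A)
  then have "smooth (f a + (\<lambda>x. \<Sum>a\<in>A. f a x))" by (intro smooth_add) auto
  then show ?case using insert by (simp add: plus_fun_def)
qed simp_all

lemma sfuns_star [simp, intro]:
  assumes "f \<in> sfuns" "g \<in> sfuns"
  shows "f \<star> g \<in> sfuns"
proof -
  have "smooth ((f \<star> g) K)" for K
  proof -
    have "smooth (\<lambda>x. (-1) ^ inversions I (K - I) * (f I x * g (K - I) x))" for I
      using assms by (intro smooth_mult smooth_const sfuns_smooth)
    then have "smooth (\<lambda>x. \<Sum>I\<in>Pow K. (-1) ^ inversions I (K - I) * (f I x * g (K - I) x))"
      by (intro smooth_sum)
    then show ?thesis by (simp add: sfun_mult_def mult.assoc)
  qed
  moreover have "(f \<star> g) K = 0" if K: "\<not> K \<subseteq> {p+1..p+q}" for K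
  proof -
    have "f I x * g (K - I) x = 0" for I x
    proof (cases "I \<subseteq> {p+1..p+q}")
      case True
      then have "\<not> K - I \<subseteq> {p+1..p+q}" using K by blast
      then show ?thesis using sfuns_supp[OF assms(2)] by simp
    next
      case False
      then show ?thesis using sfuns_supp[OF assms(1)] by simp
    qed
    then have "(f \<star> g) K x = 0" for x
      unfolding sfun_mult_def mult.assoc by (intro sum.neutral) simp
    then show ?thesis by (intro ext) simp
  qed
  ultimately show ?thesis by (simp add: sfuns_def)
qed

lemma pderivs_empty [simp]: "pderivs {#} f = f"
  by (simp add: pderivs_def)

lemma pderivs_add_min:
  assumes "\<And>y. y \<in># \<gamma> \<Longrightarrow> x \<le> y"
  shows "pderivs (add_mset x \<gamma>) f = pderiv x (pderivs \<gamma> f)"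
  using assms by (simp add: pderivs_def insort_is_Cons)

lemma sfuns_pderivs [simp, intro]:
  assumes "set_mset \<alpha> \<subseteq> {1..p+q}" "f \<in> sfuns"
  shows "pderivs \<alpha> f \<in> sfuns"
  using assms(1)
proof (induction \<alpha> rule: multiset_induct_min)
  case (add x \<gamma>)
  then show ?case by (subst pderivs_add_min) auto
qed (use assms(2) in simp)

lemma midx_set: "\<alpha> \<in> midx \<Longrightarrow> set_mset \<alpha> \<subseteq> {1..p+q}"
  by (simp add: midx_def)

lemma pderiv_odd_twice:
  assumes "f \<in> sfuns" "i \<in> {1..p+q}" "p < i"
  shows "pderiv i (pderiv i f) = 0"
proof -
  have "pderiv i (pderiv i f) = - pderiv i (pderiv i f)"
    using pderiv_commute[OF assms(1,2,2)] assms(3) by (simp add: par_def)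
  then have "(2::real) *\<^sub>R pderiv i (pderiv i f) = 0" by (simp add: scaleR_2 eq_neg_iff_add_eq_0)
  then show ?thesis by (simp only: scaleR_eq_0_iff) simp
qed

text \<open>The new derivative moves to its sorted place, passing the smaller odd indices. If j is
  odd and already present, the result is 0 because odd derivatives square to 0.\<close>

lemma pderiv_pderivs:
  assumes "\<alpha> \<in> midx" "j \<in> {1..p+q}" "f \<in> sfuns"
  shows "pderiv j (pderivs \<alpha> f) = (if add_mset j \<alpha> \<in> midx then sg j \<alpha> *\<^sub>R pderivs (add_mset j \<alpha>) f else 0)"
  using assms(1)
proof (induction \<alpha> rule: multiset_induct_min)
  case empty
  have "add_mset j {#} \<in> midx" using assms(2) empty by (simp add: midx_add)
  then show ?case by (simp add: sg_def pderivs_def)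
next
  case (add x \<gamma>)
  have \<gamma>: "\<gamma> \<in> midx" "x \<in> {1..p+q}" using add.prems by (simp_all add: midx_add)
  note s = sfuns_pderivs[OF midx_set[OF \<gamma>(1)] assms(3)]
  have x: "pderivs (add_mset x \<gamma>) f = pderiv x (pderivs \<gamma> f)"
    using add.hyps by (intro pderivs_add_min) auto
  show ?case
  proof (cases "j \<le> x")
    case True
    show ?thesis
    proof (cases "add_mset j (add_mset x \<gamma>) \<in> midx")
      case m: True
      have "{i \<in> set_mset (add_mset x \<gamma>). p < i \<and> i < j} = {}" using True add.hyps by force
      then have "sg j (add_mset x \<gamma>) = 1" unfolding sg_def by (simp only: card.empty power_0)
      moreover have "pderivs (add_mset j (add_mset x \<gamma>)) f = pderiv j (pderivs (add_mset x \<gamma>) f)"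
        using True add.hyps by (intro pderivs_add_min) force
      ultimately show ?thesis using m by simp
    next
      case m: False
      then have "p < j" "j \<in># add_mset x \<gamma>"
        using add.prems assms(2) unfolding midx_add[of j "add_mset x \<gamma>"] by simp_all
      then have "j = x" using True add.hyps by force
      then show ?thesis
        using m pderiv_odd_twice[OF s assms(2)] \<open>p < j\<close> unfolding x by simp
    qed
  next
    case False
    then have "x < j" by simp
    have m: "add_mset j (add_mset x \<gamma>) \<in> midx \<longleftrightarrow> add_mset j \<gamma> \<in> midx"
      using add.prems \<open>x < j\<close> by (auto simp: midx_add)
    have k: "(-1) ^ (par j * par x) = kap j x"
      using \<open>x < j\<close> by (auto simp: kap_def par_def)
    have "pderiv j (pderivs (add_mset x \<gamma>) f) = kap j x *\<^sub>R pderiv x (pderiv j (pderivs \<gamma> f))"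
      unfolding x k[symmetric] by (rule pderiv_commute[OF s assms(2) \<gamma>(2)])
    also have "\<dots> = (if add_mset j \<gamma> \<in> midx then (kap j x * sg j \<gamma>) *\<^sub>R pderiv x (pderivs (add_mset j \<gamma>) f) else 0)"
    proof (cases "add_mset j \<gamma> \<in> midx")
      case True
      then show ?thesis
        unfolding add.IH[OF \<gamma>(1)] using assms(3) \<gamma>(2) midx_set[OF True]
        by (simp add: pderiv_scale)
    next
      case False
      then show ?thesis unfolding add.IH[OF \<gamma>(1)] by simp
    qed
    also have "\<dots> = (if add_mset j \<gamma> \<in> midx then sg j (add_mset x \<gamma>) *\<^sub>R pderivs (add_mset j (add_mset x \<gamma>)) f else 0)"
    proof -
      have "pderivs (add_mset x (add_mset j \<gamma>)) f = pderiv x (pderivs (add_mset j \<gamma>) f)"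
        using add.hyps \<open>x < j\<close> by (intro pderivs_add_min) auto
      then show ?thesis by (simp add: sg_add[OF add.prems] add_mset_commute[of j x])
    qed
    finally show ?thesis unfolding m .
  qed
qed

definition mpar :: "nat multiset \<Rightarrow> nat" where
  "mpar \<alpha> = (\<Sum>i\<in>#\<alpha>. par i)"

lemma mpar_simps [simp]: "mpar {#} = 0" "mpar (add_mset i \<alpha>) = par i + mpar \<alpha>"
  by (simp_all add: mpar_def)

lemma pderivs_pderiv:
  assumes "set_mset \<alpha> \<subseteq> {1..p+q}" "j \<in> {1..p+q}" "f \<in> sfuns"
  shows "pderivs \<alpha> (pderiv j f) = (-1) ^ (par j * mpar \<alpha>) *\<^sub>R pderiv j (pderivs \<alpha> f)"
  using assms(1)
proof (induction \<alpha> rule: multiset_induct_min)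
  case (add x \<gamma>)
  have \<gamma>: "set_mset \<gamma> \<subseteq> {1..p+q}" "x \<in> {1..p+q}" using add.prems by simp_all
  have x: "pderivs (add_mset x \<gamma>) g = pderiv x (pderivs \<gamma> g)" for g
    using add.hyps by (intro pderivs_add_min) auto
  have s: "pderivs \<gamma> f \<in> sfuns" using \<gamma>(1) assms(3) by (rule sfuns_pderivs)
  have "pderiv x (pderivs \<gamma> (pderiv j f)) = (-1) ^ (par j * mpar \<gamma>) *\<^sub>R pderiv x (pderiv j (pderivs \<gamma> f))"
    unfolding add.IH[OF \<gamma>(1)] by (rule pderiv_scale[OF sfuns_pderiv[OF s assms(2)] \<gamma>(2)])
  then show ?case
    unfolding x pderiv_commute[OF s \<gamma>(2) assms(2)] by (simp add: power_add algebra_simps)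
qed simp

lemma tau_pderivs:
  assumes "set_mset \<alpha> \<subseteq> {1..p+q}" "f \<in> sfuns"
  shows "tau j (pderivs \<alpha> f) = (-1) ^ (par j * mpar \<alpha>) *\<^sub>R pderivs \<alpha> (tau j f)"
  using assms(1)
proof (induction \<alpha> rule: multiset_induct_min)
  case (add x \<gamma>)
  have \<gamma>: "set_mset \<gamma> \<subseteq> {1..p+q}" "x \<in> {1..p+q}" using add.prems by simp_all
  have x: "pderivs (add_mset x \<gamma>) g = pderiv x (pderivs \<gamma> g)" for g
    using add.hyps by (intro pderivs_add_min) auto
  have s: "pderivs \<gamma> f \<in> sfuns" "pderivs \<gamma> (tau j f) \<in> sfuns"
    using \<gamma>(1) assms(2) by (auto intro: sfuns_pderivs)
  show ?case
    unfolding x tau_pderiv[OF s(1) \<gamma>(2)] add.IH[OF \<gamma>(1)] pderiv_scale[OF s(2) \<gamma>(2)]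
    by (simp add: power_add algebra_simps)
qed simp

text \<open>The commutator of an iterated derivative with multiplication by y^j. The sign on the
  left undoes the cost of y^j passing all the derivatives; \<open>count\<close> is the number of
  derivatives that can hit y^j.\<close>

lemma pderivs_coord_star:
  assumes "\<alpha> \<in> midx" "j \<in> {1..p+q}" "f \<in> sfuns"
  shows "(-1) ^ (par j * mpar \<alpha>) *\<^sub>R pderivs \<alpha> (coord j \<star> f) = coord j \<star> pderivs \<alpha> f +
    ((-1) ^ par j * real (count \<alpha> j) * sg j (\<alpha> - {#j#})) *\<^sub>R pderivs (\<alpha> - {#j#}) f"
  using assms(1)
proof (induction \<alpha> rule: multiset_induct_min)
  case (add x \<gamma>)
  have \<gamma>: "\<gamma> \<in> midx" "x \<in> {1..p+q}" using add.prems by (simp_all add: midx_add)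
  have x: "pderivs (add_mset x \<gamma>) g = pderiv x (pderivs \<gamma> g)" for g
    using add.hyps by (intro pderivs_add_min) auto
  have s: "pderivs \<gamma> f \<in> sfuns" "pderivs \<gamma> (coord j \<star> f) \<in> sfuns" "pderivs (\<gamma> - {#j#}) f \<in> sfuns"
    using midx_set[OF \<gamma>(1)] assms(2,3) by (auto intro!: sfuns_pderivs dest: in_diffD)
  have cc: "(-1 :: real) ^ (par j * par x) * (-1) ^ (par j * par x) = 1"
    by (simp flip: power_mult_distrib)
  let ?r = "(-1) ^ par j * real (count \<gamma> j) * sg j (\<gamma> - {#j#})"
  have "(-1) ^ (par j * mpar (add_mset x \<gamma>)) *\<^sub>R pderivs (add_mset x \<gamma>) (coord j \<star> f) =
      (-1) ^ (par j * par x) *\<^sub>R pderiv x ((-1) ^ (par j * mpar \<gamma>) *\<^sub>R pderivs \<gamma> (coord j \<star> f))"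
    unfolding x by (simp add: pderiv_scale[OF s(2) \<gamma>(2)] distrib_left power_add)
  also have "\<dots> = (-1) ^ (par j * par x) *\<^sub>R pderiv x (coord j \<star> pderivs \<gamma> f + ?r *\<^sub>R pderivs (\<gamma> - {#j#}) f)"
    unfolding add.IH[OF \<gamma>(1)] ..
  also have "pderiv x (coord j \<star> pderivs \<gamma> f + ?r *\<^sub>R pderivs (\<gamma> - {#j#}) f) =
      pderiv x (coord j \<star> pderivs \<gamma> f) + ?r *\<^sub>R pderiv x (pderivs (\<gamma> - {#j#}) f)"
    using s assms(2) \<gamma>(2) by (simp only: pderiv_add pderiv_scale sfuns_scale sfuns_coord_star)
  also have "pderiv x (coord j \<star> pderivs \<gamma> f) = (if x = j then pderivs \<gamma> f else 0) +
      (-1) ^ (par j * par x) *\<^sub>R (coord j \<star> pderiv x (pderivs \<gamma> f))"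
    using s assms(2) \<gamma>(2) by (simp add: pderiv_star pderiv_coord one_star tau_coord mult.commute)
  finally have 1: "(-1) ^ (par j * mpar (add_mset x \<gamma>)) *\<^sub>R pderivs (add_mset x \<gamma>) (coord j \<star> f) =
      coord j \<star> pderivs (add_mset x \<gamma>) f + (-1) ^ (par j * par x) *\<^sub>R (if x = j then pderivs \<gamma> f else 0) +
      ((-1) ^ (par j * par x) * ?r) *\<^sub>R pderiv x (pderivs (\<gamma> - {#j#}) f)"
    unfolding x by (simp only: scaleR_add_right scaleR_scaleR cc scaleR_one add_ac)
  have "(-1) ^ (par j * par x) *\<^sub>R (if x = j then pderivs \<gamma> f else 0) +
      ((-1) ^ (par j * par x) * ?r) *\<^sub>R pderiv x (pderivs (\<gamma> - {#j#}) f) =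
      ((-1) ^ par j * real (count (add_mset x \<gamma>) j) * sg j (add_mset x \<gamma> - {#j#})) *\<^sub>R pderivs (add_mset x \<gamma> - {#j#}) f"
  proof (cases "x = j")
    case True
    have pp: "(-1 :: real) ^ (par j * par j) = (-1) ^ par j" by (simp add: par_def)
    have "{i \<in> set_mset \<gamma>. p < i \<and> i < j} = {}" using True add.hyps by force
    then have sg: "sg j \<gamma> = 1" unfolding sg_def by (simp only: card.empty power_0)
    show ?thesis
    proof (cases "j \<in># \<gamma>")
      case j: True
      then have "\<not> p < j" using add.prems True by (simp add: midx_add)
      then have p0: "par j = 0" by (simp add: par_def)
      have "pderiv j (pderivs (\<gamma> - {#j#}) f) = sg j (\<gamma> - {#j#}) *\<^sub>R pderivs \<gamma> f"
        using pderiv_pderivs[OF midx_minus[OF \<gamma>(1) j] assms(2,3)] j \<gamma>(1) by simp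
      then show ?thesis using True p0 sg by (simp add: algebra_simps)
    next
      case False
      then show ?thesis using True sg pp by (simp add: count_eq_zero_iff[THEN iffD2])
    qed
  next
    case False
    show ?thesis
    proof (cases "j \<in># \<gamma>")
      case True
      then have "x < j" using add.hyps False by force
      have k: "(-1) ^ (par j * par x) = kap j x"
        using \<open>x < j\<close> by (auto simp: kap_def par_def)
      have m: "add_mset x (\<gamma> - {#j#}) \<in> midx"
        using add.prems True False midx_minus[of "add_mset x \<gamma>" j] by simp
      have "pderivs (add_mset x (\<gamma> - {#j#})) f = pderiv x (pderivs (\<gamma> - {#j#}) f)"
        using add.hyps by (intro pderivs_add_min) (auto dest: in_diffD)
      then show ?thesis using False True by (simp add: k sg_add[OF m] mult_ac)
    next
      case j: False
      then show ?thesis using False by (simp add: count_eq_zero_iff[THEN iffD2])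
    qed
  qed
  then show ?case unfolding 1 add.assoc by (rule arg_cong)
qed (simp add: assms)

subsection \<open>Differential operators\<close>

lemma pderivs_in: "c \<in> symbols \<Longrightarrow> c \<alpha> \<noteq> 0 \<Longrightarrow> f \<in> sfuns \<Longrightarrow> pderivs \<alpha> f \<in> sfuns"
  using symbols_midx midx_set sfuns_pderivs by metis

lemma diff_op_term_in: "c \<in> symbols \<Longrightarrow> c \<alpha> \<noteq> 0 \<Longrightarrow> f \<in> sfuns \<Longrightarrow> c \<alpha> \<star> pderivs \<alpha> f \<in> sfuns"
  by (rule sfuns_star[OF symbols_in pderivs_in])

lemma diff_op_eq:
  assumes "f \<in> sfuns" "finite A" "\<And>\<alpha>. \<alpha> \<notin> A \<Longrightarrow> c \<alpha> = 0"
  shows "diff_op c f = (\<Sum>\<alpha>\<in>A. c \<alpha> \<star> pderivs \<alpha> f)"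
proof -
  have "(\<Sum>\<alpha> | c \<alpha> \<noteq> 0. c \<alpha> \<star> pderivs \<alpha> f) = (\<Sum>\<alpha>\<in>A. c \<alpha> \<star> pderivs \<alpha> f)"
    by (rule sum.mono_neutral_left) (use assms in auto)
  then show ?thesis using assms(1) by (simp add: diff_op_def)
qed

lemma diff_op_outside: "f \<notin> sfuns \<Longrightarrow> diff_op c f = 0"
  by (simp add: diff_op_def)

lemma diff_op_in [simp, intro]:
  assumes "c \<in> symbols" "f \<in> sfuns"
  shows "diff_op c f \<in> sfuns"
proof -
  have "(\<Sum>\<alpha> | c \<alpha> \<noteq> 0. c \<alpha> \<star> pderivs \<alpha> f) \<in> sfuns"
    by (rule sfuns_sum) (use diff_op_term_in[OF assms(1) _ assms(2)] in blast)
  then show ?thesis using assms(2) by (simp add: diff_op_def)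
qed

lemma pderivs_add:
  assumes "set_mset \<alpha> \<subseteq> {1..p+q}" "f \<in> sfuns" "g \<in> sfuns"
  shows "pderivs \<alpha> (f + g) = pderivs \<alpha> f + pderivs \<alpha> g"
  using assms(1)
proof (induction \<alpha> rule: multiset_induct_min)
  case (add x \<gamma>)
  have x: "pderivs (add_mset x \<gamma>) g = pderiv x (pderivs \<gamma> g)" for g
    using add.hyps by (intro pderivs_add_min) auto
  have \<gamma>: "set_mset \<gamma> \<subseteq> {1..p+q}" "x \<in> {1..p+q}" using add.prems by simp_all
  show ?case unfolding x add.IH[OF \<gamma>(1)]
    by (rule pderiv_add[OF sfuns_pderivs[OF \<gamma>(1) assms(2)] sfuns_pderivs[OF \<gamma>(1) assms(3)] \<gamma>(2)])
qed simp

lemma pderivs_scale: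
  assumes "set_mset \<alpha> \<subseteq> {1..p+q}" "f \<in> sfuns"
  shows "pderivs \<alpha> (r *\<^sub>R f) = r *\<^sub>R pderivs \<alpha> f"
  using assms(1)
proof (induction \<alpha> rule: multiset_induct_min)
  case (add x \<gamma>)
  have x: "pderivs (add_mset x \<gamma>) g = pderiv x (pderivs \<gamma> g)" for g
    using add.hyps by (intro pderivs_add_min) auto
  have \<gamma>: "set_mset \<gamma> \<subseteq> {1..p+q}" "x \<in> {1..p+q}" using add.prems by simp_all
  show ?case unfolding x add.IH[OF \<gamma>(1)]
    by (rule pderiv_scale[OF sfuns_pderivs[OF \<gamma>(1) assms(2)] \<gamma>(2)])
qed simp

lemma diff_op_add_arg:
  assumes "c \<in> symbols" "f \<in> sfuns" "g \<in> sfuns"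
  shows "diff_op c (f + g) = diff_op c f + diff_op c g"
proof -
  have fg: "f + g \<in> sfuns" using assms by simp
  have "c \<alpha> \<star> pderivs \<alpha> (f + g) = c \<alpha> \<star> pderivs \<alpha> f + c \<alpha> \<star> pderivs \<alpha> g" if "c \<alpha> \<noteq> 0" for \<alpha>
  proof -
    have "set_mset \<alpha> \<subseteq> {1..p+q}" using that symbols_midx[OF assms(1)] midx_set by metis
    then show ?thesis unfolding pderivs_add[OF _ assms(2,3)] by (simp add: pderivs_add[OF _ assms(2,3)] star_add_right)
  qed
  then show ?thesis
    unfolding diff_op_def if_P[OF fg] if_P[OF assms(2)] if_P[OF assms(3)] sum.distrib[symmetric]
    by (intro sum.cong) auto
qed

lemma diff_op_scale_arg:
  assumes "c \<in> symbols" "f \<in> sfuns"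
  shows "diff_op c (r *\<^sub>R f) = r *\<^sub>R diff_op c f"
proof -
  have rf: "r *\<^sub>R f \<in> sfuns" using assms by simp
  have "c \<alpha> \<star> pderivs \<alpha> (r *\<^sub>R f) = r *\<^sub>R (c \<alpha> \<star> pderivs \<alpha> f)" if "c \<alpha> \<noteq> 0" for \<alpha>
  proof -
    have "set_mset \<alpha> \<subseteq> {1..p+q}" using that symbols_midx[OF assms(1)] midx_set by metis
    then show ?thesis by (simp only: pderivs_scale[OF _ assms(2)] star_scale_right)
  qed
  then show ?thesis
    unfolding diff_op_def if_P[OF rf] if_P[OF assms(2)] scaleR_sum_right
    by (intro sum.cong) auto
qed

lemma diff_op_0_arg: "c \<in> symbols \<Longrightarrow> diff_op c 0 = 0"
  using diff_op_scale_arg[of c 0 0] by (simp only: sfuns_0 scaleR_zero_left simp_thms)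

lemma diff_op_sum_arg:
  assumes "c \<in> symbols" "\<And>a. a \<in> A \<Longrightarrow> f a \<in> sfuns"
  shows "diff_op c (\<Sum>a\<in>A. f a) = (\<Sum>a\<in>A. diff_op c (f a))"
  using assms(2)
proof (induction A rule: infinite_finite_induct)
  case (insert a A)
  have "diff_op c (f a + sum f A) = diff_op c (f a) + diff_op c (sum f A)"
    using insert by (intro diff_op_add_arg assms(1) sfuns_sum) auto
  then show ?case using insert by (simp only: sum.insert insert_iff simp_thms)
qed (simp_all only: sum.infinite sum.empty diff_op_0_arg[OF assms(1)] not_False_eq_True)

lemma diff_op_add:
  assumes "c \<in> symbols" "c' \<in> symbols"
  shows "diff_op (c + c') = diff_op c + diff_op c'"
proof
  fix f
  show "diff_op (c + c') f = (diff_op c + diff_op c') f"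
  proof (cases "f \<in> sfuns")
    case True
    let ?A = "{\<alpha>. c \<alpha> \<noteq> 0} \<union> {\<alpha>. c' \<alpha> \<noteq> 0}"
    have A: "finite ?A" using assms symbols_finite by blast
    have "diff_op (c + c') f = (\<Sum>\<alpha>\<in>?A. (c + c') \<alpha> \<star> pderivs \<alpha> f)"
      by (rule diff_op_eq[OF True A]) simp
    also have "\<dots> = (\<Sum>\<alpha>\<in>?A. c \<alpha> \<star> pderivs \<alpha> f) + (\<Sum>\<alpha>\<in>?A. c' \<alpha> \<star> pderivs \<alpha> f)"
      by (simp only: plus_fun_apply[of c c'] star_add_left sum.distrib)
    also have "(\<Sum>\<alpha>\<in>?A. c \<alpha> \<star> pderivs \<alpha> f) = diff_op c f"
      by (rule diff_op_eq[OF True A, symmetric]) simp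
    also have "(\<Sum>\<alpha>\<in>?A. c' \<alpha> \<star> pderivs \<alpha> f) = diff_op c' f"
      by (rule diff_op_eq[OF True A, symmetric]) simp
    finally show ?thesis by (simp only: plus_fun_apply[of "diff_op c"])
  qed (simp add: diff_op_outside)
qed

lemma diff_op_scale:
  assumes "c \<in> symbols"
  shows "diff_op (r *\<^sub>R c) = r *\<^sub>R diff_op c"
proof
  fix f
  show "diff_op (r *\<^sub>R c) f = (r *\<^sub>R diff_op c) f"
  proof (cases "f \<in> sfuns")
    case True
    have "diff_op (r *\<^sub>R c) f = (\<Sum>\<alpha> | c \<alpha> \<noteq> 0. (r *\<^sub>R c) \<alpha> \<star> pderivs \<alpha> f)"
      by (rule diff_op_eq[OF True symbols_finite[OF assms]]) (simp add: scaleR_fun_def[of r c])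
    also have "\<dots> = r *\<^sub>R diff_op c f"
      unfolding diff_op_def if_P[OF True] by (simp only: scaleR_fun_def[of r c] star_scale_left scaleR_sum_right)
    finally show ?thesis by (simp only: scaleR_fun_def[of r "diff_op c"])
  next
    case False
    then show ?thesis by (simp only: diff_op_outside[OF False] scaleR_fun_def[of r "diff_op c"] scaleR_zero_right)
  qed
qed

lemma diff_op_diff:
  assumes "c \<in> symbols" "c' \<in> symbols"
  shows "diff_op (c - c') = diff_op c - diff_op c'"
  using diff_op_add[OF SW.S_diff[OF assms] assms(2)] by (simp only: diff_add_cancel add_diff_cancel_right')

text \<open>The coefficients of the operator conjugated by \<open>tau k\<close>, as
  \<open>tau_diff_op\<close> shows. Each term is signed by par k times its own parity, which is that
  of its coefficient plus \<open>mpar\<close> of its multi-index.\<close>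

definition hat :: "nat \<Rightarrow> symbol \<Rightarrow> symbol" where
  "hat k c = (\<lambda>\<alpha>. (-1) ^ (par k * mpar \<alpha>) *\<^sub>R tau k (c \<alpha>))"

lemma hat_symbols [simp, intro]: "c \<in> symbols \<Longrightarrow> hat k c \<in> symbols"
  by (rule symbolsI[of _ "{\<alpha>. c \<alpha> \<noteq> 0}"])
    (auto simp: hat_def symbols_in symbols_finite dest: symbols_midx)

lemma hat_hat: "hat k (hat k c) = c"
  by (rule symbol_ext) (simp add: hat_def flip: power_mult_distrib)

section \<open>Compositions with coordinates and derivatives, expressed on coefficients\<close>

lemma diff_op_mop:
  assumes "c \<in> symbols" "f \<in> sfuns"
  shows "coord j \<star> diff_op c f = diff_op (mop j c) f"
proof -
  have "diff_op (mop j c) f = (\<Sum>\<alpha> | c \<alpha> \<noteq> 0. mop j c \<alpha> \<star> pderivs \<alpha> f)"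
    by (rule diff_op_eq[OF assms(2) symbols_finite[OF assms(1)]]) (simp add: mop_def)
  then show ?thesis
    unfolding diff_op_def if_P[OF assms(2)] mop_def by (simp only: star_sum_right star_assoc)
qed

lemma diff_op_eop:
  assumes "c \<in> symbols" "f \<in> sfuns" "j \<in> {1..p+q}"
  shows "diff_op (eop j c) f = (\<Sum>\<alpha> | c \<alpha> \<noteq> 0. tau j (c \<alpha>) \<star> pderiv j (pderivs \<alpha> f))"
proof -
  have "diff_op (eop j c) f = (\<Sum>\<beta>\<in>add_mset j ` {\<alpha>. c \<alpha> \<noteq> 0}. eop j c \<beta> \<star> pderivs \<beta> f)"
  proof (rule diff_op_eq[OF assms(2) finite_imageI[OF symbols_finite[OF assms(1)]]])
    fix \<beta> assume *: "\<beta> \<notin> add_mset j ` {\<alpha>. c \<alpha> \<noteq> 0}"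
    show "eop j c \<beta> = 0"
    proof (cases "j \<in># \<beta>")
      case True
      then have "\<beta> = add_mset j (\<beta> - {#j#})" by simp
      then have "c (\<beta> - {#j#}) = 0" using * by blast
      then show ?thesis by (simp add: eop_def emul_def)
    qed (simp add: eop_def emul_def)
  qed
  also have "\<dots> = (\<Sum>\<alpha> | c \<alpha> \<noteq> 0. eop j c (add_mset j \<alpha>) \<star> pderivs (add_mset j \<alpha>) f)"
    by (subst sum.reindex) (auto simp: inj_on_def)
  also have "\<dots> = (\<Sum>\<alpha> | c \<alpha> \<noteq> 0. tau j (c \<alpha>) \<star> pderiv j (pderivs \<alpha> f))"
  proof (intro sum.cong refl)
    fix \<alpha> assume "\<alpha> \<in> {\<alpha>. c \<alpha> \<noteq> 0}"
    then have "\<alpha> \<in> midx" using symbols_midx[OF assms(1)] by blast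
    then show "eop j c (add_mset j \<alpha>) \<star> pderivs (add_mset j \<alpha>) f = tau j (c \<alpha>) \<star> pderiv j (pderivs \<alpha> f)"
      by (simp add: pderiv_pderivs[OF _ assms(3,2)] eop_def emul_def)
  qed
  finally show ?thesis .
qed

text \<open>Composed on the left, \<partial>_j either differentiates the coefficients, which is
  \<open>dop\<close>, or passes them and joins the derivatives, which is \<open>eop\<close>.\<close>

lemma diff_op_dop:
  assumes "c \<in> symbols" "f \<in> sfuns" "j \<in> {1..p+q}"
  shows "pderiv j (diff_op c f) = diff_op (dop j c + eop j c) f"
proof -
  have "diff_op (dop j c) f = (\<Sum>\<alpha> | c \<alpha> \<noteq> 0. dop j c \<alpha> \<star> pderivs \<alpha> f)"
    by (rule diff_op_eq[OF assms(2) symbols_finite[OF assms(1)]]) (simp add: dop_def)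
  moreover have "pderiv j (c \<alpha> \<star> pderivs \<alpha> f) =
      dop j c \<alpha> \<star> pderivs \<alpha> f + tau j (c \<alpha>) \<star> pderiv j (pderivs \<alpha> f)" if "c \<alpha> \<noteq> 0" for \<alpha>
    unfolding dop_def
    by (rule pderiv_star[OF symbols_in[OF assms(1)] pderivs_in[OF assms(1) that assms(2)] assms(3)])
  then have "pderiv j (diff_op c f) = (\<Sum>\<alpha> | c \<alpha> \<noteq> 0. dop j c \<alpha> \<star> pderivs \<alpha> f + tau j (c \<alpha>) \<star> pderiv j (pderivs \<alpha> f))"
    unfolding diff_op_def if_P[OF assms(2)]
    using diff_op_term_in[OF assms(1) _ assms(2)] assms(3)
    by (subst pderiv_sum) (blast | intro sum.cong | simp)+
  ultimately show ?thesis
    using diff_op_eop[OF assms] diff_op_add[OF SW.d_in[OF assms(3,1)] SW.e_in[OF assms(3,1)]]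
    by (simp only: sum.distrib plus_fun_apply[of "diff_op _"])
qed

lemma diff_op_pderiv:
  assumes "c \<in> symbols" "f \<in> sfuns" "j \<in> {1..p+q}"
  shows "diff_op (hat j c) (pderiv j f) = diff_op (eop j c) f"
proof -
  have "diff_op (hat j c) (pderiv j f) = (\<Sum>\<alpha> | c \<alpha> \<noteq> 0. hat j c \<alpha> \<star> pderivs \<alpha> (pderiv j f))"
    by (rule diff_op_eq[OF sfuns_pderiv[OF assms(2,3)] symbols_finite[OF assms(1)]]) (simp add: hat_def)
  also have "\<dots> = diff_op (eop j c) f"
    unfolding diff_op_eop[OF assms]
  proof (intro sum.cong refl)
    fix \<alpha> assume "\<alpha> \<in> {\<alpha>. c \<alpha> \<noteq> 0}"
    then have "set_mset \<alpha> \<subseteq> {1..p+q}" using symbols_midx[OF assms(1)] midx_set by blast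
    then show "hat j c \<alpha> \<star> pderivs \<alpha> (pderiv j f) = tau j (c \<alpha>) \<star> pderiv j (pderivs \<alpha> f)"
      by (simp add: hat_def pderivs_pderiv[OF _ assms(3,2)] flip: power_mult_distrib)
  qed
  finally show ?thesis .
qed

text \<open>Composed on the right, y^j is commuted to the far left, and each derivative that it
  meets may consume it, which is the contraction. With \<open>hat\<close> on the left side, the sign
  of y^j passing a whole term disappears.\<close>

lemma diff_op_coord_star:
  assumes "c \<in> symbols" "f \<in> sfuns" "j \<in> {1..p+q}"
  shows "diff_op (hat j c) (coord j \<star> f) = diff_op (mop j c + (-1) ^ par j *\<^sub>R cop j c) f"
proof -
  let ?S = "{\<alpha>. c \<alpha> \<noteq> 0}" and ?S' = "{\<alpha>. c \<alpha> \<noteq> 0 \<and> j \<in># \<alpha>}"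
  let ?R = "\<lambda>\<alpha>. (real (count \<alpha> j) * sg j (\<alpha> - {#j#})) *\<^sub>R pderivs (\<alpha> - {#j#}) f"
  have fin: "finite ?S" "finite ?S'" using symbols_finite[OF assms(1)] by auto
  have "diff_op (cop j c) f = (\<Sum>\<beta>\<in>(\<lambda>\<alpha>. \<alpha> - {#j#}) ` ?S'. cop j c \<beta> \<star> pderivs \<beta> f)"
  proof (rule diff_op_eq[OF assms(2) finite_imageI[OF fin(2)]])
    fix \<beta> assume *: "\<beta> \<notin> (\<lambda>\<alpha>. \<alpha> - {#j#}) ` ?S'"
    have "c (add_mset j \<beta>) = 0"
    proof (rule ccontr)
      assume "c (add_mset j \<beta>) \<noteq> 0"
      then have "\<beta> \<in> (\<lambda>\<alpha>. \<alpha> - {#j#}) ` ?S'" by (intro image_eqI[of _ _ "add_mset j \<beta>"]) simp_all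
      then show False using * by contradiction
    qed
    then show "cop j c \<beta> = 0" by (simp add: cop_def contr_def)
  qed
  also have "\<dots> = (\<Sum>\<alpha>\<in>?S'. cop j c (\<alpha> - {#j#}) \<star> pderivs (\<alpha> - {#j#}) f)"
    by (rule sum.reindex_cong[where l = "\<lambda>\<alpha>. \<alpha> - {#j#}"]) (auto simp: inj_on_def dest: arg_cong[where f = "add_mset j"])
  also have "\<dots> = (\<Sum>\<alpha>\<in>?S'. tau j (c \<alpha>) \<star> ?R \<alpha>)"
  proof (intro sum.cong refl)
    fix \<alpha> assume "\<alpha> \<in> ?S'"
    then have \<alpha>: "j \<in># \<alpha>" "\<alpha> \<in> midx" using symbols_midx[OF assms(1)] by blast+
    then have "Suc (count (\<alpha> - {#j#}) j) = count \<alpha> j" by (simp add: Suc_pred)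
    then show "cop j c (\<alpha> - {#j#}) \<star> pderivs (\<alpha> - {#j#}) f = tau j (c \<alpha>) \<star> ?R \<alpha>"
      using \<alpha> by (simp add: cop_def contr_def)
  qed
  also have "\<dots> = (\<Sum>\<alpha>\<in>?S. tau j (c \<alpha>) \<star> ?R \<alpha>)"
  proof (rule sum.mono_neutral_left[OF fin(1)])
    show "\<forall>\<alpha>\<in>?S - ?S'. tau j (c \<alpha>) \<star> ?R \<alpha> = 0"
    proof
      fix \<alpha> assume "\<alpha> \<in> ?S - ?S'"
      then have "j \<notin># \<alpha>" by blast
      then have "count \<alpha> j = 0" by (simp add: count_eq_zero_iff)
      then show "tau j (c \<alpha>) \<star> ?R \<alpha> = 0" by simp
    qed
  qed blast
  finally have C: "diff_op (cop j c) f = (\<Sum>\<alpha>\<in>?S. tau j (c \<alpha>) \<star> ?R \<alpha>)" .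
  have dc: "diff_op c f = (\<Sum>\<alpha>\<in>?S. c \<alpha> \<star> pderivs \<alpha> f)"
    using assms(2) by (simp add: diff_op_def)
  have "diff_op (hat j c) (coord j \<star> f) = (\<Sum>\<alpha>\<in>?S. hat j c \<alpha> \<star> pderivs \<alpha> (coord j \<star> f))"
    by (rule diff_op_eq[OF sfuns_coord_star[OF assms(2,3)] fin(1)]) (simp add: hat_def)
  also have "\<dots> = (\<Sum>\<alpha>\<in>?S. coord j \<star> (c \<alpha> \<star> pderivs \<alpha> f) + (-1) ^ par j *\<^sub>R (tau j (c \<alpha>) \<star> ?R \<alpha>))"
  proof (intro sum.cong refl)
    fix \<alpha> assume "\<alpha> \<in> ?S"
    then have \<alpha>: "\<alpha> \<in> midx" using symbols_midx[OF assms(1)] by blast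
    have "hat j c \<alpha> \<star> pderivs \<alpha> (coord j \<star> f) = tau j (c \<alpha>) \<star> ((-1) ^ (par j * mpar \<alpha>) *\<^sub>R pderivs \<alpha> (coord j \<star> f))"
      by (simp only: hat_def star_scale_left star_scale_right)
    also have "\<dots> = tau j (c \<alpha>) \<star> (coord j \<star> pderivs \<alpha> f) + tau j (c \<alpha>) \<star> ((-1) ^ par j *\<^sub>R ?R \<alpha>)"
      unfolding pderivs_coord_star[OF \<alpha> assms(3,2)] by (simp only: star_add_right scaleR_scaleR mult.assoc)
    also have "tau j (c \<alpha>) \<star> (coord j \<star> pderivs \<alpha> f) = coord j \<star> (c \<alpha> \<star> pderivs \<alpha> f)"
      using star_coord[OF sfuns_tau[OF symbols_in[OF assms(1)]], of j \<alpha> j]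
      by (simp only: star_assoc[symmetric] tau_tau)
    finally show "hat j c \<alpha> \<star> pderivs \<alpha> (coord j \<star> f) =
        coord j \<star> (c \<alpha> \<star> pderivs \<alpha> f) + (-1) ^ par j *\<^sub>R (tau j (c \<alpha>) \<star> ?R \<alpha>)"
      by (simp only: star_scale_right)
  qed
  also have "\<dots> = coord j \<star> diff_op c f + (-1) ^ par j *\<^sub>R diff_op (cop j c) f"
    unfolding C dc sum.distrib scaleR_sum_right[symmetric] star_sum_right[symmetric] ..
  also have "\<dots> = diff_op (mop j c + (-1) ^ par j *\<^sub>R cop j c) f"
    using SW.m_in[OF assms(3,1)] SW.c_in[OF assms(3,1)]
    by (simp only: diff_op_mop[OF assms(1,2)] diff_op_add diff_op_scale SW.S_scale plus_fun_apply[of "diff_op _"] scaleR_fun_def[of _ "diff_op _"])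
  finally show ?thesis .
qed

lemma tau_diff_op:
  assumes "c \<in> symbols" "f \<in> sfuns"
  shows "tau j (diff_op c f) = diff_op (hat j c) (tau j f)"
proof -
  have tsum: "tau j (\<Sum>a\<in>A. g a) = (\<Sum>a\<in>A. tau j (g a))" for A :: "nat multiset set" and g
    using sum_comp_morphism[where h = "tau j" and g = g and A = A, OF tau_0 tau_add]
    unfolding comp_def by (rule sym)
  have "diff_op (hat j c) (tau j f) = (\<Sum>\<alpha> | c \<alpha> \<noteq> 0. hat j c \<alpha> \<star> pderivs \<alpha> (tau j f))"
    by (rule diff_op_eq[OF sfuns_tau[OF assms(2)] symbols_finite[OF assms(1)]]) (simp add: hat_def)
  also have "\<dots> = (\<Sum>\<alpha> | c \<alpha> \<noteq> 0. tau j (c \<alpha> \<star> pderivs \<alpha> f))"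
  proof (intro sum.cong refl)
    fix \<alpha> assume "\<alpha> \<in> {\<alpha>. c \<alpha> \<noteq> 0}"
    then have "set_mset \<alpha> \<subseteq> {1..p+q}" using symbols_midx[OF assms(1)] midx_set by blast
    then show "hat j c \<alpha> \<star> pderivs \<alpha> (tau j f) = tau j (c \<alpha> \<star> pderivs \<alpha> f)"
      by (simp add: hat_def tau_star tau_pderivs[OF _ assms(2)])
  qed
  also have "\<dots> = tau j (diff_op c f)" unfolding diff_op_def if_P[OF assms(2)] tsum ..
  finally show ?thesis ..
qed

text \<open>Coefficients are recovered by supercommutators with coordinates, which lower the order
  and contract the coefficients. By induction on the order all contractions vanish, hence all
  coefficients except the one at the empty multi-index, and that one is the value of the operator on
  the constant 1.\<close>

lemma diff_op_eq_0D:
  assumes "c \<in> symbols" "\<And>f. f \<in> sfuns \<Longrightarrow> diff_op c f = 0"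
  shows "c = 0"
proof -
  have "c = 0" if "\<And>\<alpha>. c \<alpha> \<noteq> 0 \<Longrightarrow> size \<alpha> < N" "c \<in> symbols" "\<And>f. f \<in> sfuns \<Longrightarrow> diff_op c f = 0" for N c
    using that
  proof (induction N arbitrary: c)
    case 0
    then show ?case by (intro symbol_ext) (metis not_less_zero zero_fun_apply)
  next
    case (Suc N)
    \<comment> \<open>Multiplying the zero operator by y^j on either side gives 0, so the
      supercommutator is 0 as well. Up to sign its coefficients are this contraction, which has
      smaller order.\<close>
    have cop: "cop j (hat j c) = 0" if j: "j \<in> {1..p+q}" for j
    proof (rule Suc.IH)
      have hc: "hat j c \<in> symbols" using Suc.prems(2) by simp
      show cs: "cop j (hat j c) \<in> symbols" using SW.c_in[OF j hc] .
      show "size \<alpha> < N" if "cop j (hat j c) \<alpha> \<noteq> 0" for \<alpha>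
      proof -
        have "c (add_mset j \<alpha>) \<noteq> 0"
        proof
          assume "c (add_mset j \<alpha>) = 0"
          then have "cop j (hat j c) \<alpha> = 0" by (simp add: cop_def contr_def hat_def)
          then show False using that by contradiction
        qed
        from Suc.prems(1)[OF this] show ?thesis by simp
      qed
      show "diff_op (cop j (hat j c)) f = 0" if f: "f \<in> sfuns" for f
      proof -
        have "diff_op (hat j c) f = tau j (diff_op c (tau j f))"
          using tau_diff_op[OF Suc.prems(2) sfuns_tau[OF f], of j] by simp
        then have "diff_op (hat j c) f = 0" unfolding Suc.prems(3)[OF sfuns_tau[OF f]] tau_0 .
        then have m: "diff_op (mop j (hat j c)) f = 0" using diff_op_mop[OF hc f, of j] by simp
        have "0 = diff_op (mop j (hat j c) + (-1) ^ par j *\<^sub>R cop j (hat j c)) f"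
          using diff_op_coord_star[OF hc f j] Suc.prems(3)[OF sfuns_coord_star[OF f j]] unfolding hat_hat by (rule trans[OF sym, rotated])
        also have "\<dots> = diff_op (mop j (hat j c)) f + (-1) ^ par j *\<^sub>R diff_op (cop j (hat j c)) f"
          by (simp only: diff_op_add[OF SW.m_in[OF j hc] SW.S_scale[OF cs]] diff_op_scale[OF cs] plus_fun_apply[of "diff_op _"] scaleR_fun_def[of _ "diff_op _"])
        finally show ?thesis unfolding m by simp
      qed
    qed
    have c0: "c \<alpha> = 0" if ne: "\<alpha> \<noteq> {#}" for \<alpha>
    proof (cases "\<alpha> \<in> midx")
      case True
      obtain j \<beta> where \<alpha>: "\<alpha> = add_mset j \<beta>" using ne by (cases \<alpha>) auto
      then have "j \<in> {1..p+q}" using True by (simp add: midx_add)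
      then have "cop j (hat j c) \<beta> = 0" using cop by simp
      then have "(real (Suc (count \<beta> j)) * sg j \<beta>) *\<^sub>R tau j (hat j c \<alpha>) = 0"
        using True by (simp add: cop_def contr_def \<alpha>)
      moreover have "sg j \<beta> \<noteq> 0" by (simp add: sg_def)
      ultimately have "tau j (hat j c \<alpha>) = 0" by (simp only: scaleR_eq_0_iff) simp
      then have "(-1) ^ (par j * mpar \<alpha>) *\<^sub>R c \<alpha> = 0" by (simp only: hat_def tau_scale tau_tau)
      then show ?thesis by (simp only: scaleR_eq_0_iff) simp
    next
      case False
      then show ?thesis by (rule symbols_midx[OF Suc.prems(2)])
    qed
    have "diff_op c one = (\<Sum>\<alpha>\<in>{{#}}. c \<alpha> \<star> pderivs \<alpha> one)"
      by (rule diff_op_eq) (use c0 in auto)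
    then have "diff_op c one = c {#}"
      using symbols_in[OF Suc.prems(2)] by (simp add: one_star)
    then have "c {#} = 0" using Suc.prems(3)[OF sfuns_one] by (rule trans[OF sym])
    with c0 have "c \<alpha> = 0" for \<alpha> by (cases "\<alpha> = {#}") blast+
    then show ?case by (intro symbol_ext) (metis zero_fun_apply)
  qed
  moreover have "\<exists>N. \<forall>\<alpha>. c \<alpha> \<noteq> 0 \<longrightarrow> size \<alpha> < N"
    using finite_nat_set_iff_bounded[of "size ` {\<alpha>. c \<alpha> \<noteq> 0}"] symbols_finite[OF assms(1)] by auto
  ultimately show ?thesis using assms by blast
qed

lemma diff_op_inj:
  assumes "c \<in> symbols" "c' \<in> symbols" "diff_op c = diff_op c'"
  shows "c = c'"
proof -
  have "c - c' = 0"
    by (rule diff_op_eq_0D) (use assms in \<open>simp_all add: SW.S_diff diff_op_diff\<close>)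
  then show ?thesis by simp
qed

subsection \<open>Projective vector fields\<close>

definition vfields :: "vfield set" where
  "vfields = {X. \<forall>i\<in>{1..p+q}. X i \<in> sfuns}"

text \<open>Makes it possible to test actions on generators of the projective superalgebra. A
  \<open>vfield\<close> has components at all natural numbers while only 1, ..., p + q are
  meaningful, hence the congruence clause.\<close>

definition vfield_linear :: "(vfield \<Rightarrow> 'b::real_vector) \<Rightarrow> bool" where
  "vfield_linear F \<longleftrightarrow> (\<forall>X\<in>vfields. \<forall>Y\<in>vfields. F (X + Y) = F X + F Y) \<and>
     (\<forall>r. \<forall>X\<in>vfields. F (r *\<^sub>R X) = r *\<^sub>R F X) \<and>
     (\<forall>X\<in>vfields. \<forall>Y. (\<forall>i\<in>{1..p+q}. Y i = X i) \<longrightarrow> F Y = F X)"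

lemma vfield_linear_add: "vfield_linear F \<Longrightarrow> X \<in> vfields \<Longrightarrow> Y \<in> vfields \<Longrightarrow> F (X + Y) = F X + F Y"
  and vfield_linear_scale: "vfield_linear F \<Longrightarrow> X \<in> vfields \<Longrightarrow> F (r *\<^sub>R X) = r *\<^sub>R F X"
  and vfield_linear_cong: "vfield_linear F \<Longrightarrow> X \<in> vfields \<Longrightarrow> (\<And>i. i \<in> {1..p+q} \<Longrightarrow> Y i = X i) \<Longrightarrow> F Y = F X"
  unfolding vfield_linear_def by blast+

lemma vfield_linearI:
  assumes "\<And>X Y. X \<in> vfields \<Longrightarrow> Y \<in> vfields \<Longrightarrow> F (X + Y) = F X + F Y"
    and "\<And>r X. X \<in> vfields \<Longrightarrow> F (r *\<^sub>R X) = r *\<^sub>R F X"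
    and "\<And>X Y. X \<in> vfields \<Longrightarrow> (\<And>i. i \<in> {1..p+q} \<Longrightarrow> Y i = X i) \<Longrightarrow> F Y = F X"
  shows "vfield_linear F"
  unfolding vfield_linear_def using assms by blast

lemma vfields_add: "X \<in> vfields \<Longrightarrow> Y \<in> vfields \<Longrightarrow> X + Y \<in> vfields"
  and vfields_scale: "X \<in> vfields \<Longrightarrow> r *\<^sub>R X \<in> vfields"
  by (simp_all add: vfields_def scaleR_fun_def[of r X])

lemma vfields_sum: "(\<And>k. k \<in> A \<Longrightarrow> X k \<in> vfields) \<Longrightarrow> sum X A \<in> vfields"
  by (simp add: vfields_def sum_fun_apply sfuns_sum)

lemma vfield_linear_setsum:
  assumes "vfield_linear F" "\<And>k. k \<in> A \<Longrightarrow> X k \<in> vfields"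
  shows "F (\<Sum>k\<in>A. r k *\<^sub>R X k) = (\<Sum>k\<in>A. r k *\<^sub>R F (X k))"
  using assms(2)
proof (induction A rule: infinite_finite_induct)
  have F0: "F 0 = 0"
  proof -
    have "0 \<in> vfields" by (simp add: vfields_def)
    then show ?thesis using vfield_linear_scale[OF assms(1), of 0 0] by simp
  qed
  {
    case (infinite A) then show ?case by (simp only: sum.infinite F0 not_False_eq_True)
  next
    case empty show ?case by (simp only: sum.empty F0)
  next
    case (insert k A)
    have "F (r k *\<^sub>R X k + (\<Sum>k\<in>A. r k *\<^sub>R X k)) = F (r k *\<^sub>R X k) + F (\<Sum>k\<in>A. r k *\<^sub>R X k)"
      using insert.prems by (intro vfield_linear_add[OF assms(1)] vfields_scale vfields_sum) auto
    also have "F (r k *\<^sub>R X k) = r k *\<^sub>R F (X k)"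
      using insert.prems by (intro vfield_linear_scale[OF assms(1)]) auto
    finally show ?case using insert by (simp only: sum.insert insert_iff simp_thms)
  }
qed

lemma vfield_linear_compose:
  assumes "vfield_linear F" "\<And>X. X \<in> vfields \<Longrightarrow> F X \<in> sfuns"
    and "\<And>f g. f \<in> sfuns \<Longrightarrow> g \<in> sfuns \<Longrightarrow> H (f + g) = H f + H g"
    and "\<And>r f. f \<in> sfuns \<Longrightarrow> H (r *\<^sub>R f) = r *\<^sub>R H f"
  shows "vfield_linear (\<lambda>X. H (F X))"
proof (rule vfield_linearI)
  fix X Y :: vfield assume X: "X \<in> vfields" and "\<And>i. i \<in> {1..p+q} \<Longrightarrow> Y i = X i"
  then show "H (F Y) = H (F X)" using vfield_linear_cong[OF assms(1) X] by metis
qed (simp_all only: vfield_linear_add[OF assms(1)] vfield_linear_scale[OF assms(1)] assms(2-4))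

lemma vfield_linear_sums:
  assumes "\<And>k. k \<in> A \<Longrightarrow> vfield_linear (F k)"
  shows "vfield_linear (\<lambda>X. \<Sum>k\<in>A. F k X)"
proof (rule vfield_linearI)
  fix X Y :: vfield assume X: "X \<in> vfields"
  show "(\<Sum>k\<in>A. F k (X + Y)) = (\<Sum>k\<in>A. F k X) + (\<Sum>k\<in>A. F k Y)" if "Y \<in> vfields"
    unfolding sum.distrib[symmetric] by (intro sum.cong refl vfield_linear_add assms X that)
  show "(\<Sum>k\<in>A. F k (r *\<^sub>R X)) = r *\<^sub>R (\<Sum>k\<in>A. F k X)" for r
    unfolding scaleR_sum_right by (intro sum.cong refl vfield_linear_scale assms X)
  assume *: "\<And>i. i \<in> {1..p+q} \<Longrightarrow> Y i = X i"
  show "(\<Sum>k\<in>A. F k Y) = (\<Sum>k\<in>A. F k X)"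
    by (intro sum.cong refl vfield_linear_cong[OF assms X] *)
qed

lemma vfield_linear_plus:
  assumes "vfield_linear G" "vfield_linear H"
  shows "vfield_linear (\<lambda>X. G X + H X)"
  using vfield_linear_sums[of "UNIV :: bool set" "\<lambda>b. if b then G else H"] assms by (simp add: UNIV_bool add.commute)

lemma vfield_linear_scaleR:
  assumes "vfield_linear G"
  shows "vfield_linear (\<lambda>X. r *\<^sub>R G X)"
proof (rule vfield_linearI)
  fix X Y :: vfield assume X: "X \<in> vfields"
  show "r *\<^sub>R G (X + Y) = r *\<^sub>R G X + r *\<^sub>R G Y" if "Y \<in> vfields"
    by (simp only: vfield_linear_add[OF assms X that] scaleR_add_right)
  show "r *\<^sub>R G (s *\<^sub>R X) = s *\<^sub>R r *\<^sub>R G X" for s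
    by (simp only: vfield_linear_scale[OF assms X] scaleR_scaleR mult.commute)
  assume "\<And>i. i \<in> {1..p+q} \<Longrightarrow> Y i = X i"
  then show "r *\<^sub>R G Y = r *\<^sub>R G X" using vfield_linear_cong[OF assms X] by metis
qed

lemma vfield_linear_minus: "vfield_linear G \<Longrightarrow> vfield_linear H \<Longrightarrow> vfield_linear (\<lambda>X. G X - H X)"
  using vfield_linear_plus[of G "\<lambda>X. (-1) *\<^sub>R H X"] vfield_linear_scaleR[of H "-1"] by simp

lemma vfield_linear_star:
  assumes "vfield_linear G"
  shows "vfield_linear (\<lambda>X. G X \<star> f)" "vfield_linear (\<lambda>X. f \<star> G X)"
proof -
  have *: "vfield_linear (\<lambda>X. H (G X))" if "\<And>f g. H (f + g) = H f + H g" "\<And>r f. H (r *\<^sub>R f) = r *\<^sub>R H f" for H :: "sfun \<Rightarrow> sfun"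
  proof (rule vfield_linearI)
    fix X Y :: vfield assume X: "X \<in> vfields"
    show "H (G (X + Y)) = H (G X) + H (G Y)" if "Y \<in> vfields"
      by (simp only: vfield_linear_add[OF assms X that] \<open>\<And>f g. H (f + g) = H f + H g\<close>)
    show "H (G (s *\<^sub>R X)) = s *\<^sub>R H (G X)" for s
      by (simp only: vfield_linear_scale[OF assms X] that(2))
    assume "\<And>i. i \<in> {1..p+q} \<Longrightarrow> Y i = X i"
    then show "H (G Y) = H (G X)" using vfield_linear_cong[OF assms X] by metis
  qed
  show "vfield_linear (\<lambda>X. G X \<star> f)" by (rule *[of "\<lambda>g. g \<star> f"]) (rule star_add_left star_scale_left)+
  show "vfield_linear (\<lambda>X. f \<star> G X)" by (rule *[of "\<lambda>g. f \<star> g"]) (rule star_add_right star_scale_right)+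
qed

lemma vfield_linear_fun:
  fixes F :: "vfield \<Rightarrow> 'a \<Rightarrow> 'b::real_vector"
  assumes "\<And>\<beta>. vfield_linear (\<lambda>X. F X \<beta>)"
  shows "vfield_linear F"
proof (rule vfield_linearI)
  fix X Y :: vfield assume X: "X \<in> vfields"
  show "F (X + Y) = F X + F Y" if "Y \<in> vfields"
    by (rule ext) (simp only: vfield_linear_add[OF assms X that] plus_fun_apply[of "F X"])
  show "F (s *\<^sub>R X) = s *\<^sub>R F X" for s
    by (rule ext) (simp only: vfield_linear_scale[OF assms X] scaleR_fun_def[of s "F X"])
  assume "\<And>i. i \<in> {1..p+q} \<Longrightarrow> Y i = X i"
  then show "F Y = F X" using vfield_linear_cong[OF assms X] by (intro ext) metis
qed

lemma vfield_linear_component: "i \<in> {1..p+q} \<Longrightarrow> vfield_linear (\<lambda>X. X i)"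
  by (rule vfield_linearI) (simp_all add: scaleR_fun_def[of _ "_ :: vfield"])

lemma fpart_add: "fpart a (f + g) = fpart a f + fpart a g"
  and fpart_scale: "fpart a (r *\<^sub>R f) = r *\<^sub>R fpart a f"
  by (auto simp: fpart_def fun_eq_iff scaleR_fun_def)

lemma vfield_linear_fpart_component: "i \<in> {1..p+q} \<Longrightarrow> vfield_linear (\<lambda>X. fpart c (X i))"
  by (rule vfield_linear_compose[OF vfield_linear_component]) (rule fpart_add fpart_scale | simp add: vfields_def)+

lemma vfield_linear_fpart2_component: "i \<in> {1..p+q} \<Longrightarrow> vfield_linear (\<lambda>X. fpart b (fpart c (X i)))"
  by (rule vfield_linear_compose[OF vfield_linear_fpart_component]) (rule fpart_add fpart_scale | simp add: vfields_def)+

lemma vfield_linear_jac: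
  assumes "i \<in> {1..p+q}" "j \<in> {1..p+q}"
  shows "vfield_linear (\<lambda>X. jac a (vpart a X) i j)"
  unfolding jac_def vpart_def
proof (rule vfield_linear_scaleR, rule vfield_linear_compose[OF vfield_linear_fpart_component[OF assms(2)]])
  show "fpart (a + par j) (X j) \<in> sfuns" if "X \<in> vfields" for X
    using that assms by (simp add: vfields_def)
qed (intro pderiv_add pderiv_scale assms; assumption)+

lemma vfield_linear_lie_symbol: "vfield_linear (\<lambda>X. lie_symbol d X T)"
  unfolding lie_symbol_def vf_apply_def
  by (intro vfield_linear_fun[where F = "\<lambda>X. (\<lambda>\<beta>. _ X \<beta>)"] vfield_linear_plus vfield_linear_sums vfield_linear_scaleR vfield_linear_star vfield_linear_component vfield_linear_jac)

lemma vfield_linear_lie_density: "vfield_linear (\<lambda>X. lie_density lam (vpart a X) f)"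
proof -
  have "vfield_linear (\<lambda>X. pderiv i (fpart b (fpart (a + par i) (X i))))" if i: "i \<in> {1..p+q}" for i b
  proof (rule vfield_linear_compose[OF vfield_linear_fpart2_component[OF i]])
    show "fpart b (fpart (a + par i) (X i)) \<in> sfuns" if "X \<in> vfields" for X
      using that i by (simp add: vfields_def)
  qed (intro pderiv_add pderiv_scale i; assumption)+
  then show ?thesis
    unfolding lie_density_def vf_apply_def dvg_def vpart_def
    by (intro vfield_linear_plus vfield_linear_sums vfield_linear_scaleR vfield_linear_star vfield_linear_fpart_component)
qed

lemma lie_density_in:
  assumes "X \<in> vfields" "f \<in> sfuns"
  shows "lie_density lam X f \<in> sfuns"
  unfolding lie_density_def vf_apply_def dvg_def
  using assms by (auto simp: vfields_def intro!: sfuns_add sfuns_sum sfuns_star sfuns_scale)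

lemma vpart_in: "X \<in> vfields \<Longrightarrow> vpart a X \<in> vfields"
  by (simp add: vfields_def vpart_def)

lemma opart_add:
  assumes "c \<in> symbols" "f \<in> sfuns" "g \<in> sfuns"
  shows "opart b (diff_op c) (f + g) = opart b (diff_op c) f + opart b (diff_op c) g"
  unfolding opart_def sum.distrib[symmetric]
  by (intro sum.cong refl) (simp only: fpart_add diff_op_add_arg[OF assms(1) sfuns_fpart[OF assms(2)] sfuns_fpart[OF assms(3)]])

lemma opart_scale:
  assumes "c \<in> symbols" "f \<in> sfuns"
  shows "opart b (diff_op c) (r *\<^sub>R f) = r *\<^sub>R opart b (diff_op c) f"
  unfolding opart_def scaleR_sum_right
  by (intro sum.cong refl) (simp only: fpart_scale diff_op_scale_arg[OF assms(1) sfuns_fpart[OF assms(2)]])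

lemma vfield_linear_lie_op:
  assumes "c \<in> symbols"
  shows "vfield_linear (\<lambda>X. lie_op lam mu X (diff_op c))"
proof (rule vfield_linear_fun)
  fix f
  show "vfield_linear (\<lambda>X. lie_op lam mu X (diff_op c) f)"
  proof (cases "f \<in> sfuns")
    case True
    have "vfield_linear (\<lambda>X. opart b (diff_op c) (lie_density lam (vpart a X) f))" for a b
      by (rule vfield_linear_compose[OF vfield_linear_lie_density])
        (intro lie_density_in vpart_in opart_add[OF assms] opart_scale[OF assms] True; assumption)+
    then show ?thesis
      unfolding lie_op_def if_P[OF True]
      by (intro vfield_linear_sums vfield_linear_minus vfield_linear_scaleR vfield_linear_lie_density)
  next
    case False
    show ?thesis unfolding lie_op_def if_not_P[OF False] by (simp add: vfield_linear_def)
  qed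
qed

section \<open>Generators: fields along one coordinate, and coordinates times the Euler
  field\<close>

definition single :: "nat \<Rightarrow> sfun \<Rightarrow> vfield" where
  "single l g = (\<lambda>i. if i = l then g else 0)"

definition quad :: "nat \<Rightarrow> vfield" where
  "quad k = (\<lambda>i. coord k \<star> coord i)"

lemma single_in: "g \<in> sfuns \<Longrightarrow> single l g \<in> vfields"
  by (simp add: vfields_def single_def)

lemma quad_in: "k \<in> {1..p+q} \<Longrightarrow> quad k \<in> vfields"
  by (simp add: vfields_def quad_def)

lemma sum_single:
  assumes "i \<in> {1..p+q}"
  shows "(\<Sum>l\<in>{1..p+q}. r l *\<^sub>R single l (g l)) i = r i *\<^sub>R g i"
proof -
  have "(\<Sum>l\<in>{1..p+q}. r l *\<^sub>R single l (g l)) i = (\<Sum>l\<in>{1..p+q}. if l = i then r i *\<^sub>R g i else 0)"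
    unfolding sum_fun_apply[where x = i]
    by (intro sum.cong refl) (auto simp: scaleR_fun_apply[where \<alpha> = i] single_def)
  then show ?thesis using assms by simp
qed

lemma vfield_linear_vf_pgl:
  assumes "vfield_linear F"
  shows "F (vf_pgl M) = (\<Sum>l\<in>{1..p+q}. (- M l 0) *\<^sub>R F (single l one)) +
    (\<Sum>k\<in>{1..p+q}. \<Sum>l\<in>{1..p+q}. (- ((-1) ^ (par k * (par l + par k)) * (M l k - (if l = k then M 0 0 else 0)))) *\<^sub>R F (single l (coord k))) +
    (\<Sum>k\<in>{1..p+q}. (M 0 k * (-1) ^ par k) *\<^sub>R F (quad k))"
proof -
  let ?r = "\<lambda>k l. - ((-1) ^ (par k * (par l + par k)) * (M l k - (if l = k then M 0 0 else 0)))"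
  let ?X = "\<Sum>l\<in>{1..p+q}. (- M l 0) *\<^sub>R single l one"
  let ?Y = "\<lambda>k. \<Sum>l\<in>{1..p+q}. ?r k l *\<^sub>R single l (coord k)"
  let ?Z = "\<Sum>k\<in>{1..p+q}. (M 0 k * (-1) ^ par k) *\<^sub>R quad k"
  have Y1: "(\<Sum>k\<in>{1..p+q}. ?Y k) = (\<Sum>k\<in>{1..p+q}. 1 *\<^sub>R ?Y k)" by simp
  have in_X: "?X \<in> vfields" by (intro vfields_sum vfields_scale single_in sfuns_one)
  have in_Y: "?Y k \<in> vfields" if "k \<in> {1..p+q}" for k
    using that by (intro vfields_sum vfields_scale single_in sfuns_coord)
  have in_Z: "?Z \<in> vfields" by (intro vfields_sum vfields_scale quad_in)
  have in_Y': "(\<Sum>k\<in>{1..p+q}. ?Y k) \<in> vfields" by (rule vfields_sum[OF in_Y])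
  have "F (vf_pgl M) = F (?X + (\<Sum>k\<in>{1..p+q}. ?Y k) + ?Z)"
  proof (rule vfield_linear_cong[OF assms vfields_add[OF vfields_add[OF in_X in_Y'] in_Z]])
    fix i assume i: "i \<in> {1..p+q}"
    have 1: "vf_minus1 (\<lambda>i. M i 0) i = ?X i"
      unfolding sum_single[OF i] by (simp add: vf_minus1_def one_def)
    have 2: "vf_zero (\<lambda>i j. M i j - (if i = j then M 0 0 else 0)) i = (\<Sum>k\<in>{1..p+q}. ?Y k) i"
      unfolding vf_zero_def
    proof -
      have "(\<Sum>k\<in>{1..p+q}. ?Y k) i = (\<Sum>k\<in>{1..p+q}. ?Y k i)" by (rule sum_fun_apply)
      also have "\<dots> = (\<Sum>k\<in>{1..p+q}. ?r k i *\<^sub>R coord k)" by (simp only: sum_single[OF i])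
      also have "\<dots> = - (\<Sum>j\<in>{1..p+q}. ((-1) ^ (par j * (par i + par j)) * (M i j - (if i = j then M 0 0 else 0))) *\<^sub>R coord j)"
        by (simp only: scaleR_minus_left sum_negf)
      finally show "- (\<Sum>j\<in>{1..p+q}. ((-1) ^ (par j * (par i + par j)) * (M i j - (if i = j then M 0 0 else 0))) *\<^sub>R coord j) =
        (\<Sum>k\<in>{1..p+q}. ?Y k) i" ..
    qed
    have 3: "vf_plus1 (\<lambda>j. M 0 j) i = ?Z i"
      unfolding vf_plus1_def sum_fun_apply[where x = i] by (intro sum.cong refl) (simp only: scaleR_fun_apply[where \<alpha> = i] quad_def)
    show "vf_pgl M i = (?X + (\<Sum>k\<in>{1..p+q}. ?Y k) + ?Z) i"
      unfolding vf_pgl_def plus_fun_apply[of _ _ i] 1 2 3 ..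
  qed
  also have "\<dots> = F ?X + F (\<Sum>k\<in>{1..p+q}. ?Y k) + F ?Z"
    unfolding vfield_linear_add[OF assms vfields_add[OF in_X in_Y'] in_Z] vfield_linear_add[OF assms in_X in_Y'] ..
  also have "F ?X = (\<Sum>l\<in>{1..p+q}. (- M l 0) *\<^sub>R F (single l one))"
    by (rule vfield_linear_setsum[OF assms]) (rule single_in[OF sfuns_one])
  also have "F (\<Sum>k\<in>{1..p+q}. ?Y k) = (\<Sum>k\<in>{1..p+q}. F (?Y k))"
    unfolding Y1 by (subst vfield_linear_setsum[OF assms in_Y]) simp_all
  also have "\<dots> = (\<Sum>k\<in>{1..p+q}. \<Sum>l\<in>{1..p+q}. ?r k l *\<^sub>R F (single l (coord k)))"
    by (intro sum.cong refl vfield_linear_setsum[OF assms] single_in sfuns_coord)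
  also have "F ?Z = (\<Sum>k\<in>{1..p+q}. (M 0 k * (-1) ^ par k) *\<^sub>R F (quad k))"
    by (rule vfield_linear_setsum[OF assms]) (rule quad_in)
  finally show ?thesis .
qed

text \<open>This lemma and the next two realize each generator by a matrix with one nonzero entry,
  so that equivariance for all matrices yields equivariance for each generator. The entries undo the
  signs in the definition of the realization.\<close>

lemma vfield_linear_pgl_const: "H (vf_pgl (\<lambda>r c. if r = l \<and> c = 0 then - 1 else 0)) = H (single l one)"
  if "vfield_linear H" "l \<in> {1..p+q}"
proof -
  have "l \<noteq> 0" using that by simp
  have 0: "(\<Sum>i\<in>{1..p+q}. (- (if i = l \<and> (0::nat) = 0 then - 1 else 0)) *\<^sub>R H (single i one)) =
      (\<Sum>i\<in>{1..p+q}. if i = l then H (single l one) else 0)"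
    by (intro sum.cong) auto
  show ?thesis
    unfolding vfield_linear_vf_pgl[OF that(1)] 0 using that \<open>l \<noteq> 0\<close>
    by (simp add: sum.neutral)
qed

lemma vfield_linear_pgl_linear: "H (vf_pgl (\<lambda>r c. if r = l \<and> c = k then - ((-1) ^ (par k * (par l + par k))) else 0)) = H (single l (coord k))"
  if "vfield_linear H" "l \<in> {1..p+q}" "k \<in> {1..p+q}"
proof -
  have "l \<noteq> 0" "k \<noteq> 0" using that by auto
  have "(- ((-1) ^ (par k' * (par l' + par k')) * ((if l' = l \<and> k' = k then - ((-1) ^ (par k * (par l + par k))) else 0) - (if l' = k' then (if 0 = l \<and> 0 = k then - ((-1) ^ (par k * (par l + par k))) else 0) else 0)))) *\<^sub>R H (single l' (coord k')) =
     (if l' = l then if k' = k then H (single l (coord k)) else 0 else 0)" for k' l'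
    using \<open>l \<noteq> 0\<close> by (auto simp flip: power_mult_distrib)
  then show ?thesis
    unfolding vfield_linear_vf_pgl[OF that(1)] using that \<open>l \<noteq> 0\<close> \<open>k \<noteq> 0\<close>
    by (simp add: sum.neutral)
qed

lemma vfield_linear_pgl_quad: "H (vf_pgl (\<lambda>r c. if r = 0 \<and> c = k then (-1) ^ par k else 0)) = H (quad k)"
  if "vfield_linear H" "k \<in> {1..p+q}"
proof -
  have "k \<noteq> 0" using that by auto
  have 0: "(\<Sum>i\<in>{1..p+q}. ((if (0::nat) = 0 \<and> i = k then (-1) ^ par k else 0) * (-1) ^ par i) *\<^sub>R H (quad i)) =
      (\<Sum>i\<in>{1..p+q}. if i = k then H (quad k) else 0)"
    by (intro sum.cong) (auto simp flip: power_mult_distrib)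
  show ?thesis
    unfolding vfield_linear_vf_pgl[OF that(1)] 0 using that \<open>k \<noteq> 0\<close>
    by (simp add: sum.neutral)
qed

declare plus_fun_apply [simp del] zero_fun_apply [simp del] minus_apply [simp del] uminus_apply [simp del]

subsection \<open>The actions of the projective superalgebra\<close>

lemma coord_parity: "odd (card J + par k) \<Longrightarrow> coord k J = 0"
  by (auto simp: coord_def par_def fun_eq_iff zero_fun_apply)

lemma one_parity: "odd (card J) \<Longrightarrow> one J = 0"
  by (auto simp: one_def fun_eq_iff zero_fun_apply)

lemma star_parity:
  assumes "\<And>J. odd (card J + a) \<Longrightarrow> f J = 0" "\<And>J. odd (card J + b) \<Longrightarrow> g J = 0" "odd (card K + (a + b))"
  shows "(f \<star> g) K = 0"
proof (rule ext)
  fix x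
  have "f I x * g (K - I) x = 0" if "I \<in> Pow K" "finite K" for I
  proof -
    have "card K = card I + card (K - I)"
      using that by (simp add: card_Diff_subset finite_subset card_mono)
    then have "odd (card I + a) \<or> odd (card (K - I) + b)" using assms(3) by presburger
    then have "f I = 0 \<or> g (K - I) = 0" using assms(1,2) by blast
    then show ?thesis by (auto simp: zero_fun_apply)
  qed
  then have "(\<Sum>I\<in>Pow K. (-1) ^ inversions I (K - I) * f I x * g (K - I) x) = 0"
    by (cases "finite K") (simp_all add: mult.assoc sum.neutral)
  then show "(f \<star> g) K x = 0 x" by (simp add: sfun_mult_def zero_fun_apply)
qed

lemma homogeneous_single:
  assumes "g \<in> sfuns" "\<And>J. odd (card J + (a + par l)) \<Longrightarrow> g J = 0"
  shows "homogeneous a (single l g)"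
  using assms by (auto simp: homogeneous_def single_def zero_fun_apply add.assoc)

lemma homogeneous_single_one: "homogeneous (par l) (single l one)"
  by (rule homogeneous_single) (auto intro: one_parity simp flip: mult_2)

lemma homogeneous_single_coord:
  assumes "k \<in> {1..p+q}"
  shows "homogeneous ((par k + par l) mod 2) (single l (coord k))"
proof (rule homogeneous_single[OF sfuns_coord[OF assms]])
  fix J :: "nat set" assume "odd (card J + ((par k + par l) mod 2 + par l))"
  then have "odd (card J + par k)" by presburger
  then show "coord k J = 0" by (rule coord_parity)
qed

lemma homogeneous_quad:
  assumes "k \<in> {1..p+q}"
  shows "homogeneous (par k) (quad k)"
  unfolding homogeneous_def quad_def
proof (intro ballI conjI allI impI)
  fix i assume "i \<in> {1..p+q}"
  then show "coord k \<star> coord i \<in> sfuns" using assms by (intro sfuns_star sfuns_coord)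
  show "(coord k \<star> coord i) J = 0" if "odd (card J + par k + par i)" for J
    by (rule star_parity[of "par k" _ "par i"]) (use that coord_parity in \<open>simp_all add: add.assoc\<close>)
qed

lemma par_less_2: "par k < 2"
  by (simp add: par_def)

lemma pm_sq: "(-1 :: real) ^ n * (-1) ^ n = 1"
  by (simp flip: power_mult_distrib)

lemma ss_par: "SW.ss i i = (-1) ^ par i"
  by (simp add: SW.ss_def par_def)

lemma vf_apply_single:
  assumes "l \<in> {1..p+q}"
  shows "vf_apply (single l g) f = g \<star> pderiv l f"
proof -
  have "vf_apply (single l g) f = (\<Sum>i\<in>{1..p+q}. if i = l then g \<star> pderiv l f else 0)"
    unfolding vf_apply_def by (intro sum.cong) (simp_all add: single_def)
  then show ?thesis using assms by simp
qed

lemma lie_symbol_const: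
  assumes "T \<in> symbols" "l \<in> {1..p+q}"
  shows "lie_symbol d (single l one) T = dop l T"
proof (rule symbol_ext)
  fix \<beta>
  have "pderiv i (single l one j) = 0" for i j by (simp add: single_def)
  then show "lie_symbol d (single l one) T \<beta> = dop l T \<beta>"
    using sfuns_pderiv[OF symbols_in[OF assms(1)] assms(2)]
    by (simp add: lie_symbol_homogeneous[OF homogeneous_single_one par_less_2 assms(1)]
        vf_apply_single[OF assms(2)] one_star dop_def)
qed

lemma lie_symbol_linear:
  assumes "T \<in> symbols" "k \<in> {1..p+q}" "l \<in> {1..p+q}"
  shows "lie_symbol d (single l (coord k)) T = SW.G d k l T"
proof (rule symbol_ext)
  fix \<beta>
  let ?a = "(par k + par l) mod 2"
  let ?W = "\<lambda>i j. eop j (cop i T) \<beta> - (if i = j then (d * (-1) ^ par i) *\<^sub>R T \<beta> else 0)"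
  have eop_in: "eop l (cop k T) \<beta> \<in> sfuns"
    by (intro symbols_in SW.e_in SW.c_in assms)
  have T_in: "T \<beta> \<in> sfuns" by (rule symbols_in[OF assms(1)])
  have W_in: "?W k l \<in> sfuns"
  proof -
    have "?W k l = eop l (cop k T) \<beta> + (- 1) *\<^sub>R (if k = l then (d * (-1) ^ par k) *\<^sub>R T \<beta> else 0)" by simp
    moreover have "\<dots> \<in> sfuns" using eop_in T_in by (intro sfuns_add sfuns_scale) auto
    ultimately show ?thesis by simp
  qed
  have "(-1) ^ (par i * ?a + 1) *\<^sub>R (pderiv i (single l (coord k) j) \<star> ?W i j) =
      (if j = l then if i = k then (-1) ^ (par k * ?a + 1) *\<^sub>R ?W k l else 0 else 0)"
    for i j using one_star(1)[OF W_in] by (auto simp: single_def pderiv_coord)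
  then have "lie_symbol d (single l (coord k)) T \<beta> = coord k \<star> pderiv l (T \<beta>) + (-1) ^ (par k * ?a + 1) *\<^sub>R ?W k l"
    using assms
    by (simp add: lie_symbol_homogeneous[OF homogeneous_single_coord[OF assms(2)] _ assms(1)] vf_apply_single[OF assms(3)])
  moreover have "(-1) ^ (par k * ?a + 1) = - (SW.ss k k * SW.ss k l)"
    by (auto simp: SW.ss_def par_def)
  moreover have "k = l \<Longrightarrow> SW.ss k k * SW.ss k l = 1" by simp
  ultimately show "lie_symbol d (single l (coord k)) T \<beta> = SW.G d k l T \<beta>"
    by (auto simp: SW.G_def mop_def dop_def plus_fun_apply[where x = \<beta>] minus_apply[where x = \<beta>] scaleR_fun_apply[where \<alpha> = \<beta>] zero_fun_apply[where x = \<beta>] ss_par algebra_simps)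
qed

lemma pderiv_coord_coord:
  assumes "i \<in> {1..p+q}" "k \<in> {1..p+q}" "j \<in> {1..p+q}"
  shows "pderiv i (coord k \<star> coord j) =
    (if i = k then coord j else 0) + (-1) ^ (par i * par k) *\<^sub>R (if i = j then coord k else 0)"
  using assms by (simp add: pderiv_star pderiv_coord tau_coord one_star)

text \<open>The derivative \<partial>_i of y^k y^j has two parts. The part at i = k assembles to Y
  c_k, the part at i = j to the degree operator K; their density terms contribute 1 and
  \<open>sdim\<close>, whence the factor \<open>sdim + 1\<close> in \<open>L\<close>.\<close>

lemma lie_symbol_quad:
  assumes "T \<in> symbols" "k \<in> {1..p+q}"
  shows "lie_symbol d (quad k) T = SW.L d k T"
proof (rule symbol_ext)
  fix \<beta>
  let ?I = "{1..p+q}"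
  let ?W = "\<lambda>i j. eop j (cop i T) \<beta> - (if i = j then (d * (-1) ^ par i) *\<^sub>R T \<beta> else 0)"
  have "(-1) ^ (par i * par k + 1) *\<^sub>R (pderiv i (quad k j) \<star> ?W i j) =
      (if i = k then - ((-1) ^ par k *\<^sub>R (coord j \<star> ?W k j)) else 0) + (if i = j then - (coord k \<star> ?W j j) else 0)"
    if "i \<in> ?I" "j \<in> ?I" for i j
  proof -
    have "(-1) ^ (par i * par k + 1) *\<^sub>R (pderiv i (quad k j) \<star> ?W i j) =
      (-1) ^ (par i * par k + 1) *\<^sub>R ((if i = k then coord j else 0) \<star> ?W i j) +
      ((-1) ^ (par i * par k + 1) * (-1) ^ (par i * par k)) *\<^sub>R ((if i = j then coord k else 0) \<star> ?W i j)"
      unfolding quad_def pderiv_coord_coord[OF that(1) assms(2) that(2)]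
      by (simp only: star_add_left star_scale_left scaleR_add_right scaleR_scaleR)
    also have "(-1 :: real) ^ (par i * par k + 1) * (-1) ^ (par i * par k) = -1"
      by (simp add: pm_sq)
    also have "(-1) ^ (par i * par k + 1) *\<^sub>R ((if i = k then coord j else 0) \<star> ?W i j) =
        (if i = k then - ((-1) ^ par k *\<^sub>R (coord j \<star> ?W k j)) else 0)"
      by (simp add: par_def)
    also have "(-1) *\<^sub>R ((if i = j then coord k else 0) \<star> ?W i j) = (if i = j then - (coord k \<star> ?W j j) else 0)"
      by simp
    finally show ?thesis .
  qed
  then have "(\<Sum>i\<in>?I. \<Sum>j\<in>?I. (-1) ^ (par i * par k + 1) *\<^sub>R (pderiv i (quad k j) \<star> ?W i j)) =
      (\<Sum>i\<in>?I. \<Sum>j\<in>?I. (if i = k then - ((-1) ^ par k *\<^sub>R (coord j \<star> ?W k j)) else 0) + (if i = j then - (coord k \<star> ?W j j) else 0))"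
    by (intro sum.cong refl)
  also have "\<dots> = (\<Sum>j\<in>?I. \<Sum>i\<in>?I. (if i = k then - ((-1) ^ par k *\<^sub>R (coord j \<star> ?W k j)) else 0)) +
      (\<Sum>i\<in>?I. \<Sum>j\<in>?I. (if i = j then - (coord k \<star> ?W j j) else 0))"
    unfolding sum.distrib by (subst sum.swap) (rule refl)
  also have "(\<Sum>j\<in>?I. \<Sum>i\<in>?I. (if i = k then - ((-1) ^ par k *\<^sub>R (coord j \<star> ?W k j)) else 0)) =
      - ((-1) ^ par k *\<^sub>R (\<Sum>j\<in>?I. coord j \<star> ?W k j))"
    using assms(2) by (simp add: sum_negf scaleR_sum_right)
  also have "(\<Sum>i\<in>?I. \<Sum>j\<in>?I. (if i = j then - (coord k \<star> ?W j j) else 0)) = - (\<Sum>j\<in>?I. coord k \<star> ?W j j)"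
    unfolding sum_negf[symmetric] by (intro sum.cong refl) simp
  also have "(\<Sum>j\<in>?I. coord j \<star> ?W k j) = SW.Y (cop k T) \<beta> - (d * (-1) ^ par k) *\<^sub>R mop k T \<beta>"
  proof -
    have "(\<Sum>j\<in>?I. coord j \<star> ?W k j) =
        (\<Sum>j\<in>?I. mop j (eop j (cop k T)) \<beta> + (if j = k then - ((d * (-1) ^ par k) *\<^sub>R mop k T \<beta>) else 0))"
      unfolding mop_def
      by (intro sum.cong refl) (use star_add_right[of _ _ "- ((d * (-1) ^ par k) *\<^sub>R T \<beta>)"] in auto)
    also have "\<dots> = (\<Sum>j\<in>?I. mop j (eop j (cop k T)) \<beta>) - (d * (-1) ^ par k) *\<^sub>R mop k T \<beta>"
      using assms(2) by (simp add: sum.distrib)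
    finally show ?thesis unfolding SW.Y_def sum_fun_apply[where x = \<beta>] .
  qed
  also have "(\<Sum>j\<in>?I. coord k \<star> ?W j j) = mop k (SW.K T) \<beta> - (d * SW.sdim) *\<^sub>R mop k T \<beta>"
  proof -
    have "(\<Sum>j\<in>?I. coord k \<star> ?W j j) = (\<Sum>j\<in>?I. coord k \<star> eop j (cop j T) \<beta> - (d * (-1) ^ par j) *\<^sub>R mop k T \<beta>)"
      unfolding mop_def
      by (intro sum.cong refl) (use star_add_right[of "coord k" _ "- ((d * (-1) ^ par _) *\<^sub>R T \<beta>)"] in simp)
    also have "\<dots> = coord k \<star> (\<Sum>j\<in>?I. eop j (cop j T) \<beta>) - (\<Sum>j\<in>?I. d * (-1) ^ par j) *\<^sub>R mop k T \<beta>"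
      by (simp add: sum_subtractf star_sum_right scaleR_sum_left)
    finally show ?thesis
      unfolding SW.K_def sum_fun_apply[where x = \<beta>] SW.sdim_def ss_par mop_def[of k "\<Sum>i\<in>?I. eop i (cop i T)"] sum_distrib_left .
  qed
  finally have S: "(\<Sum>i\<in>?I. \<Sum>j\<in>?I. (-1) ^ (par i * par k + 1) *\<^sub>R (pderiv i (quad k j) \<star> ?W i j)) =
      - ((-1) ^ par k *\<^sub>R (SW.Y (cop k T) \<beta> - (d * (-1) ^ par k) *\<^sub>R mop k T \<beta>)) +
      - (mop k (SW.K T) \<beta> - (d * SW.sdim) *\<^sub>R mop k T \<beta>)" .
  have E: "vf_apply (quad k) (T \<beta>) = mop k (SW.E T) \<beta>"
    unfolding vf_apply_def quad_def star_assoc star_sum_right[symmetric] SW.E_def mop_def dop_def sum_fun_apply[where x = \<beta>] ..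
  have "(-1) ^ par k *\<^sub>R ((d * (-1) ^ par k) *\<^sub>R mop k T \<beta>) = d *\<^sub>R mop k T \<beta>"
    by (simp add: pm_sq)
  then show "lie_symbol d (quad k) T \<beta> = SW.L d k T \<beta>"
    unfolding lie_symbol_homogeneous[OF homogeneous_quad[OF assms(2)] par_less_2 assms(1)] S E
    by (simp only: SW.L_def plus_fun_apply[where x = \<beta>] minus_apply[where x = \<beta>] scaleR_fun_apply[where \<alpha> = \<beta>] ss_par
        scaleR_diff_right distrib_left mult_1_right scaleR_left_distrib) (simp add: algebra_simps)
qed

lemma lie_density_cong:
  assumes "\<And>i. i \<in> {1..p+q} \<Longrightarrow> X i = Y i"
  shows "lie_density lam X f = lie_density lam Y f"
proof -
  have "vf_apply X f = vf_apply Y f" "dvg X = dvg Y"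
    unfolding vf_apply_def dvg_def using assms by (auto intro!: sum.cong)
  then show ?thesis by (simp add: lie_density_def)
qed

lemma fpart_0 [simp]: "fpart b 0 = 0"
  by (rule ext) (simp add: fpart_def zero_fun_apply)

lemma lie_density_0: "lie_density lam (\<lambda>i. 0) f = 0"
  by (simp add: lie_density_def vf_apply_def dvg_def)

lemma vpart_homogeneous:
  assumes "homogeneous a X" "a < 2" "b < 2"
  shows "lie_density lam (vpart b X) f = (if b = a then lie_density lam X f else 0)"
proof (cases "b = a")
  case True
  show ?thesis unfolding if_P[OF True]
    by (rule lie_density_cong) (simp add: vpart_def True homogeneous_fpart[OF assms(1)])
next
  case False
  then have "odd (a + b)" using assms(2,3) by (auto simp: less_2_cases_iff)
  then have "lie_density lam (vpart b X) f = lie_density lam (\<lambda>i. 0) f"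
    by (intro lie_density_cong) (simp add: vpart_def homogeneous_fpart[OF assms(1)])
  then show ?thesis using False by (simp add: lie_density_0)
qed

lemma fpart_sum: "(\<Sum>b<2. fpart (b + c) f) = f"
  by (rule ext) (auto simp: sum_less_2 fpart_def plus_fun_apply)

lemma fpart_sum': "(\<Sum>b<2. fpart b f) = f"
  using fpart_sum[of 0 f] by simp

lemma opart_sum:
  assumes "c \<in> symbols" "f \<in> sfuns"
  shows "(\<Sum>b<2. opart b (diff_op c) f) = diff_op c f"
proof -
  have "(\<Sum>b<2. opart b (diff_op c) f) = (\<Sum>a<2. \<Sum>b<2. fpart (b + a) (diff_op c (fpart a f)))"
    unfolding opart_def by (rule sum.swap)
  also have "\<dots> = diff_op c (\<Sum>a<2. fpart a f)"
    unfolding fpart_sum by (rule diff_op_sum_arg[symmetric]) (use assms in auto)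
  finally show ?thesis by (simp only: fpart_sum')
qed

text \<open>The sign (-1) ^ (parity of field times parity of operator), summed over the parts of the
  operator, is conjugation by an involution. The parity of the field is encoded by two indices k and
  l because that of y^k \<partial>_l is a sum; index 0 fills a free slot as an even one.\<close>

lemma opart_signed_sum:
  assumes "c \<in> symbols" "f \<in> sfuns" "even (a + par k + par l)"
  shows "(\<Sum>b<2. (-1) ^ (a * b) *\<^sub>R opart b (diff_op c) f) = diff_op (hat k (hat l c)) f"
proof -
  let ?s = "par k + par l"
  have tsum: "tau j (\<Sum>a\<in>A. g a) = (\<Sum>a\<in>A. tau j (g a))" for A :: "nat set" and g j
    using sum_comp_morphism[where h = "tau j" and g = g and A = A, OF tau_0 tau_add]
    unfolding comp_def by (rule sym)
  have 1: "(\<Sum>b<2. (-1) ^ (a * b) *\<^sub>R fpart (b + c) h) = (-1) ^ (c * ?s) *\<^sub>R tau k (tau l h)" for c h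
  proof (rule ext)
    fix I
    have "even a \<longleftrightarrow> even ?s" using assms(3) by presburger
    then show "(\<Sum>b<2. (-1) ^ (a * b) *\<^sub>R fpart (b + c) h) I = ((-1) ^ (c * ?s) *\<^sub>R tau k (tau l h)) I"
      by (simp only: sum_less_2 fpart_def tau_def plus_fun_apply[where x = I] scaleR_fun_apply[where \<alpha> = I])
        (auto simp: minus_one_power_iff)
  qed
  have "(\<Sum>b<2. (-1) ^ (a * b) *\<^sub>R opart b (diff_op c) f) =
      (\<Sum>e<2. \<Sum>b<2. (-1) ^ (a * b) *\<^sub>R fpart (b + e) (diff_op c (fpart e f)))"
    unfolding opart_def scaleR_sum_right by (rule sum.swap)
  also have "\<dots> = (\<Sum>e<2. tau k (tau l (diff_op c ((-1) ^ (e * ?s) *\<^sub>R fpart e f))))"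
    unfolding 1 by (simp only: diff_op_scale_arg[OF assms(1) sfuns_fpart[OF assms(2)]] tau_scale)
  also have "\<dots> = tau k (tau l (diff_op c (\<Sum>e<2. (-1) ^ (e * ?s) *\<^sub>R fpart e f)))"
    unfolding tsum[symmetric] by (subst diff_op_sum_arg) (use assms in auto)
  also have "\<dots> = tau k (tau l (diff_op c (tau k (tau l f))))"
    unfolding tau_fpart ..
  also have "\<dots> = diff_op (hat k (hat l c)) (tau k (tau l (tau k (tau l f))))"
    by (simp only: tau_diff_op[OF assms(1)] tau_diff_op[OF hat_symbols[OF assms(1)]] sfuns_tau assms(2))
  also have "tau k (tau l (tau k (tau l f))) = f"
    by (simp only: tau_commute[of l k] tau_tau)
  finally show ?thesis .
qed

lemma lie_density_add:
  assumes "f \<in> sfuns" "g \<in> sfuns"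
  shows "lie_density lam X (f + g) = lie_density lam X f + lie_density lam X g"
proof -
  have "vf_apply X (f + g) = vf_apply X f + vf_apply X g"
    unfolding vf_apply_def sum.distrib[symmetric]
    by (intro sum.cong refl) (simp only: pderiv_add assms star_add_right)
  then show ?thesis by (simp add: lie_density_def star_add_right scaleR_add_right)
qed

text \<open>The supercommutator with a homogeneous field becomes a plain difference in which
  \<open>hat\<close> carries the sign, so the operator may be inhomogeneous.\<close>

lemma lie_op_homogeneous:
  assumes "homogeneous a X" "a < 2" "even (a + par k + par l)" "c \<in> symbols" "f \<in> sfuns"
  shows "lie_op lam mu X (diff_op c) f =
    lie_density mu X (diff_op c f) - diff_op (hat k (hat l c)) (lie_density lam X f)"
proof -
  have X: "X \<in> vfields" using assms(1) by (simp add: homogeneous_def vfields_def)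
  have o0: "opart b (diff_op c) 0 = 0" for b
    using opart_scale[OF assms(4) sfuns_0, of b 0] by simp
  have o_in: "opart b (diff_op c) f \<in> sfuns" for b
    unfolding opart_def by (intro sfuns_sum sfuns_fpart diff_op_in assms)
  let ?t = "\<lambda>b. lie_density mu X (opart b (diff_op c) f) - (-1) ^ (a * b) *\<^sub>R opart b (diff_op c) (lie_density lam X f)"
  have "lie_op lam mu X (diff_op c) f = (\<Sum>e<2. if e = a then \<Sum>b<2. ?t b else 0)"
    unfolding lie_op_def if_P[OF assms(5)]
  proof (rule sum.cong)
    fix e :: nat assume e: "e \<in> {..<2}"
    then have v: "lie_density lm (vpart e X) g = (if e = a then lie_density lm X g else 0)" for lm g
      using vpart_homogeneous[OF assms(1,2)] by simp
    show "(\<Sum>b<2. lie_density mu (vpart e X) (opart b (diff_op c) f) -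
        (-1) ^ (e * b) *\<^sub>R opart b (diff_op c) (lie_density lam (vpart e X) f)) = (if e = a then \<Sum>b<2. ?t b else 0)"
      unfolding v by (cases "e = a") (simp_all add: o0)
  qed simp
  also have "\<dots> = (\<Sum>b<2. lie_density mu X (opart b (diff_op c) f)) -
      (\<Sum>b<2. (-1) ^ (a * b) *\<^sub>R opart b (diff_op c) (lie_density lam X f))"
    using assms(2) by (simp add: sum_subtractf)
  also have "(\<Sum>b<2. lie_density mu X (opart b (diff_op c) f)) = lie_density mu X (diff_op c f)"
    unfolding opart_sum[OF assms(4,5), symmetric] sum_less_2 by (rule lie_density_add[OF o_in o_in, symmetric])
  finally show ?thesis
    unfolding opart_signed_sum[OF assms(4) lie_density_in[OF X assms(5)] assms(3)] .
qed

declare One_nat_def [simp del]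

lemma tau_index_0 [simp]: "tau 0 f = f"
  by (rule ext) (simp add: tau_def par_def)

lemma hat_0 [simp]: "hat 0 c = c"
  by (rule symbol_ext) (simp add: hat_def par_def)

lemma dvg_eq:
  assumes "X \<in> vfields"
  shows "dvg X = (\<Sum>i\<in>{1..p+q}. pderiv i (tau i (X i)))"
  unfolding dvg_def
proof (intro sum.cong refl)
  fix i assume i: "i \<in> {1..p+q}"
  then have Xi: "X i \<in> sfuns" using assms by (simp add: vfields_def)
  have "tau i (X i) = (\<Sum>a<2. (-1) ^ (par i * a) *\<^sub>R fpart a (X i))"
    using tau_fpart[of i 0 "X i"] by (simp add: par_def[of 0] mult.commute)
  then show "(\<Sum>a<2. (-1) ^ (par i * a) *\<^sub>R pderiv i (fpart a (X i))) = pderiv i (tau i (X i))"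
    using i Xi by (simp only: pderiv_sum sfuns_scale sfuns_fpart pderiv_scale)
qed

lemma lie_density_const:
  assumes "f \<in> sfuns" "l \<in> {1..p+q}"
  shows "lie_density lam (single l one) f = pderiv l f"
proof -
  have "pderiv i (tau i (single l one i)) = 0" for i by (simp add: single_def)
  then have "dvg (single l one) = 0" by (simp add: dvg_eq[OF single_in[OF sfuns_one]])
  then show ?thesis
    using assms by (simp add: lie_density_def vf_apply_single one_star)
qed

lemma lie_density_linear:
  assumes "f \<in> sfuns" "k \<in> {1..p+q}" "l \<in> {1..p+q}"
  shows "lie_density lam (single l (coord k)) f =
    coord k \<star> pderiv l f + (if k = l then (lam * (-1) ^ par k) *\<^sub>R f else 0)"
proof -
  have "pderiv i (tau i (single l (coord k) i)) = (if i = l then if k = l then (-1) ^ par k *\<^sub>R one else 0 else 0)"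
    if "i \<in> {1..p+q}" for i
    using that assms by (auto simp: single_def tau_coord pderiv_scale pderiv_coord par_def)
  then have "dvg (single l (coord k)) = (\<Sum>i\<in>{1..p+q}. (if i = l then if k = l then (-1) ^ par k *\<^sub>R one else 0 else 0))"
    unfolding dvg_eq[OF single_in[OF sfuns_coord[OF assms(2)]]] by (intro sum.cong refl)
  then have "dvg (single l (coord k)) = (if k = l then (-1) ^ par k *\<^sub>R one else 0)"
    using assms(3) by simp
  then show ?thesis
    using assms by (simp add: lie_density_def vf_apply_single one_star)
qed

text \<open>The divergence of y^k times the Euler field is (sdim + 1) y^k: the Euler field itself
  has divergence \<open>sdim\<close>, and its action on y^k adds 1.\<close>

lemma lie_density_quad:
  assumes "f \<in> sfuns" "k \<in> {1..p+q}"
  shows "lie_density lam (quad k) f =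
    coord k \<star> ((\<Sum>l\<in>{1..p+q}. coord l \<star> pderiv l f) + (lam * (SW.sdim + 1)) *\<^sub>R f)"
proof -
  have "pderiv i (tau i (quad k i)) = (if i = k then coord k else 0) + (-1) ^ par i *\<^sub>R coord k"
    if "i \<in> {1..p+q}" for i
  proof -
    have kk: "coord k \<star> coord i \<in> sfuns" using that assms by blast
    have "pderiv i (tau i (quad k i)) = ((-1) ^ (par i * par k) * (-1) ^ par i) *\<^sub>R
        ((if i = k then coord i else 0) + (-1) ^ (par i * par k) *\<^sub>R coord k)"
      using that assms pderiv_scale[OF kk that] pderiv_coord_coord[OF that assms(2) that]
      by (simp add: quad_def tau_star tau_coord par_def[of i])
    also have "\<dots> = (if i = k then coord k else 0) + (-1) ^ par i *\<^sub>R coord k"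
      by (auto simp: par_def scaleR_add_right)
    finally show ?thesis .
  qed
  then have "dvg (quad k) = (\<Sum>i\<in>{1..p+q}. (if i = k then coord k else 0) + (-1) ^ par i *\<^sub>R coord k)"
    unfolding dvg_eq[OF quad_in[OF assms(2)]] by (intro sum.cong refl)
  also have "\<dots> = coord k + SW.sdim *\<^sub>R coord k"
    using assms(2) by (simp add: sum.distrib SW.sdim_def ss_par scaleR_sum_left)
  finally have D: "dvg (quad k) = coord k + SW.sdim *\<^sub>R coord k" .
  have V: "vf_apply (quad k) f = coord k \<star> (\<Sum>l\<in>{1..p+q}. coord l \<star> pderiv l f)"
    unfolding vf_apply_def quad_def star_assoc star_sum_right ..
  show ?thesis
    unfolding lie_density_def D V by (simp add: star_add_left star_add_right algebra_simps)
qed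

lemma diff_op_plus: "c \<in> symbols \<Longrightarrow> c' \<in> symbols \<Longrightarrow> diff_op (c + c') f = diff_op c f + diff_op c' f"
  by (simp only: diff_op_add plus_fun_apply[where x = f])

lemma diff_op_scaleR: "c \<in> symbols \<Longrightarrow> diff_op (r *\<^sub>R c) f = r *\<^sub>R diff_op c f"
  by (simp only: diff_op_scale scaleR_fun_apply[where \<alpha> = f])

lemma diff_op_minus: "c \<in> symbols \<Longrightarrow> c' \<in> symbols \<Longrightarrow> diff_op (c - c') f = diff_op c f - diff_op c' f"
  by (simp only: diff_op_diff minus_apply[where x = f])

lemma diff_op_0: "diff_op 0 = 0"
  using diff_op_scale[OF SW.S_0, of 0] by simp

lemma diff_op_sum: "(\<And>a. a \<in> A \<Longrightarrow> c a \<in> symbols) \<Longrightarrow> diff_op (\<Sum>a\<in>A. c a) = (\<Sum>a\<in>A. diff_op (c a))"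
  by (induction A rule: infinite_finite_induct) (simp_all add: diff_op_0 diff_op_add)

lemma diff_op_sum_apply: "(\<And>a. a \<in> A \<Longrightarrow> c a \<in> symbols) \<Longrightarrow> diff_op (\<Sum>a\<in>A. c a) f = (\<Sum>a\<in>A. diff_op (c a) f)"
  by (simp only: diff_op_sum sum_fun_apply[where x = f])

lemma mop_hat: "mop k (hat l c) = SW.ss k l *\<^sub>R hat l (mop k c)"
  by (rule symbol_ext)
    (simp add: mop_def hat_def scaleR_fun_apply SW.ss_def tau_star tau_coord pm_sq mult_ac)

lemma cop_hat: "cop k (hat l c) = SW.ss k l *\<^sub>R hat l (cop k c)"
  by (rule symbol_ext)
    (simp add: cop_def contr_def hat_def scaleR_fun_apply SW.ss_def tau_commute[of k l] distrib_left power_add mult_ac)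

lemma hat_add: "hat l (c + c') = hat l c + hat l c'"
  by (rule symbol_ext) (simp add: hat_def plus_fun_apply[where x = _ and f = c] plus_fun_apply[where f = "\<lambda>\<alpha>. _ \<alpha>" and g = "\<lambda>\<alpha>. _ \<alpha>"] tau_add scaleR_add_right)

lemma hat_scale: "hat l (r *\<^sub>R c) = r *\<^sub>R hat l c"
  by (rule symbol_ext) (simp add: hat_def scaleR_fun_apply)

lemma diff_op_coord_star_pderiv:
  assumes "c \<in> symbols" "f \<in> sfuns" "k \<in> {1..p+q}" "l \<in> {1..p+q}"
  shows "diff_op (hat k (hat l c)) (coord k \<star> pderiv l f) =
    SW.ss k l *\<^sub>R diff_op (eop l (mop k c + (-1) ^ par k *\<^sub>R cop k c)) f"
proof -
  have "mop k (hat l c) + (-1) ^ par k *\<^sub>R cop k (hat l c) =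
      SW.ss k l *\<^sub>R hat l (mop k c + (-1) ^ par k *\<^sub>R cop k c)"
    by (simp add: mop_hat cop_hat hat_add hat_scale scaleR_add_right mult.commute)
  then have "diff_op (hat k (hat l c)) (coord k \<star> pderiv l f) =
      diff_op (SW.ss k l *\<^sub>R hat l (mop k c + (-1) ^ par k *\<^sub>R cop k c)) (pderiv l f)"
    using diff_op_coord_star[OF hat_symbols[OF assms(1)] sfuns_pderiv[OF assms(2,4)] assms(3), of l] by simp
  then show ?thesis
    using assms by (simp add: diff_op_scaleR diff_op_pderiv)
qed

lemma lie_op_outside: "f \<notin> sfuns \<Longrightarrow> lie_op lam mu X D f = 0"
  by (simp add: lie_op_def)

text \<open>The left composition contributes d_l + e_l and the right composition e_l, so the
  commutator differentiates the coefficients only.\<close>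

lemma lie_op_const:
  assumes "c \<in> symbols" "l \<in> {1..p+q}"
  shows "lie_op lam mu (single l one) (diff_op c) = diff_op (dop l c)"
proof (rule ext)
  fix f
  show "lie_op lam mu (single l one) (diff_op c) f = diff_op (dop l c) f"
  proof (cases "f \<in> sfuns")
    case True
    have "lie_op lam mu (single l one) (diff_op c) f = diff_op (dop l c + eop l c) f - diff_op (eop l c) f"
      using assms True diff_op_pderiv[OF assms(1) True assms(2)]
      by (subst lie_op_homogeneous[OF homogeneous_single_one par_less_2, of l l 0])
        (simp_all add: lie_density_const diff_op_dop par_def[of 0])
    then show ?thesis using assms by (simp add: diff_op_plus)
  qed (simp add: lie_op_outside diff_op_outside)
qed

text \<open>The left and right compositions share the term m_k e_l, which cancels. What remains is
  m_k d_l from the left and e_l c_k from the right, with the densities entering through mu - lam: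
  the same operator as on symbols, so affine fields demand no correction.\<close>

lemma lie_op_linear:
  assumes "c \<in> symbols" "k \<in> {1..p+q}" "l \<in> {1..p+q}"
  shows "lie_op lam mu (single l (coord k)) (diff_op c) = diff_op (SW.G (mu - lam) k l c)"
proof (rule ext)
  fix f
  show "lie_op lam mu (single l (coord k)) (diff_op c) f = diff_op (SW.G (mu - lam) k l c) f"
  proof (cases "f \<in> sfuns")
    case True
    let ?h = "diff_op (hat k (hat l c))"
    have e: "even ((par k + par l) mod 2 + par k + par l)" by presburger
    have h: "hat k (hat l c) \<in> symbols" using assms(1) by simp
    have cp: "coord k \<star> pderiv l f \<in> sfuns" using assms True by simp
    have 1: "lie_density mu (single l (coord k)) (diff_op c f) =
        diff_op (mop k (dop l c + eop l c)) f + (if k = l then (mu * (-1) ^ par k) *\<^sub>R diff_op c f else 0)"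
      using assms True
      by (subst lie_density_linear[OF diff_op_in[OF assms(1) True] assms(2,3)])
        (simp add: diff_op_dop diff_op_mop)
    have "?h (lie_density lam (single l (coord k)) f) =
        ?h (coord k \<star> pderiv l f) + ?h (if k = l then (lam * (-1) ^ par k) *\<^sub>R f else 0)"
      unfolding lie_density_linear[OF True assms(2,3)]
      by (rule diff_op_add_arg[OF h cp]) (use True in auto)
    also have "?h (if k = l then (lam * (-1) ^ par k) *\<^sub>R f else 0) = (if k = l then (lam * (-1) ^ par k) *\<^sub>R diff_op c f else 0)"
      using diff_op_scale_arg[OF h True] diff_op_0_arg[OF h] by (cases "k = l") (simp_all add: hat_hat)
    finally have 2: "?h (lie_density lam (single l (coord k)) f) =
        SW.ss k l *\<^sub>R diff_op (eop l (mop k c + (-1) ^ par k *\<^sub>R cop k c)) f +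
        (if k = l then (lam * (-1) ^ par k) *\<^sub>R diff_op c f else 0)"
      unfolding diff_op_coord_star_pderiv[OF assms(1) True assms(2,3)] .
    have 3: "mop k (dop l c + eop l c) = mop k (dop l c) + SW.ss k l *\<^sub>R eop l (mop k c)"
      using assms by (simp add: SW.m_add SW.swap(5))
    have 4: "eop l (mop k c + (-1) ^ par k *\<^sub>R cop k c) = eop l (mop k c) + (-1) ^ par k *\<^sub>R eop l (cop k c)"
      using assms by (simp add: SW.e_add SW.e_scale)
    have "lie_op lam mu (single l (coord k)) (diff_op c) f =
        lie_density mu (single l (coord k)) (diff_op c f) - ?h (lie_density lam (single l (coord k)) f)"
      by (rule lie_op_homogeneous[OF homogeneous_single_coord[OF assms(2)] _ e assms(1) True]) simp
    also have "\<dots> = diff_op (SW.G (mu - lam) k l c) f"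
      unfolding 1 2 3 4 SW.G_def using assms
      by (cases "k = l") (simp_all add: diff_op_plus diff_op_minus diff_op_scaleR ss_par scaleR_add_right algebra_simps)
    finally show ?thesis .
  qed (simp add: lie_op_outside diff_op_outside)
qed

text \<open>Here the two actions part. Right composition with y^k replaces c by m_k c plus or minus
  c_k c, and the Euler field then adds Y + K. The surplus over the action on symbols is K c_k + lam
  (sdim + 1) c_k up to sign, that is, the difference between \<open>L'\<close> and
  \<open>L\<close>.\<close>

lemma lie_op_quad:
  assumes "c \<in> symbols" "k \<in> {1..p+q}"
  shows "lie_op lam mu (quad k) (diff_op c) = diff_op (SW.L' (mu - lam) lam k c)"
proof (rule ext)
  fix f
  let ?I = "{1..p+q}"
  show "lie_op lam mu (quad k) (diff_op c) f = diff_op (SW.L' (mu - lam) lam k c) f"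
  proof (cases "f \<in> sfuns")
    case True
    define c' where "c' = mop k c + (-1) ^ par k *\<^sub>R cop k c"
    have c': "c' \<in> symbols" using assms by (simp add: c'_def)
    let ?n = "SW.sdim + 1"
    let ?e = "\<lambda>f. \<Sum>l\<in>?I. coord l \<star> pderiv l f"
    have e_in: "?e f \<in> sfuns" using True by (intro sfuns_sum) auto
    have "?e (diff_op c f) = (\<Sum>l\<in>?I. diff_op (mop l (dop l c) + mop l (eop l c)) f)"
      by (intro sum.cong refl) (use assms True in \<open>simp add: diff_op_dop diff_op_mop SW.m_add\<close>)
    also have "\<dots> = diff_op (SW.E c + SW.Y c) f"
      unfolding SW.E_def SW.Y_def sum.distrib[symmetric] by (rule diff_op_sum_apply[symmetric]) (use assms in simp)
    finally have "lie_density mu (quad k) (diff_op c f) = coord k \<star> (diff_op (SW.E c + SW.Y c) f + (mu * ?n) *\<^sub>R diff_op c f)"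
      by (simp only: lie_density_quad[OF diff_op_in[OF assms(1) True] assms(2)])
    also have "\<dots> = diff_op (mop k (SW.E c + SW.Y c) + (mu * ?n) *\<^sub>R mop k c) f"
      using assms True by (simp add: star_add_right diff_op_mop diff_op_plus diff_op_scaleR SW.m_add)
    finally have 1: "lie_density mu (quad k) (diff_op c f) = diff_op (mop k (SW.E c + SW.Y c) + (mu * ?n) *\<^sub>R mop k c) f" .
    have "diff_op c' (coord l \<star> pderiv l f) = diff_op (mop l (eop l c') + eop l (cop l c')) f" if l: "l \<in> ?I" for l
    proof -
      have "diff_op c' (coord l \<star> pderiv l f) = SW.ss l l *\<^sub>R diff_op (eop l (mop l c' + (-1) ^ par l *\<^sub>R cop l c')) f"
        using diff_op_coord_star_pderiv[OF c' True l l] by (simp only: hat_hat)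
      also have "\<dots> = diff_op (SW.ss l l *\<^sub>R eop l (mop l c' + (-1) ^ par l *\<^sub>R cop l c')) f"
        using c' l by (simp add: diff_op_scaleR)
      also have "SW.ss l l *\<^sub>R eop l (mop l c' + (-1) ^ par l *\<^sub>R cop l c') = mop l (eop l c') + eop l (cop l c')"
        using c' l by (simp add: SW.e_add SW.e_scale scaleR_add_right SW.swap(5)[OF l l c'] flip: ss_par)
      finally show ?thesis .
    qed
    then have "(\<Sum>l\<in>?I. diff_op c' (coord l \<star> pderiv l f)) = (\<Sum>l\<in>?I. diff_op (mop l (eop l c') + eop l (cop l c')) f)"
      by (intro sum.cong refl)
    also have "\<dots> = diff_op (SW.Y c' + SW.K c') f"
      unfolding SW.K_def SW.Y_def sum.distrib[symmetric] by (rule diff_op_sum_apply[symmetric]) (use c' in simp)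
    finally have e: "diff_op c' (?e f) = diff_op (SW.Y c' + SW.K c') f"
      using diff_op_sum_arg[OF c', of ?I "\<lambda>l. coord l \<star> pderiv l f"] True by simp
    have g_in: "?e f + (lam * ?n) *\<^sub>R f \<in> sfuns" using e_in True by simp
    have "diff_op (hat k c) (lie_density lam (quad k) f) = diff_op c' (?e f + (lam * ?n) *\<^sub>R f)"
      unfolding lie_density_quad[OF True assms(2)] c'_def by (rule diff_op_coord_star[OF assms(1) g_in assms(2)])
    also have "\<dots> = diff_op (SW.Y c' + SW.K c' + (lam * ?n) *\<^sub>R c') f"
      using c' True e_in by (simp add: diff_op_add_arg diff_op_scale_arg e diff_op_plus diff_op_scaleR)
    finally have 2: "diff_op (hat k c) (lie_density lam (quad k) f) = diff_op (SW.Y c' + SW.K c' + (lam * ?n) *\<^sub>R c') f" .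
    have p0: "even (par k + par k + par 0)" by (simp add: par_def)
    have "lie_op lam mu (quad k) (diff_op c) f =
        lie_density mu (quad k) (diff_op c f) - diff_op (hat k (hat 0 c)) (lie_density lam (quad k) f)"
      by (rule lie_op_homogeneous[OF homogeneous_quad[OF assms(2)] par_less_2 p0 assms(1) True])
    also have "\<dots> = diff_op (mop k (SW.E c + SW.Y c) + (mu * ?n) *\<^sub>R mop k c - (SW.Y c' + SW.K c' + (lam * ?n) *\<^sub>R c')) f"
      unfolding hat_0 1 2 using assms c' by (simp add: diff_op_minus)
    also have "mop k (SW.E c + SW.Y c) + (mu * ?n) *\<^sub>R mop k c - (SW.Y c' + SW.K c' + (lam * ?n) *\<^sub>R c') = SW.L' (mu - lam) lam k c"
      using assms unfolding c'_def ss_par[symmetric]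
      by (simp add: SW.L'_def SW.L_def SW.even_swap SW.linS_rules algebra_simps)
    finally show ?thesis .
  qed (simp add: lie_op_outside diff_op_outside)
qed

subsection \<open>The equivariant map of symbols\<close>

lemma symbol_plus: "(T + U) \<alpha> = T \<alpha> + (U :: symbol) \<alpha>"
  and symbol_zero: "(0 :: symbol) \<alpha> = 0"
  and symbol_scale: "(r *\<^sub>R T) \<alpha> = r *\<^sub>R (T :: symbol) \<alpha>"
  by (rule plus_fun_apply zero_fun_apply scaleR_fun_apply)+

definition below_deg :: "nat \<Rightarrow> symbol \<Rightarrow> bool" where
  "below_deg N T \<longleftrightarrow> T \<in> symbols \<and> (\<forall>\<alpha>. N \<le> size \<alpha> \<longrightarrow> T \<alpha> = 0)"

lemma below_deg_0: "below_deg 0 T \<Longrightarrow> T = 0"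
  by (rule symbol_ext) (simp add: below_deg_def symbol_zero)

lemma below_deg_symbols: "below_deg N T \<Longrightarrow> T \<in> symbols"
  by (simp add: below_deg_def)

lemma below_degD: "below_deg N T \<Longrightarrow> N \<le> size \<alpha> \<Longrightarrow> T \<alpha> = 0"
  unfolding below_deg_def by blast

lemma deg_eq_0: "T \<in> symbols_deg k \<Longrightarrow> size \<alpha> \<noteq> k \<Longrightarrow> T \<alpha> = 0"
  unfolding symbols_deg_def by blast

lemma below_degI: "T \<in> symbols \<Longrightarrow> (\<And>\<alpha>. N \<le> size \<alpha> \<Longrightarrow> T \<alpha> = 0) \<Longrightarrow> below_deg N T"
  unfolding below_deg_def by blast

lemma below_deg_mono: "below_deg N T \<Longrightarrow> N \<le> M \<Longrightarrow> below_deg M T"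
  unfolding below_deg_def using order_trans by blast

lemma coeffs_upto_iff: "T \<in> coeffs_upto k \<longleftrightarrow> below_deg (Suc k) T"
  unfolding coeffs_upto_def below_deg_def mem_Collect_eq not_less_eq_eq[symmetric] by blast

lemma below_deg_exists:
  assumes "T \<in> symbols"
  shows "\<exists>N. below_deg N T"
proof -
  obtain N where N: "\<forall>n\<in>size ` {\<alpha>. T \<alpha> \<noteq> 0}. n < N"
    using finite_imageI[OF symbols_finite[OF assms], of size] unfolding finite_nat_set_iff_bounded by blast
  have "T \<alpha> = 0" if "N \<le> size \<alpha>" for \<alpha>
  proof (rule ccontr)
    assume "T \<alpha> \<noteq> 0"
    then have "size \<alpha> < N" using N by blast
    then show False using that by simp
  qed
  then show ?thesis using assms unfolding below_deg_def by blast
qed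

lemma symbols_deg_below:
  assumes "T \<in> symbols_deg k"
  shows "below_deg (Suc k) T"
proof -
  have "T \<alpha> = 0" if "Suc k \<le> size \<alpha>" for \<alpha>
  proof (rule ccontr)
    assume "T \<alpha> \<noteq> 0"
    then have "size \<alpha> = k" using assms unfolding symbols_deg_def by blast
    then show False using that by simp
  qed
  then show ?thesis using assms unfolding symbols_deg_def below_deg_def by blast
qed

section \<open>Homogeneous components of symbols\<close>

definition deg_part :: "nat \<Rightarrow> symbol \<Rightarrow> symbol" where
  "deg_part k T = (\<lambda>\<alpha>. if size \<alpha> = k then T \<alpha> else 0)"

lemma deg_part_in [simp]:
  assumes "T \<in> symbols"
  shows "deg_part k T \<in> symbols"
proof (rule symbolsI[of _ "{\<alpha>. T \<alpha> \<noteq> 0}"])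
  show "deg_part k T \<alpha> \<in> sfuns" for \<alpha>
    using symbols_in[OF assms, of \<alpha>] by (simp add: deg_part_def)
  show "deg_part k T \<alpha> = 0" if "\<alpha> \<notin> midx" for \<alpha>
    using symbols_midx[OF assms that] by (simp add: deg_part_def)
  show "{\<alpha>. deg_part k T \<alpha> \<noteq> 0} \<subseteq> {\<alpha>. T \<alpha> \<noteq> 0}" by (auto simp: deg_part_def)
qed (rule symbols_finite[OF assms])

lemma linS_deg_part: "SW.linS (deg_part k)"
  unfolding SW.linS_def
proof (intro conjI ballI allI)
  show "deg_part k (T + U) = deg_part k T + deg_part k U" for T U
    by (rule symbol_ext) (simp add: deg_part_def symbol_plus)
  show "deg_part k (r *\<^sub>R T) = r *\<^sub>R deg_part k T" for r T
    by (rule symbol_ext) (simp add: deg_part_def symbol_scale)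
qed (rule deg_part_in)

lemma deg_part_deg: "T \<in> symbols \<Longrightarrow> deg_part k T \<in> symbols_deg k"
  unfolding symbols_deg_def
proof (intro CollectI conjI allI impI)
  show "size \<alpha> = k" if "deg_part k T \<alpha> \<noteq> 0" for \<alpha>
    using that by (rule contrapos_np) (simp add: deg_part_def)
qed (rule deg_part_in)

lemma deg_in: "T \<in> symbols_deg k \<Longrightarrow> T \<in> symbols"
  by (simp add: symbols_deg_def)

lemma deg_part_of_deg: "T \<in> symbols_deg j \<Longrightarrow> deg_part k T = (if j = k then T else 0)"
proof (rule symbol_ext)
  fix \<alpha> assume T: "T \<in> symbols_deg j"
  show "deg_part k T \<alpha> = (if j = k then T else 0) \<alpha>"
    using deg_eq_0[OF T, of \<alpha>] by (cases "size \<alpha> = j") (simp_all add: deg_part_def symbol_zero)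
qed

lemma deg_iff_K:
  assumes "T \<in> symbols"
  shows "T \<in> symbols_deg k \<longleftrightarrow> SW.K T = real k *\<^sub>R T"
proof
  assume T: "T \<in> symbols_deg k"
  show "SW.K T = real k *\<^sub>R T"
  proof (rule symbol_ext)
    fix \<alpha>
    show "SW.K T \<alpha> = (real k *\<^sub>R T) \<alpha>"
      unfolding K_apply[OF assms] scaleR_fun_apply[where \<alpha> = \<alpha>]
      using deg_eq_0[OF T, of \<alpha>] by (cases "size \<alpha> = k") simp_all
  qed
next
  assume K: "SW.K T = real k *\<^sub>R T"
  have "real (size \<alpha>) *\<^sub>R T \<alpha> = real k *\<^sub>R T \<alpha>" for \<alpha>
    using K_apply[OF assms, of \<alpha>] unfolding K symbol_scale by (rule sym)
  then have "size \<alpha> = k" if "T \<alpha> \<noteq> 0" for \<alpha>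
    using that by (metis of_nat_eq_iff scaleR_cancel_right)
  then show "T \<in> symbols_deg k" unfolding symbols_deg_def using assms by blast
qed

lemma sum_deg_part: "below_deg N T \<Longrightarrow> T = (\<Sum>k<N. deg_part k T)"
proof (rule symbol_ext)
  fix \<alpha> assume T: "below_deg N T"
  have "(\<Sum>k<N. deg_part k T) \<alpha> = (\<Sum>k<N. if k = size \<alpha> then T \<alpha> else 0)"
    unfolding sum_fun_apply[where x = \<alpha>] by (intro sum.cong) (auto simp: deg_part_def)
  then show "T \<alpha> = (\<Sum>k<N. deg_part k T) \<alpha>"
    using below_degD[OF T, of \<alpha>] by (cases "size \<alpha> < N") simp_all
qed

lemma deg_part_eq_0:
  assumes "below_deg N T" "N \<le> k"
  shows "deg_part k T = 0"
proof (rule symbol_ext)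
  fix \<alpha>
  show "deg_part k T \<alpha> = 0 \<alpha>"
  proof (cases "size \<alpha> = k")
    case True
    then have "T \<alpha> = 0" using assms by (intro below_degD[OF assms(1)]) simp
    then show ?thesis using True by (simp add: deg_part_def symbol_zero)
  qed (simp add: deg_part_def symbol_zero)
qed

lemma K_comm_deg:
  assumes "SW.linS F" "\<And>T. T \<in> symbols \<Longrightarrow> SW.K (F T) = F (SW.K T)" "T \<in> symbols_deg k"
  shows "F T \<in> symbols_deg k"
proof -
  have T: "T \<in> symbols" by (rule deg_in[OF assms(3)])
  have K: "SW.K T = real k *\<^sub>R T" using assms(3) deg_iff_K[OF T] by blast
  have "SW.K (F T) = F (real k *\<^sub>R T)" unfolding assms(2)[OF T] K ..
  also have "\<dots> = real k *\<^sub>R F T" by (rule SW.linS_scale[OF assms(1) T])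
  finally show ?thesis using deg_iff_K[OF SW.linS_in[OF assms(1) T]] by blast
qed

lemma lin_sum_deg_part:
  assumes "SW.linS F" "below_deg N T"
  shows "F T = (\<Sum>k<N. F (deg_part k T))"
proof -
  have "F T = F (\<Sum>k<N. deg_part k T)" by (simp only: sum_deg_part[OF assms(2), symmetric])
  also have "\<dots> = (\<Sum>k<N. F (deg_part k T))"
    by (rule SW.linS_sum[OF assms(1)]) (rule deg_part_in[OF below_deg_symbols[OF assms(2)]])
  finally show ?thesis .
qed

lemma deg_part_comm:
  assumes F: "SW.linS F" and comm: "\<And>T. T \<in> symbols \<Longrightarrow> SW.K (F T) = F (SW.K T)" and T: "T \<in> symbols"
  shows "deg_part k (F T) = F (deg_part k T)"
proof -
  obtain N where N: "below_deg N T" using below_deg_exists[OF T] by blast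
  have 1: "F T = (\<Sum>j<N. F (deg_part j T))" by (rule lin_sum_deg_part[OF F N])
  have 2: "deg_part k (\<Sum>j<N. F (deg_part j T)) = (\<Sum>j<N. deg_part k (F (deg_part j T)))"
    by (rule SW.linS_sum[OF linS_deg_part]) (rule SW.linS_in[OF F deg_part_in[OF T]])
  have 3: "deg_part k (F (deg_part j T)) = (if j = k then F (deg_part j T) else 0)" for j
    by (rule deg_part_of_deg[OF K_comm_deg[where F = F, OF F comm deg_part_deg[OF T]]])
  have 4: "(\<Sum>j<N. if j = k then g j else 0) = (if k < N then g k else 0)" for g :: "nat \<Rightarrow> symbol"
    by simp
  have 5: "F (deg_part k T) = 0" if "\<not> k < N"
    using that SW.linS_0[OF F] by (simp add: deg_part_eq_0[OF N])
  have "deg_part k (F T) = (\<Sum>j<N. if j = k then F (deg_part j T) else 0)"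
    unfolding 1 2 by (intro sum.cong refl 3)
  also have "\<dots> = (if k < N then F (deg_part k T) else 0)" by (rule 4)
  also have "\<dots> = F (deg_part k T)"
  proof (cases "k < N")
    case False
    show ?thesis unfolding 5[OF False] if_not_P[OF False] ..
  qed simp
  finally show ?thesis .
qed

text \<open>Each degree has its own series \<open>SW.A\<close>, so the symbol is split first. The
  sum runs over the finitely many degrees that occur; \<open>quant_map_eq\<close> replaces them by
  any common bound, as additivity requires.\<close>

definition quant_map :: "real \<Rightarrow> real \<Rightarrow> symbol \<Rightarrow> symbol" where
  "quant_map w r T = (\<Sum>k\<in>size ` {\<alpha>. T \<alpha> \<noteq> 0}. SW.A w r k (deg_part k T))"

lemma quant_map_eq:
  assumes "below_deg N T"
  shows "quant_map w r T = (\<Sum>k<N. SW.A w r k (deg_part k T))"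
  unfolding quant_map_def
proof (rule sum.mono_neutral_left)
  show "size ` {\<alpha>. T \<alpha> \<noteq> 0} \<subseteq> {..<N}"
    using below_degD[OF assms] not_le by blast
  show "\<forall>k\<in>{..<N} - size ` {\<alpha>. T \<alpha> \<noteq> 0}. SW.A w r k (deg_part k T) = 0"
  proof
    fix k assume k: "k \<in> {..<N} - size ` {\<alpha>. T \<alpha> \<noteq> 0}"
    have "deg_part k T = 0"
      by (rule symbol_ext) (use k in \<open>auto simp: deg_part_def symbol_zero\<close>)
    then show "SW.A w r k (deg_part k T) = 0" by (simp add: SW.linS_0[OF SW.linS_A])
  qed
qed simp

lemma linS_quant_map: "SW.linS (quant_map w r)"
  unfolding SW.linS_def
proof (intro conjI ballI allI)
  fix T assume T: "T \<in> symbols"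
  obtain N where N: "below_deg N T" using below_deg_exists[OF T] by blast
  show "quant_map w r T \<in> symbols"
    unfolding quant_map_eq[OF N] by (intro SW.S_sum SW.linS_in[OF SW.linS_A] deg_part_in T)
  show "quant_map w r (s *\<^sub>R T) = s *\<^sub>R quant_map w r T" for s
  proof -
    have "below_deg N (s *\<^sub>R T)"
    proof (rule below_degI)
      show "(s *\<^sub>R T) \<alpha> = 0" if "N \<le> size \<alpha>" for \<alpha>
        unfolding symbol_scale below_degD[OF N that] by (rule scaleR_zero_right)
    qed (rule SW.S_scale[OF T])
    then show ?thesis
      unfolding quant_map_eq[OF N] quant_map_eq[OF \<open>below_deg N (s *\<^sub>R T)\<close>] scaleR_sum_right
      by (intro sum.cong refl) (simp only: SW.linS_scale[OF linS_deg_part T] SW.linS_scale[OF SW.linS_A deg_part_in[OF T]])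
  qed
  fix U assume U: "U \<in> symbols"
  obtain M where M: "below_deg M U" using below_deg_exists[OF U] by blast
  have NM: "below_deg (max N M) T" "below_deg (max N M) U"
    using below_deg_mono[OF N] below_deg_mono[OF M] by simp_all
  have TU: "below_deg (max N M) (T + U)"
  proof (intro below_degI)
    show "(T + U) \<alpha> = 0" if "max N M \<le> size \<alpha>" for \<alpha>
      unfolding symbol_plus below_degD[OF NM(1) that] below_degD[OF NM(2) that] by (rule add_0_right)
  qed (rule SW.S_add[OF T U])
  show "quant_map w r (T + U) = quant_map w r T + quant_map w r U"
    unfolding quant_map_eq[OF NM(1)] quant_map_eq[OF NM(2)] quant_map_eq[OF TU] sum.distrib[symmetric]
    by (intro sum.cong refl) (simp only: SW.linS_add[OF linS_deg_part T U] SW.linS_add[OF SW.linS_A deg_part_in[OF T] deg_part_in[OF U]])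
qed

lemma quant_map_deg:
  assumes "T \<in> symbols_deg k"
  shows "quant_map w r T = SW.A w r k T"
proof -
  have "quant_map w r T = (\<Sum>j<Suc k. if j = k then SW.A w r k T else 0)"
    unfolding quant_map_eq[OF symbols_deg_below[OF assms]]
    by (intro sum.cong refl) (auto simp: deg_part_of_deg[OF assms] SW.linS_0[OF SW.linS_A])
  then show ?thesis by simp
qed

text \<open>For l > 0 the symbol \<open>D\<close> ^ l T has degree k - l, which the size of \<alpha>
  exceeds. Only the term l = 0, with coefficient 1, is seen.\<close>

lemma A_top:
  assumes "T \<in> symbols_deg k" "k \<le> size \<alpha>"
  shows "SW.A w r k T \<alpha> = T \<alpha>"
proof -
  have T: "T \<in> symbols" by (rule deg_in[OF assms(1)])
  have K: "SW.K T = real k *\<^sub>R T" using assms(1) by (simp add: deg_iff_K[OF T])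
  have 0: "(SW.D ^^ l) T \<alpha> = 0" if "0 < l" for l
  proof -
    have "SW.K ((SW.D ^^ l) T) \<alpha> = (real k - real l) *\<^sub>R (SW.D ^^ l) T \<alpha>"
      unfolding SW.K_D_pow[OF T K] by (rule scaleR_fun_apply)
    then have "real (size \<alpha>) *\<^sub>R (SW.D ^^ l) T \<alpha> = (real k - real l) *\<^sub>R (SW.D ^^ l) T \<alpha>"
      using K_apply[OF SW.D_pow_in[OF T]] by simp
    moreover have "real (size \<alpha>) \<noteq> real k - real l" using that assms(2) by simp
    ultimately show ?thesis by (metis scaleR_cancel_right)
  qed
  have "SW.A w r k T \<alpha> = (\<Sum>l\<le>k. if l = 0 then T \<alpha> else 0)"
    unfolding SW.A_def sum_fun_apply[where x = \<alpha>] scaleR_fun_apply[where \<alpha> = \<alpha>]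
    by (intro sum.cong refl) (auto simp: 0)
  then show ?thesis by simp
qed

text \<open>Unitriangularity with respect to the degree. It yields injectivity and surjectivity by
  descending through the degrees, and it preserves principal symbols.\<close>

lemma quant_map_top:
  assumes "below_deg (Suc N) T" "N \<le> size \<alpha>"
  shows "quant_map w r T \<alpha> = T \<alpha>"
proof -
  have T: "T \<in> symbols" by (rule below_deg_symbols[OF assms(1)])
  have "SW.A w r k (deg_part k T) \<alpha> = deg_part k T \<alpha>" if "k < Suc N" for k
    using that assms(2) by (intro A_top deg_part_deg T) simp
  then have "quant_map w r T \<alpha> = (\<Sum>k<Suc N. deg_part k T) \<alpha>"
    unfolding quant_map_eq[OF assms(1)] sum_fun_apply[where x = \<alpha>] by (intro sum.cong refl) simp
  then show ?thesis by (simp only: sum_deg_part[OF assms(1), symmetric])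
qed

lemma quant_map_below_deg:
  assumes "below_deg (Suc N) T"
  shows "below_deg (Suc N) (quant_map w r T)"
proof (rule below_degI)
  show "quant_map w r T \<alpha> = 0" if "Suc N \<le> size \<alpha>" for \<alpha>
    using quant_map_top[OF assms, of \<alpha>] below_degD[OF assms that] that by simp
qed (rule SW.linS_in[OF linS_quant_map below_deg_symbols[OF assms]])

lemma quant_map_eq_0D:
  assumes "T \<in> symbols" "quant_map w r T = 0"
  shows "T = 0"
proof -
  have "below_deg N T \<Longrightarrow> T = 0" for N
  proof (induction N)
    case (Suc N)
    have "T \<alpha> = 0" if "N \<le> size \<alpha>" for \<alpha>
      using quant_map_top[OF Suc.prems that, of w r] assms(2) by (simp add: symbol_zero)
    then show ?case using assms(1) by (intro Suc.IH below_degI)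
  qed (rule below_deg_0)
  then show ?thesis using below_deg_exists[OF assms(1)] by blast
qed

lemma quant_map_inj:
  assumes "T \<in> symbols" "U \<in> symbols" "quant_map w r T = quant_map w r U"
  shows "T = U"
  using quant_map_eq_0D[of "T - U" w r] assms by (simp add: SW.linS_diff[OF linS_quant_map])

lemma quant_map_surj: "below_deg N c \<Longrightarrow> \<exists>T\<in>symbols. quant_map w r T = c"
proof (induction N arbitrary: c)
  case 0
  then have "c = 0" by (rule below_deg_0)
  then show ?case using SW.linS_0[OF linS_quant_map] by (intro bexI[of _ 0]) simp_all
next
  case (Suc N)
  note c = below_deg_symbols[OF Suc.prems]
  have p: "below_deg (Suc N) (deg_part N c)" by (rule symbols_deg_below[OF deg_part_deg[OF c]])
  \<comment> \<open>Subtracting the image of the top component of c leaves a symbol of smaller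
    degree, to which the induction hypothesis applies.\<close>
  have "(c - quant_map w r (deg_part N c)) \<alpha> = 0" if "N \<le> size \<alpha>" for \<alpha>
    using that below_degD[OF Suc.prems, of \<alpha>] unfolding minus_apply[where x = \<alpha>] quant_map_top[OF p that]
    by (cases "size \<alpha> = N") (simp_all add: deg_part_def)
  then have "below_deg N (c - quant_map w r (deg_part N c))"
    using c by (intro below_degI SW.S_diff SW.linS_in[OF linS_quant_map] deg_part_in)
  then obtain T where T: "T \<in> symbols" "quant_map w r T = c - quant_map w r (deg_part N c)" using Suc.IH by blast
  then have "quant_map w r (T + deg_part N c) = c" using c by (simp add: SW.linS_add[OF linS_quant_map])
  then show ?case using T(1) c by (intro bexI[of _ "T + deg_part N c"]) simp_all
qed

lemma quant_map_comm:
  assumes F: "SW.linS F" and comm: "\<And>T. T \<in> symbols \<Longrightarrow> SW.K (F T) = F (SW.K T)" and G: "SW.linS G"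
    and A: "\<And>k T. T \<in> symbols_deg k \<Longrightarrow> SW.A w r k (F T) = G (SW.A w r k T)"
    and T: "T \<in> symbols"
  shows "quant_map w r (F T) = G (quant_map w r T)"
proof -
  obtain N where N: "below_deg N T" using below_deg_exists[OF T] by blast
  have 1: "F T = (\<Sum>j<N. F (deg_part j T))" by (rule lin_sum_deg_part[OF F N])
  have 2: "quant_map w r (\<Sum>j<N. F (deg_part j T)) = (\<Sum>j<N. quant_map w r (F (deg_part j T)))"
    by (rule SW.linS_sum[OF linS_quant_map]) (rule SW.linS_in[OF F deg_part_in[OF T]])
  have 3: "quant_map w r (F (deg_part j T)) = G (SW.A w r j (deg_part j T))" for j
    by (rule trans[OF quant_map_deg[OF K_comm_deg[where F = F, OF F comm deg_part_deg[OF T]]] A[OF deg_part_deg[OF T]]])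
  have 4: "G (\<Sum>j<N. SW.A w r j (deg_part j T)) = (\<Sum>j<N. G (SW.A w r j (deg_part j T)))"
    by (rule SW.linS_sum[OF G]) (rule SW.linS_in[OF SW.linS_A deg_part_in[OF T]])
  have "quant_map w r (F T) = (\<Sum>j<N. G (SW.A w r j (deg_part j T)))"
    unfolding 1 2 by (intro sum.cong refl 3)
  then show ?thesis unfolding quant_map_eq[OF N] 4 .
qed

text \<open>Equivariance on generators of the quantization with coefficient map B. Affine generators
  act alike on both sides; for quadratic ones symbols carry \<open>L\<close> and coefficients of
  operators carry \<open>L'\<close>.\<close>

definition intertwines :: "real \<Rightarrow> real \<Rightarrow> (symbol \<Rightarrow> symbol) \<Rightarrow> bool" where
  "intertwines w r B \<longleftrightarrow> (\<forall>T\<in>symbols. \<forall>k\<in>{1..p+q}. \<forall>l\<in>{1..p+q}.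
     dop l (B T) = B (dop l T) \<and> SW.G w k l (B T) = B (SW.G w k l T) \<and> SW.L' w r k (B T) = B (SW.L w k T))"

lemma contr_degree_0:
  assumes "U \<in> symbols" "SW.K U = 0"
  shows "cop j U = 0"
proof (rule symbol_ext)
  fix \<beta>
  have "real (size (add_mset j \<beta>)) *\<^sub>R U (add_mset j \<beta>) = 0"
    using K_apply[OF assms(1), of "add_mset j \<beta>"] assms(2) by (simp add: symbol_zero)
  then have "U (add_mset j \<beta>) = 0"
    unfolding scaleR_eq_0_iff by simp
  then show "cop j U \<beta> = 0 \<beta>" by (simp add: cop_def contr_def symbol_zero)
qed

lemma intertwines_quant_map:
  assumes "\<And>k l. l < k \<Longrightarrow> w * (SW.sdim + 1) \<noteq> real k + real l + SW.sdim"
  shows "intertwines w r (quant_map w r)"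
  unfolding intertwines_def
proof (intro ballI conjI)
  fix T k l assume T: "T \<in> symbols" and k: "k \<in> {1..p+q}" and l: "l \<in> {1..p+q}"
  show "dop l (quant_map w r T) = quant_map w r (dop l T)"
    by (rule quant_map_comm[where F = "dop l" and G = "dop l", symmetric, OF SW.linS_d[OF l] SW.K_d[OF l] SW.linS_d[OF l] SW.A_d[OF l deg_in] T])
  show "SW.G w k l (quant_map w r T) = quant_map w r (SW.G w k l T)"
    by (rule quant_map_comm[where F = "SW.G w k l" and G = "SW.G w k l", symmetric, OF SW.linS_G[OF k l] SW.K_G[OF k l] SW.linS_G[OF k l] SW.A_G[OF k l deg_in] T])
  show "SW.L' w r k (quant_map w r T) = quant_map w r (SW.L w k T)"
  proof (rule quant_map_comm[where F = "SW.L w k" and G = "SW.L' w r k", symmetric, OF SW.linS_L[OF k] SW.K_L[OF k] SW.linS_L'[OF k] _ T])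
    fix j U assume U: "U \<in> symbols_deg j"
    then have "SW.K U = real j *\<^sub>R U" using deg_iff_K[OF deg_in[OF U]] by simp
    then show "SW.A w r j (SW.L w k U) = SW.L' w r k (SW.A w r j U)"
      by (rule SW.A_L[OF k deg_in[OF U]]) (use contr_degree_0 assms in auto)
  qed
qed

text \<open>Since \<open>quant_map\<close> is bijective, B factors through it by a map P, and P
  commutes with the action on symbols because B and \<open>quant_map\<close> intertwine the same two
  actions. The Casimir argument makes P preserve degrees, and preservation of principal symbols then
  makes it the identity.\<close>

lemma intertwines_unique:
  assumes noncrit: "\<And>k l :: nat. k \<noteq> l \<Longrightarrow> w * (SW.sdim + 1) \<noteq> real k + real l + SW.sdim"
    and B: "SW.linS B" "intertwines w r B"
    and top: "\<And>k T \<alpha>. T \<in> symbols_deg k \<Longrightarrow> size \<alpha> = k \<Longrightarrow> B T \<alpha> = T \<alpha>"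
    and T: "T \<in> symbols"
  shows "B T = quant_map w r T"
proof -
  have quant_map: "intertwines w r (quant_map w r)" by (rule intertwines_quant_map) (use noncrit in auto)
  have "\<forall>T\<in>symbols. \<exists>U. U \<in> symbols \<and> quant_map w r U = B T"
  proof
    fix T assume "T \<in> symbols"
    then obtain N where "below_deg N (B T)" using below_deg_exists[OF SW.linS_in[OF B(1)]] by blast
    then show "\<exists>U. U \<in> symbols \<and> quant_map w r U = B T" using quant_map_surj[of N "B T" w r] by blast
  qed
  then have "\<exists>P. \<forall>T\<in>symbols. P T \<in> symbols \<and> quant_map w r (P T) = B T" by (rule bchoice)
  then obtain P where P: "\<And>T. T \<in> symbols \<Longrightarrow> P T \<in> symbols" "\<And>T. T \<in> symbols \<Longrightarrow> quant_map w r (P T) = B T"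
    by blast
  have PI: "P T = U" if "T \<in> symbols" "U \<in> symbols" "quant_map w r U = B T" for T U
    by (rule quant_map_inj[where w = w and r = r, OF P(1)[OF that(1)] that(2)]) (simp only: P(2)[OF that(1)] that(3))
  have linP: "SW.linS P"
    unfolding SW.linS_def
  proof (intro conjI ballI allI)
    fix T assume T: "T \<in> symbols"
    show "P T \<in> symbols" by (rule P(1)[OF T])
    show "P (s *\<^sub>R T) = s *\<^sub>R P T" for s
      by (rule PI[OF SW.S_scale[OF T] SW.S_scale[OF P(1)[OF T]]])
        (simp only: SW.linS_scale[OF linS_quant_map P(1)[OF T]] SW.linS_scale[OF B(1) T] P(2)[OF T])
    show "P (T + U) = P T + P U" if U: "U \<in> symbols" for U
      by (rule PI[OF SW.S_add[OF T U] SW.S_add[OF P(1)[OF T] P(1)[OF U]]])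
        (simp only: SW.linS_add[OF linS_quant_map P(1)[OF T] P(1)[OF U]] SW.linS_add[OF B(1) T U] P(2)[OF T] P(2)[OF U])
  qed
  have Pd: "P (dop l T) = dop l (P T)" and PG: "P (SW.G w k l T) = SW.G w k l (P T)"
    and PL: "P (SW.L w k T) = SW.L w k (P T)"
    if "T \<in> symbols" "k \<in> {1..p+q}" "l \<in> {1..p+q}" for T k l
  proof -
    have A: "dop l (quant_map w r (P T)) = quant_map w r (dop l (P T))" "SW.G w k l (quant_map w r (P T)) = quant_map w r (SW.G w k l (P T))"
      "SW.L' w r k (quant_map w r (P T)) = quant_map w r (SW.L w k (P T))"
      using quant_map P(1)[OF that(1)] that(2,3) unfolding intertwines_def by blast+
    have b: "dop l (B T) = B (dop l T)" "SW.G w k l (B T) = B (SW.G w k l T)" "SW.L' w r k (B T) = B (SW.L w k T)"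
      using B(2) that unfolding intertwines_def by blast+
    show "P (dop l T) = dop l (P T)"
      by (rule PI[OF SW.d_in[OF that(3,1)] SW.d_in[OF that(3) P(1)[OF that(1)]]])
        (simp only: A(1)[symmetric] b(1)[symmetric] P(2)[OF that(1)])
    show "P (SW.G w k l T) = SW.G w k l (P T)"
      by (rule PI[OF SW.G_in[OF that(2,3,1)] SW.G_in[OF that(2,3) P(1)[OF that(1)]]])
        (simp only: A(2)[symmetric] b(2)[symmetric] P(2)[OF that(1)])
    show "P (SW.L w k T) = SW.L w k (P T)"
      by (rule PI[OF SW.L_in[OF that(2,1)] SW.L_in[OF that(2) P(1)[OF that(1)]]])
        (simp only: A(3)[symmetric] b(3)[symmetric] P(2)[OF that(1)])
  qed
  \<comment> \<open>The symbol action preserves degrees, so the projections commute with it and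
    every matrix block of P between two degrees is equivariant by itself.\<close>
  have off: "deg_part l (P (deg_part k U)) = 0" if "k \<noteq> l" "U \<in> symbols" for k l U
  proof (rule SW.equivariant_eq_0[where P = "\<lambda>U. deg_part l (P (deg_part k U))" and w = w and k = "real k" and l = "real l"])
    have pd: "deg_part i (dop j T) = dop j (deg_part i T)" if "j \<in> {1..p+q}" "T \<in> symbols" for i j T
      by (rule deg_part_comm[where F = "dop j", OF SW.linS_d[OF that(1)] SW.K_d[OF that(1)] that(2)])
    have pG: "deg_part e (SW.G w i j T) = SW.G w i j (deg_part e T)" if "i \<in> {1..p+q}" "j \<in> {1..p+q}" "T \<in> symbols" for e i j T
      by (rule deg_part_comm[where F = "SW.G w i j", OF SW.linS_G[OF that(1,2)] SW.K_G[OF that(1,2)] that(3)])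
    have pL: "deg_part i (SW.L w j T) = SW.L w j (deg_part i T)" if "j \<in> {1..p+q}" "T \<in> symbols" for i j T
      by (rule deg_part_comm[where F = "SW.L w j", OF SW.linS_L[OF that(1)] SW.K_L[OF that(1)] that(2)])
    show "SW.linS (\<lambda>U. deg_part l (P (deg_part k U)))"
      unfolding SW.linS_def
      by (simp add: SW.linS_rules[OF linS_deg_part] SW.linS_rules[OF linP] P)
    show "deg_part l (P (deg_part k (dop j T))) = dop j (deg_part l (P (deg_part k T)))" if "j \<in> {1..p+q}" "T \<in> symbols" for j T
      unfolding pd[OF that] Pd[OF deg_part_in[OF that(2)] that(1,1)] pd[OF that(1) P(1)[OF deg_part_in[OF that(2)]]] ..
    show "deg_part l (P (deg_part k (SW.G w i j T))) = SW.G w i j (deg_part l (P (deg_part k T)))"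
      if "i \<in> {1..p+q}" "j \<in> {1..p+q}" "T \<in> symbols" for i j T
      unfolding pG[OF that] PG[OF deg_part_in[OF that(3)] that(1,2)] pG[OF that(1,2) P(1)[OF deg_part_in[OF that(3)]]] ..
    show "deg_part l (P (deg_part k (SW.L w j T))) = SW.L w j (deg_part l (P (deg_part k T)))" if "j \<in> {1..p+q}" "T \<in> symbols" for j T
      unfolding pL[OF that] PL[OF deg_part_in[OF that(2)] that(1,1)] pL[OF that(1) P(1)[OF deg_part_in[OF that(2)]]] ..
    show "deg_part l (P (deg_part k (SW.K T))) = real k *\<^sub>R deg_part l (P (deg_part k T))" if "T \<in> symbols" for T
    proof -
      have "deg_part k (SW.K T) = SW.K (deg_part k T)" by (rule deg_part_comm[where F = SW.K, OF SW.linS_K refl that])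
      also have "\<dots> = real k *\<^sub>R deg_part k T" using deg_part_deg[OF that] that by (simp add: deg_iff_K)
      finally show ?thesis
        using that by (simp add: SW.linS_scale[OF linP] SW.linS_scale[OF linS_deg_part] P)
    qed
    show "SW.K (deg_part l (P (deg_part k T))) = real l *\<^sub>R deg_part l (P (deg_part k T))" if "T \<in> symbols" for T
      using deg_part_deg[OF P(1)[OF deg_part_in[OF that]]] that P(1) by (simp add: deg_iff_K)
  qed (use that noncrit in auto)
  have deg: "P U = U" if U: "U \<in> symbols_deg k" for k U
  proof -
    note Us = deg_in[OF U]
    have "P U \<alpha> = 0" if "size \<alpha> \<noteq> k" for \<alpha>
    proof -
      have "deg_part (size \<alpha>) (P (deg_part k U)) = 0" using off[of k "size \<alpha>"] that Us by blast
      then have "deg_part (size \<alpha>) (P U) \<alpha> = 0 \<alpha>" using deg_part_of_deg[OF U, of k] by simp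
      then show ?thesis by (simp add: deg_part_def symbol_zero)
    qed
    then have PU: "P U \<in> symbols_deg k" using P(1)[OF Us] unfolding symbols_deg_def by blast
    show ?thesis
    proof (rule symbol_ext)
      fix \<alpha>
      show "P U \<alpha> = U \<alpha>"
      proof (cases "size \<alpha> = k")
        case True
        have "P U \<alpha> = quant_map w r (P U) \<alpha>"
          unfolding quant_map_deg[OF PU] using A_top[OF PU] True by simp
        then show ?thesis using top[OF U True] by (simp add: P(2)[OF Us])
      next
        case False
        then show ?thesis using deg_eq_0[OF PU] deg_eq_0[OF U] by simp
      qed
    qed
  qed
  obtain N where N: "below_deg N T" using below_deg_exists[OF T] by blast
  have "P T = (\<Sum>k<N. P (deg_part k T))" by (rule lin_sum_deg_part[OF linP N])
  also have "\<dots> = T" unfolding deg[OF deg_part_deg[OF T]] by (rule sum_deg_part[OF N, symmetric])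
  finally show ?thesis using P(2)[OF T] by simp
qed

subsection \<open>Existence and uniqueness of the quantization\<close>

lemma diff_ops_eq: "diff_ops = diff_op ` symbols"
proof -
  have "(\<Union>k. coeffs_upto k) = symbols"
  proof
    show "(\<Union>k. coeffs_upto k) \<subseteq> symbols" unfolding coeffs_upto_def by blast
    show "symbols \<subseteq> (\<Union>k. coeffs_upto k)"
    proof
      fix T assume "T \<in> symbols"
      then obtain N where "below_deg N T" using below_deg_exists by blast
      then have "below_deg (Suc N) T" by (rule below_deg_mono) simp
      then show "T \<in> (\<Union>k. coeffs_upto k)" unfolding coeffs_upto_iff[symmetric] by blast
    qed
  qed
  then show ?thesis unfolding diff_ops_def diff_ops_upto_def image_UN[symmetric] by (rule arg_cong)
qed

lemma coeffs_upto_symbols: "c \<in> coeffs_upto k \<Longrightarrow> c \<in> symbols"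
  unfolding coeffs_upto_def by blast

lemma principal_symbol_diff_op:
  assumes "c \<in> coeffs_upto k"
  shows "principal_symbol k (diff_op c) = deg_part k c"
proof -
  have "(THE c'. c' \<in> coeffs_upto k \<and> diff_op c' = diff_op c) = c"
  proof (rule the_equality)
    show "c \<in> coeffs_upto k \<and> diff_op c = diff_op c" using assms by blast
    show "c' = c" if "c' \<in> coeffs_upto k \<and> diff_op c' = diff_op c" for c'
      by (rule diff_op_inj) (use that assms coeffs_upto_symbols in blast)+
  qed
  then show ?thesis unfolding principal_symbol_def deg_part_def by (rule arg_cong)
qed

text \<open>Choosing coefficients for each value of Q gives a linear map because coefficients are
  unique. The principal symbol condition becomes agreement in top degree.\<close>

lemma quantization_coefficients:
  assumes "quantization Q"
  obtains B where "SW.linS B" "\<And>T. T \<in> symbols \<Longrightarrow> Q T = diff_op (B T)"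
    "\<And>k T \<alpha>. T \<in> symbols_deg k \<Longrightarrow> size \<alpha> = k \<Longrightarrow> B T \<alpha> = T \<alpha>"
proof -
  have add: "Q (T + U) = Q T + Q U" if "T \<in> symbols" "U \<in> symbols" for T U
    using assms that unfolding quantization_def by blast
  have scale: "Q (r *\<^sub>R T) = r *\<^sub>R Q T" if "T \<in> symbols" for r T
    using assms that unfolding quantization_def by blast
  have im: "Q ` symbols = diff_op ` symbols"
    using assms unfolding quantization_def bij_betw_def diff_ops_eq by blast
  have deg: "Q T \<in> diff_op ` coeffs_upto k" "principal_symbol k (Q T) = T" if "T \<in> symbols_deg k" for k T
    using assms that unfolding quantization_def diff_ops_upto_def by blast+
  have "\<forall>T\<in>symbols. \<exists>c. c \<in> symbols \<and> Q T = diff_op c" using im by blast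
  then have "\<exists>B. \<forall>T\<in>symbols. B T \<in> symbols \<and> Q T = diff_op (B T)" by (rule bchoice)
  then obtain B where B: "\<And>T. T \<in> symbols \<Longrightarrow> B T \<in> symbols" "\<And>T. T \<in> symbols \<Longrightarrow> Q T = diff_op (B T)"
    by blast
  have lin: "SW.linS B"
    unfolding SW.linS_def
  proof (intro conjI ballI allI)
    fix T assume T: "T \<in> symbols"
    show "B T \<in> symbols" by (rule B(1)[OF T])
    show "B (r *\<^sub>R T) = r *\<^sub>R B T" for r
    proof (rule diff_op_inj[OF B(1)[OF SW.S_scale[OF T]] SW.S_scale[OF B(1)[OF T]]])
      show "diff_op (B (r *\<^sub>R T)) = diff_op (r *\<^sub>R B T)"
        unfolding diff_op_scale[OF B(1)[OF T]] B(2)[OF T, symmetric] B(2)[OF SW.S_scale[OF T], symmetric]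
        by (rule scale[OF T])
    qed
    show "B (T + U) = B T + B U" if U: "U \<in> symbols" for U
    proof (rule diff_op_inj[OF B(1)[OF SW.S_add[OF T U]] SW.S_add[OF B(1)[OF T] B(1)[OF U]]])
      show "diff_op (B (T + U)) = diff_op (B T + B U)"
        unfolding diff_op_add[OF B(1)[OF T] B(1)[OF U]] B(2)[OF T, symmetric] B(2)[OF U, symmetric]
          B(2)[OF SW.S_add[OF T U], symmetric]
        by (rule add[OF T U])
    qed
  qed
  have top: "B T \<alpha> = T \<alpha>" if T: "T \<in> symbols_deg k" and \<alpha>: "size \<alpha> = k" for k T \<alpha>
  proof -
    obtain c where c: "c \<in> coeffs_upto k" "Q T = diff_op c" using deg(1)[OF T] by blast
    have "diff_op (B T) = diff_op c" by (rule trans[OF sym[OF B(2)[OF deg_in[OF T]]] c(2)])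
    then have "B T = c" by (rule diff_op_inj[OF B(1)[OF deg_in[OF T]] coeffs_upto_symbols[OF c(1)]])
    moreover have "deg_part k c = T"
      using deg(2)[OF T] unfolding c(2) principal_symbol_diff_op[OF c(1)] .
    then have "deg_part k c \<alpha> = T \<alpha>" by (rule arg_cong)
    ultimately show ?thesis using \<alpha> by (simp add: deg_part_def)
  qed
  show ?thesis by (rule that[of B]) (rule lin B(2) top | assumption)+
qed

text \<open>From left to right special matrices isolate the generators; from right to left both
  actions are expanded linearly in the generators, with the same coefficients.\<close>

lemma projectively_equivariant_iff:
  assumes B: "SW.linS B" and Q: "\<And>T. T \<in> symbols \<Longrightarrow> Q T = diff_op (B T)"
  shows "projectively_equivariant lam mu Q \<longleftrightarrow> intertwines (mu - lam) lam B"
proof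
  assume eq: "projectively_equivariant lam mu Q"
  show "intertwines (mu - lam) lam B"
    unfolding intertwines_def
  proof (intro ballI conjI)
    fix T k l assume T: "T \<in> symbols" and k: "k \<in> {1..p+q}" and l: "l \<in> {1..p+q}"
    note BT = SW.linS_in[OF B T]
    have e: "lie_op lam mu (vf_pgl M) (diff_op (B T)) = Q (lie_symbol (mu - lam) (vf_pgl M) T)" for M
      using eq T unfolding projectively_equivariant_def Q[OF T, symmetric] by blast
    note VO = vfield_linear_lie_op[OF BT, of lam mu] and VS = vfield_linear_lie_symbol[of "mu - lam" T]
    show "dop l (B T) = B (dop l T)"
      by (rule diff_op_inj[OF SW.d_in[OF l BT] SW.linS_in[OF B SW.d_in[OF l T]]])
        (rule e[of "\<lambda>r c. if r = l \<and> c = 0 then - 1 else 0", unfolded vfield_linear_pgl_const[OF VO l] vfield_linear_pgl_const[OF VS l]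
          lie_op_const[OF BT l] lie_symbol_const[OF T l] Q[OF SW.d_in[OF l T]]])
    show "SW.G (mu - lam) k l (B T) = B (SW.G (mu - lam) k l T)"
      by (rule diff_op_inj[OF SW.G_in[OF k l BT] SW.linS_in[OF B SW.G_in[OF k l T]]])
        (rule e[of "\<lambda>r c. if r = l \<and> c = k then - ((-1) ^ (par k * (par l + par k))) else 0",
          unfolded vfield_linear_pgl_linear[OF VO l k] vfield_linear_pgl_linear[OF VS l k]
          lie_op_linear[OF BT k l] lie_symbol_linear[OF T k l] Q[OF SW.G_in[OF k l T]]])
    show "SW.L' (mu - lam) lam k (B T) = B (SW.L (mu - lam) k T)"
      by (rule diff_op_inj[OF SW.linS_in[OF SW.linS_L'[OF k] BT] SW.linS_in[OF B SW.L_in[OF k T]]])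
        (rule e[of "\<lambda>r c. if r = 0 \<and> c = k then (-1) ^ par k else 0",
          unfolded vfield_linear_pgl_quad[OF VO k] vfield_linear_pgl_quad[OF VS k]
          lie_op_quad[OF BT k] lie_symbol_quad[OF T k] Q[OF SW.L_in[OF k T]]])
  qed
next
  assume int: "intertwines (mu - lam) lam B"
  define \<Phi> where "\<Phi> U = diff_op (B U)" for U
  have \<Phi>_add: "\<Phi> (U + V) = \<Phi> U + \<Phi> V" if "U \<in> symbols" "V \<in> symbols" for U V
    unfolding \<Phi>_def SW.linS_add[OF B that] by (intro diff_op_add SW.linS_in[OF B] that)
  have \<Phi>_scale: "\<Phi> (r *\<^sub>R U) = r *\<^sub>R \<Phi> U" if "U \<in> symbols" for r U
    unfolding \<Phi>_def SW.linS_scale[OF B that] by (intro diff_op_scale SW.linS_in[OF B] that)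
  have \<Phi>_sum: "\<Phi> (\<Sum>a\<in>N. g a) = (\<Sum>a\<in>N. \<Phi> (g a))" if "\<And>a. a \<in> N \<Longrightarrow> g a \<in> symbols"
    for g :: "nat \<Rightarrow> symbol" and N
    unfolding \<Phi>_def
    by (rule trans[OF arg_cong[where f = diff_op, OF SW.linS_sum[OF B]] diff_op_sum]) (rule that SW.linS_in[OF B] | assumption)+
  show "projectively_equivariant lam mu Q"
    unfolding projectively_equivariant_def
  proof (intro allI ballI)
    fix M :: matr and T assume T: "T \<in> symbols"
    note BT = SW.linS_in[OF B T]
    let ?I = "{1..p+q}"
    let ?d = "mu - lam"
    define a b c where "a l = - M l 0"
      and "b k l = - ((-1) ^ (par k * (par l + par k)) * (M l k - (if l = k then M 0 0 else 0)))"
      and "c k = M 0 k * (-1) ^ par k" for k l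
    define S where "S = (\<Sum>l\<in>?I. a l *\<^sub>R dop l T) + (\<Sum>k\<in>?I. \<Sum>l\<in>?I. b k l *\<^sub>R SW.G ?d k l T) + (\<Sum>k\<in>?I. c k *\<^sub>R SW.L ?d k T)"
    have d: "dop l T \<in> symbols" "lie_op lam mu (single l one) (diff_op (B T)) = \<Phi> (dop l T)" if l: "l \<in> ?I" for l
    proof -
      show "dop l T \<in> symbols" by (rule SW.d_in[OF l T])
      have "dop l (B T) = B (dop l T)" using int T l unfolding intertwines_def by blast
      then show "lie_op lam mu (single l one) (diff_op (B T)) = \<Phi> (dop l T)"
        unfolding lie_op_const[OF BT l] \<Phi>_def by (rule arg_cong)
    qed
    have G: "SW.G ?d k l T \<in> symbols" "lie_op lam mu (single l (coord k)) (diff_op (B T)) = \<Phi> (SW.G ?d k l T)"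
      if k: "k \<in> ?I" and l: "l \<in> ?I" for k l
    proof -
      show "SW.G ?d k l T \<in> symbols" by (rule SW.G_in[OF k l T])
      have "SW.G ?d k l (B T) = B (SW.G ?d k l T)" using int T k l unfolding intertwines_def by blast
      then show "lie_op lam mu (single l (coord k)) (diff_op (B T)) = \<Phi> (SW.G ?d k l T)"
        unfolding lie_op_linear[OF BT k l] \<Phi>_def by (rule arg_cong)
    qed
    have L: "SW.L ?d k T \<in> symbols" "lie_op lam mu (quad k) (diff_op (B T)) = \<Phi> (SW.L ?d k T)" if k: "k \<in> ?I" for k
    proof -
      show "SW.L ?d k T \<in> symbols" by (rule SW.L_in[OF k T])
      have "SW.L' ?d lam k (B T) = B (SW.L ?d k T)" using int T k unfolding intertwines_def by blast
      then show "lie_op lam mu (quad k) (diff_op (B T)) = \<Phi> (SW.L ?d k T)"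
        unfolding lie_op_quad[OF BT k] \<Phi>_def by (rule arg_cong)
    qed
    have in1: "(\<Sum>l\<in>?I. a l *\<^sub>R dop l T) \<in> symbols"
      by (intro SW.S_sum SW.S_scale d(1))
    have in2: "(\<Sum>l\<in>?I. b k l *\<^sub>R SW.G ?d k l T) \<in> symbols" if "k \<in> ?I" for k
      by (intro SW.S_sum SW.S_scale G(1) that)
    have in3: "(\<Sum>k\<in>?I. \<Sum>l\<in>?I. b k l *\<^sub>R SW.G ?d k l T) \<in> symbols"
      by (intro SW.S_sum in2)
    have in4: "(\<Sum>k\<in>?I. c k *\<^sub>R SW.L ?d k T) \<in> symbols"
      by (intro SW.S_sum SW.S_scale L(1))
    have "lie_symbol ?d (vf_pgl M) T = S"
      unfolding vfield_linear_vf_pgl[OF vfield_linear_lie_symbol] S_def a_def b_def c_def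
      by (intro arg_cong2[where f = "(+)"] sum.cong refl arg_cong[where f = "scaleR _"]
          lie_symbol_const[OF T] lie_symbol_linear[OF T] lie_symbol_quad[OF T])
    moreover have "S \<in> symbols" unfolding S_def by (intro SW.S_add in1 in3 in4)
    moreover have "lie_op lam mu (vf_pgl M) (Q T) = \<Phi> S"
    proof -
      have "\<Phi> S = (\<Sum>l\<in>?I. a l *\<^sub>R \<Phi> (dop l T)) + (\<Sum>k\<in>?I. \<Sum>l\<in>?I. b k l *\<^sub>R \<Phi> (SW.G ?d k l T)) + (\<Sum>k\<in>?I. c k *\<^sub>R \<Phi> (SW.L ?d k T))"
        unfolding S_def \<Phi>_add[OF SW.S_add[OF in1 in3] in4] \<Phi>_add[OF in1 in3]
      proof (intro arg_cong2[where f = "(+)"])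
        show "\<Phi> (\<Sum>l\<in>?I. a l *\<^sub>R dop l T) = (\<Sum>l\<in>?I. a l *\<^sub>R \<Phi> (dop l T))"
          by (rule trans[OF \<Phi>_sum]) (rule SW.S_scale d(1) sum.cong refl \<Phi>_scale | assumption)+
        show "\<Phi> (\<Sum>k\<in>?I. \<Sum>l\<in>?I. b k l *\<^sub>R SW.G ?d k l T) = (\<Sum>k\<in>?I. \<Sum>l\<in>?I. b k l *\<^sub>R \<Phi> (SW.G ?d k l T))"
        proof (rule trans[OF \<Phi>_sum[OF in2]], assumption, rule sum.cong[OF refl])
          fix k assume k: "k \<in> ?I"
          show "\<Phi> (\<Sum>l\<in>?I. b k l *\<^sub>R SW.G ?d k l T) = (\<Sum>l\<in>?I. b k l *\<^sub>R \<Phi> (SW.G ?d k l T))"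
            by (rule trans[OF \<Phi>_sum]) (rule SW.S_scale G(1) k sum.cong refl \<Phi>_scale | assumption)+
        qed
        show "\<Phi> (\<Sum>k\<in>?I. c k *\<^sub>R SW.L ?d k T) = (\<Sum>k\<in>?I. c k *\<^sub>R \<Phi> (SW.L ?d k T))"
          by (rule trans[OF \<Phi>_sum]) (rule SW.S_scale L(1) sum.cong refl \<Phi>_scale | assumption)+
      qed
      moreover have "lie_op lam mu (vf_pgl M) (diff_op (B T)) =
          (\<Sum>l\<in>?I. a l *\<^sub>R \<Phi> (dop l T)) + (\<Sum>k\<in>?I. \<Sum>l\<in>?I. b k l *\<^sub>R \<Phi> (SW.G ?d k l T)) + (\<Sum>k\<in>?I. c k *\<^sub>R \<Phi> (SW.L ?d k T))"
        unfolding vfield_linear_vf_pgl[OF vfield_linear_lie_op[OF BT]] a_def b_def c_def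
        by (intro arg_cong2[where f = "(+)"] sum.cong refl arg_cong[where f = "scaleR _"] d(2) G(2) L(2))
      ultimately show ?thesis unfolding Q[OF T] by (simp only:)
    qed
    ultimately show "lie_op lam mu (vf_pgl M) (Q T) = Q (lie_symbol ?d (vf_pgl M) T)"
      unfolding \<Phi>_def using Q[of S] by (simp only:)
  qed
qed

text \<open>The condition q \<noteq> p + 1 makes n + 1 nonzero, so the difference of the critical
  polynomials can be cleared of its denominator. The resulting inequality is symmetric in k and l,
  although \<open>critical\<close> orders them.\<close>

lemma noncritical_eigenvalues:
  assumes "q \<noteq> p + 1" "\<not> critical d" "k \<noteq> l"
  shows "d * (SW.sdim + 1) \<noteq> real k + real l + SW.sdim"
proof -
  define n where "n = real p - real q"
  have n: "n + 1 \<noteq> 0" using assms(1) by (simp add: n_def)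
  have *: "d * (n + 1) \<noteq> real k + real l + n" if "l < k" for k l
  proof
    assume d: "d * (n + 1) = real k + real l + n"
    have "real k * (real k + n) = real l * (real l + n) + (real k - real l) * (real k + real l + n)"
      by algebra
    also have "\<dots> = real l * (real l + n) + (real k - real l) * d * (n + 1)" unfolding d[symmetric] by simp
    finally have eq: "real k * (real k + n) / (n + 1) = real l * (real l + n) / (n + 1) + (real k - real l) * d"
      using n by (simp add: field_simps)
    have "n / 2 * d\<^sup>2 - (2 * real k + n) / 2 * d + (Y + (real k - real l) * d) = n / 2 * d\<^sup>2 - (2 * real l + n) / 2 * d + Y" for Y
      by (simp add: field_simps)
    then have "crit_poly k d = crit_poly l d"
      unfolding crit_poly_def Let_def n_def[symmetric] eq .
    then show False using assms(2) that unfolding critical_def by blast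
  qed
  have "SW.sdim = n" unfolding n_def by (rule sdim_eq)
  then show ?thesis using *[of k l] *[of l k] assms(3) by (cases "l < k") (auto simp: add.commute)
qed

text \<open>A quantization is a map on symbols only, while Q is a total function;
  \<open>extensional\<close> fixes its values elsewhere, so that unique existence is
  meaningful.\<close>

theorem ex1_equivariant_quantization:
  assumes "q \<noteq> p + 1" "\<not> critical (mu - lam)"
  shows "\<exists>!Q. Q \<in> extensional symbols \<and> quantization Q \<and> projectively_equivariant lam mu Q"
proof -
  note noncrit = noncritical_eigenvalues[OF assms]
  define A where "A = quant_map (mu - lam) lam"
  define Q where "Q = restrict (\<lambda>T. diff_op (A T)) symbols"
  have Q: "Q T = diff_op (A T)" if "T \<in> symbols" for T
    unfolding Q_def by (rule restrict_apply'[OF that])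
  have lin: "SW.linS A" unfolding A_def by (rule linS_quant_map)
  note A_in = SW.linS_in[OF lin]
  have "quantization Q"
    unfolding quantization_def
  proof (intro conjI ballI allI)
    show "Q (T + U) = Q T + Q U" if "T \<in> symbols" "U \<in> symbols" for T U
      unfolding Q[OF SW.S_add[OF that]] Q[OF that(1)] Q[OF that(2)] SW.linS_add[OF lin that]
      by (intro diff_op_add A_in that)
    show "Q (r *\<^sub>R T) = r *\<^sub>R Q T" if "T \<in> symbols" for r T
      unfolding Q[OF SW.S_scale[OF that]] Q[OF that] SW.linS_scale[OF lin that]
      by (intro diff_op_scale A_in that)
    show "bij_betw Q symbols diff_ops"
      unfolding bij_betw_def
    proof
      show "inj_on Q symbols"
      proof (rule inj_onI)
        fix T U assume TU: "T \<in> symbols" "U \<in> symbols" "Q T = Q U"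
        have "A T = A U"
          using diff_op_inj[OF A_in[OF TU(1)] A_in[OF TU(2)]] TU(3) unfolding Q[OF TU(1)] Q[OF TU(2)] by blast
        then show "T = U" unfolding A_def by (rule quant_map_inj[OF TU(1,2)])
      qed
      have "A ` symbols = symbols"
      proof
        show "A ` symbols \<subseteq> symbols" using A_in by blast
        show "symbols \<subseteq> A ` symbols"
        proof
          fix c assume "c \<in> symbols"
          then obtain N where "below_deg N c" using below_deg_exists by blast
          then obtain T where "T \<in> symbols" "A T = c" unfolding A_def using quant_map_surj by blast
          then show "c \<in> A ` symbols" by blast
        qed
      qed
      then have "diff_op ` A ` symbols = diff_ops" unfolding diff_ops_eq by (rule arg_cong)
      moreover have "Q ` symbols = diff_op ` A ` symbols"
        unfolding image_image by (rule image_cong[OF refl Q])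
      ultimately show "Q ` symbols = diff_ops" by simp
    qed
    fix k T assume T: "T \<in> symbols_deg k"
    have AT: "A T \<in> coeffs_upto k"
      unfolding A_def coeffs_upto_iff by (rule quant_map_below_deg[OF symbols_deg_below[OF T]])
    show "Q T \<in> diff_ops_upto k" unfolding Q[OF deg_in[OF T]] diff_ops_upto_def using AT by (rule imageI)
    show "principal_symbol k (Q T) = T"
      unfolding Q[OF deg_in[OF T]] principal_symbol_diff_op[OF AT]
    proof (rule symbol_ext)
      fix \<alpha>
      show "deg_part k (A T) \<alpha> = T \<alpha>"
        using quant_map_top[OF symbols_deg_below[OF T], of \<alpha> "mu - lam" lam] deg_eq_0[OF T, of \<alpha>]
        unfolding A_def by (cases "size \<alpha> = k") (simp_all add: deg_part_def)
    qed
  qed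
  moreover have "projectively_equivariant lam mu Q"
  proof -
    have "intertwines (mu - lam) lam A" unfolding A_def by (rule intertwines_quant_map) (use noncrit in auto)
    then show ?thesis using projectively_equivariant_iff[where B = A and Q = Q, OF lin Q] by blast
  qed
  moreover have "Q \<in> extensional symbols" unfolding Q_def by (rule restrict_extensional)
  moreover have "Q' = Q" if Q': "Q' \<in> extensional symbols" "quantization Q'" "projectively_equivariant lam mu Q'" for Q'
  proof -
    obtain B where B: "SW.linS B" "\<And>T. T \<in> symbols \<Longrightarrow> Q' T = diff_op (B T)"
      "\<And>k T \<alpha>. T \<in> symbols_deg k \<Longrightarrow> size \<alpha> = k \<Longrightarrow> B T \<alpha> = T \<alpha>"
      using quantization_coefficients[OF Q'(2)] by blast
    have int: "intertwines (mu - lam) lam B"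
      using projectively_equivariant_iff[where B = B and Q = Q', OF B(1,2)] Q'(3) by blast
    have "B T = A T" if "T \<in> symbols" for T
      unfolding A_def by (rule intertwines_unique[where B = B]) (rule noncrit B(1) int B(3) that | assumption)+
    then show ?thesis
      by (intro extensionalityI[OF Q'(1) \<open>Q \<in> extensional symbols\<close>]) (simp only: B(2) Q)
  qed
  ultimately show ?thesis by (intro ex1I[of _ Q] conjI) blast+
qed

end

theorem theorem4p2p1:
  fixes p q :: nat and lam mu \<delta> :: real
  assumes "q \<noteq> p + 1"
    and "\<delta> = mu - lam"
    and "\<not> superspace.critical p q \<delta>"
  shows "\<exists>!Q. Q \<in> extensional (superspace.symbols p q) \<and>
           superspace.quantization p q Q \<and>
           superspace.projectively_equivariant p q lam mu Q"
  using assms(3) unfolding assms(2) by (rule superspace.ex1_equivariant_quantization[OF assms(1)])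

end
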